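(* Let $\boldsymbol p=(p,0)$ or $\boldsymbol p=(0,p)$ with $p\in\mathbb N=\{1,2,\dots\}$. A map $W:\mathcal B(\mathcal H_{\boldsymbol p})\to C^\infty_{\mathbb C}(\mathbb CP^2)$, $A\mapsto W_A$, is a symbol correspondence if and only if $$W_A(\mathrm x)=\operatorname{tr}(A\,K(\mathrm x))\qquad(A\in\mathcal B(\mathcal H_{\boldsymbol p}),\ \mathrm x\in\mathbb CP^2)$$ for an operator $K\in\mathcal B(\mathcal H_{\boldsymbol p})$ (its operator kernel) of the form $$K=\sum_{n=0}^p c_n\sqrt{\frac{(n+1)^3}{\dim(\boldsymbol p)}}\;\boldsymbol e(n;\boldsymbol 0_n,0)=\frac{1}{\dim(\boldsymbol p)}\mathds 1+\sum_{n=1}^p c_n\sqrt{\frac{(n+1)^3}{\dim(\boldsymbol p)}}\;\boldsymbol e(n;\boldsymbol 0_n,0),$$ with $(c_1,\dots,c_p)\in(\mathbb R^\times)^p$ and $c_0=1$. In particular, $W$ maps $$\sqrt{\dim(\boldsymbol p)}\;\boldsymbol e(n;\boldsymbol\nu,J)\ \mapsto\ c_n X^n_{\boldsymbol\nu,J}.$$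
   Context: Representations. In a representation of $SU(3)$ (extended to $\mathfrak{sl}(3,\mathbb C)$) let $T_+,T_-,T_3,U_+,U_-,U_3$ be the images of $E_{12},E_{21},\tfrac12(E_{11}-E_{22}),E_{23},E_{32},\tfrac12(E_{22}-E_{33})$. For $\boldsymbol p=(p,q)\in\mathbb N_0^2$, "the irrep $\boldsymbol p$" is the unitary irrep on a Hilbert space $\mathcal H_{\boldsymbol p}$ whose highest weight vector has eigenvalue $p/2$ for $T_3$ and $q/2$ for $U_3$; $\dim(\boldsymbol p)=\frac{(p+1)(q+1)(p+q+2)}2$, $|\boldsymbol p|=p+q$, $\check{\boldsymbol p}=(q,p)$ (the dual irrep). Inner products are linear in the second entry. Gelfand-Tsetlin (GT) basis: an orthonormal basis $\{\boldsymbol e(\boldsymbol p;\boldsymbol\nu,J)\}$ indexed by $\boldsymbol\nu=(\nu_1,\nu_2,\nu_3)$ and $J$ where, for integers $0\le r_-\le q\le r_+\le p+q$ and $r_-\le\nu_3\le r_+$: $\nu_1=p+2q-(r_++r_-)$, $\nu_2=r_++r_--\nu_3$, $J=\frac12(r_+-r_-)$. Put $t_{\boldsymbol\nu}=\frac{\nu_1-\nu_2}2$, $u_{\boldsymbol\nu}=\frac{\nu_2-\nu_3}2$ (the eigenvalues of $T_3,U_3$). The basis is determined by a unit highest weight vector $\boldsymbol e(\boldsymbol p;(p+q,q,0),q/2)$ via, with $u=u_{\boldsymbol\nu}$, $U_-\boldsymbol e(\boldsymbol p;\boldsymbol\nu,J)=\sqrt{(J+u)(J-u+1)}\,\boldsymbol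 e(\boldsymbol p;(\nu_1,\nu_2-1,\nu_3+1),J)$ and $T_-\boldsymbol e(\boldsymbol p;\boldsymbol\nu,J)=\sqrt{\tfrac{(J-u)(p+q+J-u-\nu_3+1)(q+J-u-\nu_3)(u-J+\nu_3+1)}{2J(2J+1)}}\,\boldsymbol e(\boldsymbol p;(\nu_1-1,\nu_2+1,\nu_3),J-\tfrac12)+\sqrt{\tfrac{(J+u+1)(p+q-J-u-\nu_3)(J+u+1+\nu_3-q)(J+u+2+\nu_3)}{2(J+1)(2J+1)}}\,\boldsymbol e(\boldsymbol p;(\nu_1-1,\nu_2+1,\nu_3),J+\tfrac12)$ (terms with zero numerator are $0$). For a GT label $\boldsymbol\nu$ of $\boldsymbol p$ put $\check{\boldsymbol\nu}=(|\boldsymbol p|,|\boldsymbol p|,|\boldsymbol p|)-\boldsymbol\nu$, a GT label of $\check{\boldsymbol p}$. The induced GT basis of the dual $\mathcal H_{\check{\boldsymbol p}}=\mathcal H_{\boldsymbol p}^*$ is $\check{\boldsymbol e}(\check{\boldsymbol p};\check{\boldsymbol\nu},J)=(-1)^{2(t_{\boldsymbol\nu}+u_{\boldsymbol\nu})}\boldsymbol e^*(\boldsymbol p;\boldsymbol\nu,J)$. Wigner functions: $D^{\boldsymbol p}_{\boldsymbol\nu J,\boldsymbol\mu L}(g)=\langle\boldsymbol e(\boldsymbol p;\boldsymbol\nu,J)|\rho(g)\boldsymbol e(\boldsymbol p;\boldsymbol\mu,L)\rangle$. Operators. $\mathcal B(\mathcal H_{\boldsymbol p})\simeq\mathcal H_{\boldsymbol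 p}\otimes\mathcal H_{\boldsymbol p}^*$ carries the action $A^g=\rho(g)A\rho(g)^{-1}$ and the inner product $\operatorname{tr}(A^\dagger B)$. For $\boldsymbol p=(p,0)$ or $(0,p)$ it decomposes without multiplicity as $\bigoplus_{n=0}^p(n,n)$. A coupled basis $\{\boldsymbol e(n;\boldsymbol\nu,J)\}$ is the union of GT bases $\boldsymbol e(n;\boldsymbol\nu,J)$ of the subrepresentations $(n,n)\subset\mathcal B(\mathcal H_{\boldsymbol p})$, with phases chosen so that all coefficients with respect to the uncoupled basis $\boldsymbol e(\boldsymbol p;\boldsymbol\nu_1,J_1)\otimes\check{\boldsymbol e}(\check{\boldsymbol p};\boldsymbol\nu_2,J_2)$ (Clebsch-Gordan coefficients) are real, and $\boldsymbol e(0;(0,0,0),0)=\mathds 1/\sqrt{\dim\boldsymbol p}$. Put $\boldsymbol 0_n=(n,n,n)$. Phase space. $\mathbb CP^2\simeq SU(3)/H$, where $H=\{\mathrm{diag}(\det(U)^{-1},U):U\in U(2)\}$ is the isotropy group of $\mathrm x_0=[1:0:0]$, with the $SU(3)$-invariant integral of total mass $1$. Harmonics: $X^n_{\boldsymbol\nu,J}(g\mathrm x_0)=(n+1)^{3/2}\,\overline{D^{(n,n)}_{\boldsymbol\nu J,\boldsymbol 0_n0}(g)}$. For $K\in\mathcal B(\mathcal H_{\boldsymbol p})$ fixed by $H$, $K(g\mathrm x_0):=K^g$. A symbol correspondence $W:\mathcal B(\mathcal H_{\boldsymbol p})\to C^\infty_{\mathbb C}(\mathbb CP^2)$ is an injective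 linear map with: (1) $W_{A^g}=(W_A)^g$ for all $g\in SU(3)$, where $f^g(\mathrm x)=f(g^{-1}\mathrm x)$; (2) $W_{A^\dagger}=\overline{W_A}$; (3) $\int_{\mathbb CP^2}W_A\,d\mathrm x=\operatorname{tr}(A)/\dim(\boldsymbol p)$. *)

theory Defs
  imports "HOL-Analysis.Analysis"
begin

section \<open>Finite-dimensional complex Hilbert spaces\<close>

text \<open>The inner product is linear in the second entry; its real part is the Euclidean inner
  product of the underlying real space, so both structures induce the same norm.\<close>

class complex_euclidean = euclidean_space +
  fixes scaleC :: "complex \<Rightarrow> 'a \<Rightarrow> 'a" (infixr "*\<^sub>C" 75)
    and cinner :: "'a \<Rightarrow> 'a \<Rightarrow> complex"
  assumes scaleC_add_right: "a *\<^sub>C (x + y) = a *\<^sub>C x + a *\<^sub>C y"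
    and scaleC_add_left: "(a + b) *\<^sub>C x = a *\<^sub>C x + b *\<^sub>C x"
    and scaleC_scaleC: "a *\<^sub>C (b *\<^sub>C x) = (a * b) *\<^sub>C x"
    and scaleC_of_real: "complex_of_real r *\<^sub>C x = r *\<^sub>R x"
    and cinner_commute: "cinner x y = cnj (cinner y x)"
    and cinner_add_right: "cinner x (y + z) = cinner x y + cinner x z"
    and cinner_scaleC_right: "cinner x (a *\<^sub>C y) = a * cinner x y"
    and Re_cinner: "Re (cinner x y) = x \<bullet> y"

instantiation complex :: complex_euclidean
begin

definition scaleC_complex :: "complex \<Rightarrow> complex \<Rightarrow> complex"
  where "scaleC_complex a x = a * x"

definition cinner_complex :: "complex \<Rightarrow> complex \<Rightarrow> complex"
  where "cinner_complex x y = cnj x * y"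

instance
  by standard
    (auto simp: scaleC_complex_def cinner_complex_def algebra_simps scaleR_conv_of_real
      inner_complex_def)

end

instantiation vec :: (complex_euclidean, finite) complex_euclidean
begin

definition scaleC_vec :: "complex \<Rightarrow> 'a ^ 'b \<Rightarrow> 'a ^ 'b"
  where "scaleC_vec a x = (\<chi> i. a *\<^sub>C (x $ i))"

definition cinner_vec :: "'a ^ 'b \<Rightarrow> 'a ^ 'b \<Rightarrow> complex"
  where "cinner_vec x y = (\<Sum>i\<in>UNIV. cinner (x $ i) (y $ i))"

instance
proof
  fix x y :: "'a ^ 'b"
  show "cinner x y = cnj (cinner y x)"
    unfolding cinner_vec_def cnj_sum by (rule sum.cong[OF refl cinner_commute])
qed (auto simp: scaleC_vec_def cinner_vec_def vec_eq_iff inner_vec_def scaleC_add_right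
      scaleC_add_left scaleC_scaleC scaleC_of_real cinner_add_right cinner_scaleC_right
      Re_cinner sum.distrib sum_distrib_left)

end

global_interpretation complex_vector:
    vector_space "scaleC :: complex \<Rightarrow> 'a::complex_euclidean \<Rightarrow> 'a"
  using scaleC_of_real[of 1]
  by unfold_locales (auto simp: scaleC_add_right scaleC_add_left scaleC_scaleC)

definition dagger :: "complex^'n^'m \<Rightarrow> complex^'m^'n"
  where "dagger A = (\<chi> i j. cnj (A $ j $ i))"

text \<open>On operators, the inner product of the class is the trace inner product.\<close>

lemma cinner_matrix: "cinner A B = trace (dagger A ** B)" for A B :: "complex^'d^'d"
  unfolding cinner_vec_def cinner_complex_def trace_def dagger_def matrix_matrix_mult_def
  by (simp, rule sum.swap)


section \<open>Representations of SU(3)\<close>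

definition SU3 :: "(complex^3^3) set"
  where "SU3 = {g. dagger g ** g = mat 1 \<and> det g = 1}"

primrec matrix_pow :: "complex^'n^'n \<Rightarrow> nat \<Rightarrow> complex^'n^'n" where
  "matrix_pow A 0 = mat 1"
| "matrix_pow A (Suc k) = A ** matrix_pow A k"

definition mexp :: "complex^'n^'n \<Rightarrow> complex^'n^'n"
  where "mexp A = (\<Sum>k. (1 / fact k) *\<^sub>R matrix_pow A k)"

definition unitary_rep :: "(complex^3^3 \<Rightarrow> 'v \<Rightarrow> 'v) \<Rightarrow> 'v::complex_euclidean set \<Rightarrow> bool"
  where "unitary_rep \<alpha> V \<longleftrightarrow>
    complex_vector.subspace V
    \<and> (\<forall>g\<in>SU3. \<forall>v\<in>V. \<alpha> g v \<in> V)
    \<and> (\<forall>g\<in>SU3. \<forall>v\<in>V. \<forall>w\<in>V. \<forall>a. \<alpha> g (a *\<^sub>C v + w) = a *\<^sub>C \<alpha> g v + \<alpha> g w)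
    \<and> (\<forall>v\<in>V. \<alpha> (mat 1) v = v)
    \<and> (\<forall>g\<in>SU3. \<forall>h\<in>SU3. \<forall>v\<in>V. \<alpha> (g ** h) v = \<alpha> g (\<alpha> h v))
    \<and> (\<forall>g\<in>SU3. \<forall>v\<in>V. \<forall>w\<in>V. cinner (\<alpha> g v) (\<alpha> g w) = cinner v w)
    \<and> (\<forall>v\<in>V. continuous_on SU3 (\<lambda>g. \<alpha> g v))"

definition irreducible_rep :: "(complex^3^3 \<Rightarrow> 'v \<Rightarrow> 'v) \<Rightarrow> 'v::complex_euclidean set \<Rightarrow> bool"
  where "irreducible_rep \<alpha> V \<longleftrightarrow> V \<noteq> {0} \<and>
    (\<forall>U. complex_vector.subspace U \<and> U \<subseteq> V \<and> (\<forall>g\<in>SU3. \<forall>v\<in>U. \<alpha> g v \<in> U) \<longrightarrow> U = {0} \<or> U = V)"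

text \<open>The infinitesimal action of su(3), and its complex linear extension to sl(3) along
  \<open>Z = A + \<i> B\<close> with \<open>A = (Z - Z\<^sup>\<dagger>)/2\<close> and \<open>B = (Z + Z\<^sup>\<dagger>)/(2\<i>)\<close> skew-Hermitian.\<close>

definition su3_action :: "(complex^3^3 \<Rightarrow> 'v \<Rightarrow> 'v) \<Rightarrow> complex^3^3 \<Rightarrow> 'v \<Rightarrow> 'v::complex_euclidean"
  where "su3_action \<alpha> X v = vector_derivative (\<lambda>t::real. \<alpha> (mexp (t *\<^sub>R X)) v) (at 0)"

definition sl3_action :: "(complex^3^3 \<Rightarrow> 'v \<Rightarrow> 'v) \<Rightarrow> complex^3^3 \<Rightarrow> 'v \<Rightarrow> 'v::complex_euclidean"
  where "sl3_action \<alpha> Z v =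
    su3_action \<alpha> ((1 / 2) *\<^sub>C (Z - dagger Z)) v
    + \<i> *\<^sub>C su3_action \<alpha> ((1 / (2 * \<i>)) *\<^sub>C (Z + dagger Z)) v"

definition unit_matrix :: "3 \<Rightarrow> 3 \<Rightarrow> complex^3^3"
  where "unit_matrix i j = (\<chi> a b. if a = i \<and> b = j then 1 else 0)"

definition "T_plus \<alpha> = sl3_action \<alpha> (unit_matrix 1 2)"
definition "T_minus \<alpha> = sl3_action \<alpha> (unit_matrix 2 1)"
definition "T_three \<alpha> = sl3_action \<alpha> ((1 / 2) *\<^sub>C (unit_matrix 1 1 - unit_matrix 2 2))"
definition "U_plus \<alpha> = sl3_action \<alpha> (unit_matrix 2 3)"
definition "U_minus \<alpha> = sl3_action \<alpha> (unit_matrix 3 2)"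
definition "U_three \<alpha> = sl3_action \<alpha> ((1 / 2) *\<^sub>C (unit_matrix 2 2 - unit_matrix 3 3))"

definition highest_weight_vector ::
    "(complex^3^3 \<Rightarrow> 'v \<Rightarrow> 'v) \<Rightarrow> nat \<times> nat \<Rightarrow> 'v::complex_euclidean \<Rightarrow> bool"
  where "highest_weight_vector \<alpha> P v \<longleftrightarrow> v \<noteq> 0 \<and> T_plus \<alpha> v = 0 \<and> U_plus \<alpha> v = 0
    \<and> T_three \<alpha> v = (real (fst P) / 2) *\<^sub>R v \<and> U_three \<alpha> v = (real (snd P) / 2) *\<^sub>R v"

definition irrep :: "(complex^3^3 \<Rightarrow> 'v \<Rightarrow> 'v) \<Rightarrow> 'v::complex_euclidean set \<Rightarrow> nat \<times> nat \<Rightarrow> bool"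
  where "irrep \<alpha> V P \<longleftrightarrow>
    unitary_rep \<alpha> V \<and> irreducible_rep \<alpha> V \<and> (\<exists>v\<in>V. highest_weight_vector \<alpha> P v)"

definition irrep_dim :: "nat \<times> nat \<Rightarrow> real"
  where "irrep_dim = (\<lambda>(p, q). (real p + 1) * (real q + 1) * (real p + real q + 2) / 2)"

definition irrep_size :: "nat \<times> nat \<Rightarrow> nat"
  where "irrep_size = (\<lambda>(p, q). p + q)"

definition irrep_dual :: "nat \<times> nat \<Rightarrow> nat \<times> nat"
  where "irrep_dual = (\<lambda>(p, q). (q, p))"

text \<open>For \<open>\<rho> g\<close> given as matrices: the action on vectors, and \<open>A\<^sup>g\<close> on operators.\<close>

definition vector_action :: "(complex^3^3 \<Rightarrow> complex^'d^'d) \<Rightarrow> complex^3^3 \<Rightarrow> complex^'d \<Rightarrow> complex^'d"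
  where "vector_action \<rho> g v = \<rho> g *v v"

definition operator_action ::
    "(complex^3^3 \<Rightarrow> complex^'d^'d) \<Rightarrow> complex^3^3 \<Rightarrow> complex^'d^'d \<Rightarrow> complex^'d^'d"
  where "operator_action \<rho> g A = \<rho> g ** A ** matrix_inv (\<rho> g)"


section \<open>Gelfand-Tsetlin bases\<close>

type_synonym weight = "int \<times> int \<times> int"

definition gt_labels :: "nat \<times> nat \<Rightarrow> (weight \<times> real) set"
  where "gt_labels = (\<lambda>(p, q).
    {((int p + 2 * int q - (r + s), r + s - \<nu>\<^sub>3, \<nu>\<^sub>3), real_of_int (r - s) / 2) | r s \<nu>\<^sub>3.
      0 \<le> s \<and> s \<le> int q \<and> int q \<le> r \<and> r \<le> int p + int q \<and> s \<le> \<nu>\<^sub>3 \<and> \<nu>\<^sub>3 \<le> r})"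

text \<open>At labels outside \<open>gt_labels\<close> a family \<open>e\<close> is unconstrained. The lowering
  formulas mention such labels only with coefficient 0; for \<open>J = 0\<close> the first coefficient of
  \<open>T_minus\<close> has numerator 0 and is \<open>0 / 0 = 0\<close>.\<close>

definition gt_basis ::
    "(complex^3^3 \<Rightarrow> 'v \<Rightarrow> 'v) \<Rightarrow> 'v::complex_euclidean set \<Rightarrow> nat \<times> nat
      \<Rightarrow> (weight \<Rightarrow> real \<Rightarrow> 'v) \<Rightarrow> bool"
  where "gt_basis \<alpha> V P e \<longleftrightarrow> (let p = fst P; q = snd P in
    (\<forall>(\<nu>, J)\<in>gt_labels P. \<forall>(\<mu>, L)\<in>gt_labels P.
       cinner (e \<nu> J) (e \<mu> L) = (if (\<nu>, J) = (\<mu>, L) then 1 else 0))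
    \<and> complex_vector.span {e \<nu> J | \<nu> J. (\<nu>, J) \<in> gt_labels P} = V
    \<and> highest_weight_vector \<alpha> P (e (int p + int q, int q, 0) (real q / 2))
    \<and> (\<forall>\<nu>\<^sub>1 \<nu>\<^sub>2 \<nu>\<^sub>3 J. ((\<nu>\<^sub>1, \<nu>\<^sub>2, \<nu>\<^sub>3), J) \<in> gt_labels P \<longrightarrow>
        (let u = real_of_int (\<nu>\<^sub>2 - \<nu>\<^sub>3) / 2; n = real_of_int \<nu>\<^sub>3 in
         U_minus \<alpha> (e (\<nu>\<^sub>1, \<nu>\<^sub>2, \<nu>\<^sub>3) J) =
           sqrt ((J + u) * (J - u + 1)) *\<^sub>R e (\<nu>\<^sub>1, \<nu>\<^sub>2 - 1, \<nu>\<^sub>3 + 1) J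
         \<and> T_minus \<alpha> (e (\<nu>\<^sub>1, \<nu>\<^sub>2, \<nu>\<^sub>3) J) =
           sqrt ((J - u) * (p + q + J - u - n + 1) * (q + J - u - n) * (u - J + n + 1)
                 / (2 * J * (2 * J + 1))) *\<^sub>R e (\<nu>\<^sub>1 - 1, \<nu>\<^sub>2 + 1, \<nu>\<^sub>3) (J - 1 / 2)
           + sqrt ((J + u + 1) * (p + q - J - u - n) * (J + u + 1 + n - q) * (J + u + 2 + n)
                 / (2 * (J + 1) * (2 * J + 1))) *\<^sub>R e (\<nu>\<^sub>1 - 1, \<nu>\<^sub>2 + 1, \<nu>\<^sub>3) (J + 1 / 2))))"

definition wigner ::
    "(complex^3^3 \<Rightarrow> 'v \<Rightarrow> 'v) \<Rightarrow> (weight \<Rightarrow> real \<Rightarrow> 'v::complex_euclidean)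
      \<Rightarrow> weight \<Rightarrow> real \<Rightarrow> weight \<Rightarrow> real \<Rightarrow> complex^3^3 \<Rightarrow> complex"
  where "wigner \<alpha> e \<nu> J \<mu> L g = cinner (e \<nu> J) (\<alpha> g (e \<mu> L))"

definition dual_weight :: "nat \<times> nat \<Rightarrow> weight \<Rightarrow> weight"
  where "dual_weight P = (\<lambda>(\<nu>\<^sub>1, \<nu>\<^sub>2, \<nu>\<^sub>3).
    (int (irrep_size P) - \<nu>\<^sub>1, int (irrep_size P) - \<nu>\<^sub>2, int (irrep_size P) - \<nu>\<^sub>3))"

text \<open>A functional \<open>w \<mapsto> (\<Sum>j. f\<^sub>j w\<^sub>j)\<close> is represented by its coefficient vector \<open>f\<close>, so that
  \<open>v\<^sup>*\<close> has the coefficients \<open>cnj (v\<^sub>j)\<close> and \<open>v \<otimes> f\<close> is the operator \<open>w \<mapsto> f(w) v\<close>.\<close>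

definition covector :: "complex^'d \<Rightarrow> complex^'d"
  where "covector v = (\<chi> j. cnj (v $ j))"

definition tensor :: "complex^'d \<Rightarrow> complex^'d \<Rightarrow> complex^'d^'d"
  where "tensor v f = (\<chi> i j. v $ i * f $ j)"

text \<open>The induced GT basis of the dual, indexed by labels of \<open>irrep_dual P\<close>; \<open>dual_weight P\<close> is an
  involution, and \<open>2 (t\<^sub>\<nu> + u\<^sub>\<nu>) = \<nu>\<^sub>1 - \<nu>\<^sub>3\<close>.\<close>

definition dual_gt ::
    "nat \<times> nat \<Rightarrow> (weight \<Rightarrow> real \<Rightarrow> complex^'d) \<Rightarrow> weight \<Rightarrow> real \<Rightarrow> complex^'d"
  where "dual_gt P e \<mu> J = (case dual_weight P \<mu> of (\<nu>\<^sub>1, \<nu>\<^sub>2, \<nu>\<^sub>3) \<Rightarrow>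
    ((- 1) powi (\<nu>\<^sub>1 - \<nu>\<^sub>3)) *\<^sub>C covector (e (\<nu>\<^sub>1, \<nu>\<^sub>2, \<nu>\<^sub>3) J))"

definition coupled_basis ::
    "(complex^3^3 \<Rightarrow> complex^'d^'d) \<Rightarrow> nat \<times> nat \<Rightarrow> (weight \<Rightarrow> real \<Rightarrow> complex^'d)
      \<Rightarrow> (nat \<Rightarrow> weight \<Rightarrow> real \<Rightarrow> complex^'d^'d) \<Rightarrow> bool"
  where "coupled_basis \<rho> P e E \<longleftrightarrow>
    (\<forall>n\<le>irrep_size P. \<exists>V. irrep (operator_action \<rho>) V (n, n)
       \<and> gt_basis (operator_action \<rho>) V (n, n) (E n))
    \<and> (\<forall>n\<le>irrep_size P. \<forall>m\<le>irrep_size P. n \<noteq> m \<longrightarrow>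
       (\<forall>(\<nu>, J)\<in>gt_labels (n, n). \<forall>(\<mu>, L)\<in>gt_labels (m, m). cinner (E n \<nu> J) (E m \<mu> L) = 0))
    \<and> complex_vector.span {E n \<nu> J | n \<nu> J. n \<le> irrep_size P \<and> (\<nu>, J) \<in> gt_labels (n, n)} = UNIV
    \<and> (\<forall>n\<le>irrep_size P. \<forall>(\<nu>, J)\<in>gt_labels (n, n).
       \<forall>(\<nu>', J')\<in>gt_labels P. \<forall>(\<nu>'', J'')\<in>gt_labels (irrep_dual P).
         cinner (tensor (e \<nu>' J') (dual_gt P e \<nu>'' J'')) (E n \<nu> J) \<in> \<real>)
    \<and> E 0 (0, 0, 0) 0 = (1 / sqrt (irrep_dim P)) *\<^sub>R mat 1"

definition zero_weight :: "nat \<Rightarrow> weight"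
  where "zero_weight n = (int n, int n, int n)"


section \<open>The complex projective plane\<close>

typedef cp2 = "{range (\<lambda>c. c *\<^sub>C v) | v :: complex^3. v \<noteq> 0}"
  by (rule exI[of _ "range (\<lambda>c. c *\<^sub>C axis 1 1)"]) (auto intro!: exI[of _ "axis 1 1"])

definition proj :: "complex^3 \<Rightarrow> cp2"
  where "proj v = Abs_cp2 (range (\<lambda>c. c *\<^sub>C v))"

definition cp2_act :: "complex^3^3 \<Rightarrow> cp2 \<Rightarrow> cp2"
  where "cp2_act g x = Abs_cp2 ((\<lambda>v. g *v v) ` Rep_cp2 x)"

lemma cp2_act_proj: "cp2_act g (proj v) = proj (g *v v)" if "v \<noteq> 0"
proof -
  have "g *v (c *\<^sub>C v) = c *\<^sub>C (g *v v)" for c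
    by (simp add: vec_eq_iff matrix_vector_mult_def scaleC_vec_def scaleC_complex_def
        sum_distrib_left algebra_simps)
  moreover have "Rep_cp2 (proj v) = range (\<lambda>c. c *\<^sub>C v)"
    unfolding proj_def using that by (intro Abs_cp2_inverse) blast
  ultimately show ?thesis
    by (simp add: cp2_act_def proj_def image_image)
qed

definition base_point :: cp2
  where "base_point = proj (vector [1, 0, 0])"

text \<open>The quotient topology.\<close>

instantiation cp2 :: topological_space
begin

definition open_cp2 :: "cp2 set \<Rightarrow> bool"
  where "open_cp2 S \<longleftrightarrow> open {v. v \<noteq> 0 \<and> proj v \<in> S}"

instance
proof
  show "open (UNIV :: cp2 set)"
    by (simp add: open_cp2_def open_Collect_neq)
next
  fix S T :: "cp2 set"
  assume "open S" "open T"
  moreover have "{v. v \<noteq> 0 \<and> proj v \<in> S \<inter> T}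
      = {v. v \<noteq> 0 \<and> proj v \<in> S} \<inter> {v. v \<noteq> 0 \<and> proj v \<in> T}" by blast
  ultimately show "open (S \<inter> T)" by (simp add: open_cp2_def open_Int)
next
  fix K :: "cp2 set set"
  assume "\<forall>S\<in>K. open S"
  moreover have "{v. v \<noteq> 0 \<and> proj v \<in> \<Union>K} = (\<Union>S\<in>K. {v. v \<noteq> 0 \<and> proj v \<in> S})" by blast
  ultimately show "open (\<Union>K)" by (simp add: open_cp2_def open_UN)
qed

end

text \<open>\<open>M\<close> is the \<open>SU(3)\<close>-invariant Borel probability measure (which is unique, the action being
  transitive).\<close>

definition invariant_probability :: "cp2 measure \<Rightarrow> bool"
  where "invariant_probability M \<longleftrightarrow> sets M = sets borel \<and> emeasure M (space M) = 1
    \<and> (\<forall>g\<in>SU3. distr M M (cp2_act g) = M)"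

text \<open>\<open>C\<^sup>k\<close> over the reals: all iterated directional derivatives up to order \<open>k\<close> exist (as values of
  Frechet derivatives) and are continuous.\<close>

primrec Ck :: "nat \<Rightarrow> ('a::real_normed_vector \<Rightarrow> 'b::real_normed_vector) \<Rightarrow> bool" where
  "Ck 0 f \<longleftrightarrow> continuous_on UNIV f"
| "Ck (Suc k) f \<longleftrightarrow> (\<forall>x. f differentiable (at x)) \<and> (\<forall>v. Ck k (\<lambda>x. frechet_derivative f (at x) v))"

text \<open>Smoothness in the three affine charts.\<close>

definition cp2_smooth :: "(cp2 \<Rightarrow> complex) \<Rightarrow> bool"
  where "cp2_smooth f \<longleftrightarrow> (\<forall>k.
    Ck k (\<lambda>(z, w). f (proj (vector [1, z, w])))
    \<and> Ck k (\<lambda>(z, w). f (proj (vector [z, 1, w])))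
    \<and> Ck k (\<lambda>(z, w). f (proj (vector [z, w, 1]))))"


section \<open>Harmonics, kernels, symbol correspondences\<close>

text \<open>A function on \<open>SU(3)/H\<close> given by its values \<open>F g\<close> at the points \<open>g x\<^sub>0\<close>; meaningful when
  \<open>F\<close> is constant on the left cosets of the isotropy group \<open>H\<close> of \<open>x\<^sub>0\<close>.\<close>

definition descend :: "(complex^3^3 \<Rightarrow> 'b) \<Rightarrow> cp2 \<Rightarrow> 'b"
  where "descend F x = (THE y. \<forall>g\<in>SU3. cp2_act g base_point = x \<longrightarrow> F g = y)"

definition harmonic ::
    "(complex^3^3 \<Rightarrow> 'v \<Rightarrow> 'v) \<Rightarrow> (weight \<Rightarrow> real \<Rightarrow> 'v::complex_euclidean)
      \<Rightarrow> nat \<Rightarrow> weight \<Rightarrow> real \<Rightarrow> cp2 \<Rightarrow> complex"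
  where "harmonic \<sigma> f n \<nu> J =
    descend (\<lambda>g. of_real ((real n + 1) powr (3 / 2)) * cnj (wigner \<sigma> f \<nu> J (zero_weight n) 0 g))"

definition kernel_at ::
    "(complex^3^3 \<Rightarrow> complex^'d^'d) \<Rightarrow> complex^'d^'d \<Rightarrow> cp2 \<Rightarrow> complex^'d^'d"
  where "kernel_at \<rho> K = descend (\<lambda>g. operator_action \<rho> g K)"

definition operator_kernel ::
    "nat \<times> nat \<Rightarrow> (nat \<Rightarrow> weight \<Rightarrow> real \<Rightarrow> complex^'d^'d) \<Rightarrow> (nat \<Rightarrow> real) \<Rightarrow> complex^'d^'d"
  where "operator_kernel P E c = (\<Sum>n=0..irrep_size P.
    (c n * sqrt ((real n + 1) ^ 3 / irrep_dim P)) *\<^sub>R E n (zero_weight n) 0)"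

definition symbol_correspondence ::
    "(complex^3^3 \<Rightarrow> complex^'d^'d) \<Rightarrow> nat \<times> nat \<Rightarrow> cp2 measure
      \<Rightarrow> (complex^'d^'d \<Rightarrow> cp2 \<Rightarrow> complex) \<Rightarrow> bool"
  where "symbol_correspondence \<rho> P M W \<longleftrightarrow>
    (\<forall>A. cp2_smooth (W A))
    \<and> (\<forall>A B x. W (A + B) x = W A x + W B x)
    \<and> (\<forall>a A x. W (a *\<^sub>C A) x = a * W A x)
    \<and> inj W
    \<and> (\<forall>g\<in>SU3. \<forall>A x. W (operator_action \<rho> g A) x = W A (cp2_act (matrix_inv g) x))
    \<and> (\<forall>A x. W (dagger A) x = cnj (W A x))
    \<and> (\<forall>A. (\<integral>x. W A x \<partial>M) = trace A / of_real (irrep_dim P))"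

end

theory Submission
  imports Defs
begin

text \<open>A symbol correspondence is determined by the functional \<open>A \<mapsto> W\<^sub>A(x\<^sub>0)\<close>, i.e. by an operator
  \<open>K\<close> with \<open>W\<^sub>A(g x\<^sub>0) = tr(A K\<^sup>g)\<close>; equivariance says that \<open>K\<close> is fixed by the isotropy group \<open>H\<close>, and
  each \<open>(n,n)\<close> contains exactly one \<open>H\<close>-fixed line, spanned by \<open>e(n;0\<^sub>n,0)\<close>. This vector is
  Hermitian because it has weight \<open>0\<close>, hence is diagonal in the GT basis of \<open>H\<^sub>p\<close> (whose weights are
  simple), with real entries by the reality of the Clebsch-Gordan coefficients. Reality, normalization
  and injectivity of \<open>W\<close> then become \<open>c\<^sub>n \<in> \<real>\<close>, \<open>c\<^sub>0 = 1\<close> and \<open>c\<^sub>n \<noteq> 0\<close>.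

  Infinitesimal arguments need the derivative of a continuous unitary representation, which is
  constructed here from averages over one-parameter groups, its additivity coming from the
  Lie product formula. Smoothness of the symbols holds because \<open>K\<close> is a polynomial in the
  image of \<open>\<i> diag(2,-1,-1)\<close>, so that \<open>K(x)\<close> is a polynomial in the image of \<open>\<i> (3 P\<^sub>x - 1)\<close>, where
  \<open>P\<^sub>x\<close> is the orthogonal projection onto the line \<open>x\<close>.\<close>

text \<open>The Lie bracket never enters: the derived action is only shown to be linear, skew and
  equivariant under conjugation. Conjugation by the diagonal torus replaces the commutation
  relations (it shows how \<open>U_minus\<close> and \<open>T_minus\<close> move weights), and
  adjoints supply the raising operators, since \<open>gt_basis\<close> prescribes only the lowering
  ones. Injectivity rests on the (n,n) having different highest weights. The operators with zero
  symbol form an SU(3)-invariant subspace; such a subspace contains each (n,n) or is orthogonal to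
  it, and c_n nonzero rules out containment. The same uniqueness of highest weight vectors makes the
  integral of the kernel a multiple of the identity. The harmonics refer to an arbitrary realization
  of (n,n), unrelated to operators. Comparing them with symbols requires GT matrix elements to agree
  in all realizations; this is checked on the torus and two families of rotations, which generate
  SU(3).\<close>

lemma scaleC_zero_right [simp]: "a *\<^sub>C (0::'a::complex_euclidean) = 0"
  by (rule complex_vector.scale_zero_right)

lemma scaleC_diff_right: "a *\<^sub>C (x - y) = a *\<^sub>C x - a *\<^sub>C (y::'a::complex_euclidean)"
  by (rule complex_vector.scale_right_diff_distrib)

lemma scaleC_scaleR: "a *\<^sub>C (r *\<^sub>R x) = (a * of_real r) *\<^sub>C (x::'a::complex_euclidean)"
  by (simp add: scaleC_of_real[symmetric] scaleC_scaleC)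

lemma scaleR_scaleC: "r *\<^sub>R (a *\<^sub>C x) = (of_real r * a) *\<^sub>C (x::'a::complex_euclidean)"
  by (simp add: scaleC_of_real[symmetric] scaleC_scaleC)

lemma cinner_zero_right [simp]: "cinner x 0 = 0"
  using cinner_scaleC_right[of x 0 0] by simp

lemma cinner_zero_left [simp]: "cinner 0 x = 0"
  by (metis cinner_commute cinner_zero_right complex_cnj_zero)

lemma cinner_add_left: "cinner (x + y) z = cinner x z + cinner y z"
  by (metis cinner_add_right cinner_commute complex_cnj_add)

lemma cinner_scaleC_left: "cinner (a *\<^sub>C x) y = cnj a * cinner x y"
  by (metis cinner_commute cinner_scaleC_right complex_cnj_mult)

lemma cinner_scaleR_right: "cinner x (r *\<^sub>R y) = of_real r * cinner x y"
  by (metis cinner_scaleC_right scaleC_of_real)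

lemma cinner_scaleR_left: "cinner (r *\<^sub>R x) y = of_real r * cinner x y"
  by (metis cinner_scaleC_left scaleC_of_real complex_cnj_complex_of_real)

lemma cinner_minus_right: "cinner x (- y) = - cinner x y"
  using cinner_scaleR_right[of x "-1" y] by simp

lemma cinner_minus_left: "cinner (- x) y = - cinner x y"
  using cinner_scaleR_left[of "-1" x y] by simp

lemma cinner_diff_right: "cinner x (y - z) = cinner x y - cinner x z"
  by (metis cinner_add_right cinner_minus_right diff_conv_add_uminus)

lemma cinner_sum_right: "cinner x (\<Sum>i\<in>A. f i) = (\<Sum>i\<in>A. cinner x (f i))"
  by (induction A rule: infinite_finite_induct) (auto simp: cinner_add_right)

lemma cinner_sum_left: "cinner (\<Sum>i\<in>A. f i) x = (\<Sum>i\<in>A. cinner (f i) x)"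
  by (induction A rule: infinite_finite_induct) (auto simp: cinner_add_left)

lemma cinner_self: "cinner x x = of_real ((norm x)\<^sup>2)"
proof -
  have "Im (cinner x x) = 0"
    by (metis cinner_commute cnj.simps(2) add.inverse_neutral eq_neg_iff_add_eq_0 mult_2
        mult_eq_0_iff zero_neq_numeral)
  thus ?thesis
    by (simp add: complex_eq_iff Re_cinner power2_norm_eq_inner)
qed

lemma cinner_eq_zero_iff: "cinner x x = 0 \<longleftrightarrow> x = 0"
  by (simp add: cinner_self)

lemma norm_scaleC: "norm (a *\<^sub>C (x::'a::complex_euclidean)) = cmod a * norm x"
proof -
  have "of_real ((norm (a *\<^sub>C x))\<^sup>2) = (of_real ((cmod a * norm x)\<^sup>2) :: complex)"
    unfolding cinner_self[symmetric] cinner_scaleC_left cinner_scaleC_right power_mult_distrib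
    using complex_norm_square[of a] by (simp add: cinner_self algebra_simps)
  hence "(norm (a *\<^sub>C x))\<^sup>2 = (cmod a * norm x)\<^sup>2" using of_real_eq_iff by blast
  thus ?thesis by (simp add: power2_eq_iff_nonneg)
qed

lemma Im_cinner: "Im (cinner x y) = - (x \<bullet> (\<i> *\<^sub>C y))"
  using Re_cinner[of x "\<i> *\<^sub>C y"] by (simp add: cinner_scaleC_right)

lemma bounded_bilinear_scaleC: "bounded_bilinear (scaleC :: complex \<Rightarrow> 'a::complex_euclidean \<Rightarrow> 'a)"
proof
  show "(r *\<^sub>R a) *\<^sub>C b = r *\<^sub>R (a *\<^sub>C b)" for r :: real and a and b :: 'a
    by (simp add: scaleR_scaleC scaleR_conv_of_real)
  show "a *\<^sub>C (r *\<^sub>R b) = r *\<^sub>R (a *\<^sub>C b)" for r :: real and a and b :: 'a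
    by (simp add: scaleR_scaleC scaleC_scaleR mult.commute)
  show "\<exists>K. \<forall>a (b::'a). norm (a *\<^sub>C b) \<le> norm a * norm b * K"
    by (rule exI[of _ 1]) (simp add: norm_scaleC)
qed (auto simp: scaleC_add_left scaleC_add_right)

lemma bounded_linear_scaleC_right: "bounded_linear (\<lambda>x::'a::complex_euclidean. a *\<^sub>C x)"
  by (rule bounded_bilinear.bounded_linear_right[OF bounded_bilinear_scaleC])

lemma bounded_bilinear_cinner:
  "bounded_bilinear (cinner :: 'a::complex_euclidean \<Rightarrow> 'a \<Rightarrow> complex)"
proof
  show "\<exists>K. \<forall>a (b::'a). norm (cinner a b) \<le> norm a * norm b * K"
  proof (intro exI allI)
    fix a b :: 'a
    have "norm (cinner a b) \<le> \<bar>Re (cinner a b)\<bar> + \<bar>Im (cinner a b)\<bar>" by (rule cmod_le)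
    also have "\<bar>Re (cinner a b)\<bar> \<le> norm a * norm b"
      by (simp add: Re_cinner Cauchy_Schwarz_ineq2)
    also have "\<bar>Im (cinner a b)\<bar> \<le> norm a * norm b"
      using Cauchy_Schwarz_ineq2[of a "\<i> *\<^sub>C b"] by (simp add: Im_cinner norm_scaleC)
    finally show "norm (cinner a b) \<le> norm a * norm b * 2" by simp
  qed
qed (auto simp: cinner_add_left cinner_add_right cinner_scaleR_left cinner_scaleR_right
    scaleR_conv_of_real)

lemma complex_subspace_imp_subspace:
  assumes "complex_vector.subspace V" shows "subspace V"
  using assms unfolding complex_vector.subspace_def subspace_def
  by (metis scaleC_of_real)

lemma cinner_eqI:
  assumes "complex_vector.span S = V" "v \<in> V" "w \<in> V" "\<And>s. s \<in> S \<Longrightarrow> cinner s v = cinner s w"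
  shows "v = w"
proof -
  have "cinner x (v - w) = 0" if "x \<in> complex_vector.span S" for x
    using that
    by (induction rule: complex_vector.span_induct_alt)
      (auto simp: cinner_diff_right cinner_add_left cinner_scaleC_left assms(4))
  moreover have "v - w \<in> V" using assms complex_vector.subspace_diff by blast
  ultimately show ?thesis using assms(1) cinner_eq_zero_iff[of "v - w"] by auto
qed

lemma orthonormal_expand:
  fixes b :: "'i \<Rightarrow> 'a::complex_euclidean"
  assumes "finite I" "complex_vector.span (b ` I) = V" "v \<in> V"
    and on: "\<And>i j. i \<in> I \<Longrightarrow> j \<in> I \<Longrightarrow> cinner (b i) (b j) = (if i = j then 1 else 0)"
  shows "v = (\<Sum>i\<in>I. cinner (b i) v *\<^sub>C b i)"
proof (rule cinner_eqI[OF assms(2,3)])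
  show "(\<Sum>i\<in>I. cinner (b i) v *\<^sub>C b i) \<in> V"
    unfolding assms(2)[symmetric]
    by (intro complex_vector.span_sum complex_vector.span_scale complex_vector.span_base) auto
  fix s assume "s \<in> b ` I"
  then obtain j where "j \<in> I" "s = b j" by auto
  thus "cinner s v = cinner s (\<Sum>i\<in>I. cinner (b i) v *\<^sub>C b i)"
    using assms(1) by (simp add: cinner_sum_right cinner_scaleC_right on if_distrib[of "\<lambda>x. _ * x"] cong: if_cong)
qed

section \<open>Adjoints, traces and products of complex matrices\<close>

lemma dagger_nth [simp]: "dagger A $ i $ j = cnj (A $ j $ i)"
  by (simp add: dagger_def)

lemma dagger_dagger [simp]: "dagger (dagger A) = A"
  by (simp add: vec_eq_iff)

lemma dagger_mult: "dagger (A ** B) = dagger B ** dagger A"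
  by (simp add: vec_eq_iff matrix_matrix_mult_def mult.commute)

lemma dagger_mat_1 [simp]: "dagger (mat 1) = mat 1"
  by (simp add: vec_eq_iff mat_def)

lemma dagger_add: "dagger (A + B) = dagger A + dagger B"
  by (simp add: vec_eq_iff)

lemma dagger_diff: "dagger (A - B) = dagger A - dagger B"
  by (simp add: vec_eq_iff)

lemma dagger_minus: "dagger (- A) = - dagger A"
  by (simp add: vec_eq_iff)

lemma scaleC_vec_nth [simp]: "(a *\<^sub>C x) $ i = a *\<^sub>C (x $ i)"
  by (simp add: scaleC_vec_def)

lemma scaleC_complex [simp]: "a *\<^sub>C (z::complex) = a * z"
  by (simp add: scaleC_complex_def)

lemma dagger_scaleC: "dagger (a *\<^sub>C A) = cnj a *\<^sub>C dagger A"
  by (simp add: vec_eq_iff)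

lemma dagger_scaleR: "dagger (a *\<^sub>R A) = a *\<^sub>R dagger A"
  by (simp add: vec_eq_iff)

lemma dagger_sum: "dagger (\<Sum>i\<in>I. f i) = (\<Sum>i\<in>I. dagger (f i))"
  by (induction I rule: infinite_finite_induct) (auto simp: dagger_add vec_eq_iff)

lemma bounded_linear_dagger: "bounded_linear (dagger :: complex^'n^'m \<Rightarrow> complex^'m^'n)"
  by (intro linear_conv_bounded_linear[THEN iffD1] linearI) (auto simp: dagger_add dagger_scaleR)

lemma matrix_scaleC_left: "(a *\<^sub>C A) ** B = a *\<^sub>C (A ** (B::complex^'k^'n))"
  by (simp add: vec_eq_iff matrix_matrix_mult_def sum_distrib_left mult.assoc)

lemma matrix_scaleC_right: "A ** (a *\<^sub>C B) = a *\<^sub>C (A ** (B::complex^'k^'n))"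
  by (simp add: vec_eq_iff matrix_matrix_mult_def sum_distrib_left mult.left_commute)

lemma matrix_scaleR_left: "(a *\<^sub>R A) ** B = a *\<^sub>R (A ** (B::complex^'k^'n))"
  by (simp add: matrix_scaleC_left scaleC_of_real[symmetric])

lemma matrix_scaleR_right: "A ** (a *\<^sub>R B) = a *\<^sub>R (A ** (B::complex^'k^'n))"
  by (simp add: matrix_scaleC_right scaleC_of_real[symmetric])

lemma matrix_vector_scaleC_right: "A *v (a *\<^sub>C x) = a *\<^sub>C (A *v (x::complex^'n))"
  by (simp add: vec_eq_iff matrix_vector_mult_def sum_distrib_left mult.left_commute)

lemma matrix_vector_scaleC_left: "(a *\<^sub>C A) *v x = a *\<^sub>C (A *v (x::complex^'n))"
  by (simp add: vec_eq_iff matrix_vector_mult_def sum_distrib_left mult.assoc)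

lemma matrix_vector_scaleR_left: "(a *\<^sub>R A) *v x = a *\<^sub>R (A *v (x::complex^'n))"
  by (simp add: matrix_vector_scaleC_left scaleC_of_real[symmetric])

lemma matrix_vector_scaleR_right: "A *v (a *\<^sub>R x) = a *\<^sub>R (A *v (x::complex^'n))"
  by (simp add: matrix_vector_scaleC_right scaleC_of_real[symmetric])

lemma matrix_mult_add_left: "(A + B) ** C = A ** C + B ** (C::complex^'k^'n)"
  by (simp add: vec_eq_iff matrix_matrix_mult_def sum.distrib algebra_simps)

lemma bounded_bilinear_matrix_mult:
  "bounded_bilinear ((**) :: complex^'n^'m \<Rightarrow> complex^'k^'n \<Rightarrow> complex^'k^'m)"
  by (intro bilinear_conv_bounded_bilinear[THEN iffD1])
    (auto simp: bilinear_def matrix_add_ldistrib matrix_mult_add_left matrix_scaleR_left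
      matrix_scaleR_right intro!: linearI)

lemma bounded_bilinear_matrix_vector_mult:
  "bounded_bilinear ((*v) :: complex^'n^'m \<Rightarrow> complex^'n \<Rightarrow> complex^'m)"
  by (intro bilinear_conv_bounded_bilinear[THEN iffD1])
    (auto simp: bilinear_def matrix_vector_right_distrib matrix_vector_mult_add_rdistrib
      matrix_vector_scaleR_left matrix_vector_scaleR_right intro!: linearI)

lemma trace_scaleC: "trace (a *\<^sub>C A) = a * trace (A::complex^'n^'n)"
  by (simp add: trace_def sum_distrib_left)

lemma trace_scaleR: "trace (a *\<^sub>R A) = of_real a * trace (A::complex^'n^'n)"
  by (simp add: trace_scaleC scaleC_of_real[symmetric])

lemma bounded_linear_trace_mult: "bounded_linear (\<lambda>X. trace (A ** X))" for A :: "complex^'n^'n"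
  by (intro linear_conv_bounded_linear[THEN iffD1] linearI)
    (simp_all add: matrix_add_ldistrib trace_add matrix_scaleR_right trace_scaleR
      scaleR_conv_of_real[where 'a = complex])

lemma trace_dagger: "trace (dagger A) = cnj (trace A)"
  by (simp add: trace_def)

lemma cinner_matrix_vector: "cinner v (A *v w) = cinner (dagger A *v v) w"
  unfolding cinner_vec_def matrix_vector_mult_def cinner_complex_def
  by (simp add: sum_distrib_left sum_distrib_right mult_ac) (rule sum.swap)

lemma cinner_matrix_left: "cinner (A ** X) (A ** Y) = cinner X Y" if "dagger A ** A = mat 1"
  for A X Y :: "complex^'k^'k"
proof -
  have "dagger X ** dagger A ** (A ** Y) = dagger X ** (dagger A ** A) ** Y"
    by (simp add: matrix_mul_assoc)
  thus ?thesis by (simp add: cinner_matrix dagger_mult that)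
qed

lemma cinner_matrix_right: "cinner (X ** A) (Y ** A) = cinner X Y" if "A ** dagger A = mat 1"
  for A X Y :: "complex^'k^'k"
proof -
  have "trace (dagger (X ** A) ** (Y ** A)) = trace (dagger A ** (dagger X ** Y ** A))"
    by (simp add: dagger_mult matrix_mul_assoc)
  also have "\<dots> = trace ((dagger X ** Y ** A) ** dagger A)" by (rule trace_mul_sym)
  also have "\<dots> = trace (dagger X ** Y ** (A ** dagger A))" by (simp add: matrix_mul_assoc)
  finally show ?thesis by (simp add: cinner_matrix that)
qed

lemma norm_matrix_left: "norm (A ** X) = norm X" if "dagger A ** A = mat 1" for A X :: "complex^'k^'k"
  using cinner_matrix_left[OF that, of X X]
  by (simp add: cinner_self flip: of_real_power)

lemma norm_matrix_right: "norm (X ** A) = norm X" if "A ** dagger A = mat 1" for A X :: "complex^'k^'k"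
  using cinner_matrix_right[OF that, of X X]
  by (simp add: cinner_self flip: of_real_power)

lemma matrix_pow_Suc2: "matrix_pow A (Suc k) = matrix_pow A k ** A"
  by (induction k) (auto simp: matrix_mul_assoc)

lemma matrix_pow_scaleR: "matrix_pow (t *\<^sub>R A) k = (t ^ k) *\<^sub>R matrix_pow A k"
  by (induction k) (auto simp: matrix_scaleR_left matrix_scaleR_right mult.commute)

text \<open>The inner factors h ** g cancel. The exponent is positive because the zeroth power would
  need the other product g ** h to be the identity.\<close>

lemma matrix_pow_conj:
  assumes "h ** g = mat 1"
  shows "matrix_pow (g ** A ** h) (Suc k) = g ** matrix_pow A (Suc k) ** h"
proof (induction k)
  case (Suc k)
  have "matrix_pow (g ** A ** h) (Suc (Suc k)) = g ** A ** (h ** g) ** matrix_pow A (Suc k) ** h"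
    using Suc by (simp add: matrix_mul_assoc)
  thus ?case by (simp add: assms matrix_mul_assoc)
qed simp

lemma dagger_matrix_pow: "dagger (matrix_pow A k) = matrix_pow (dagger A) k"
proof (induction k)
  case (Suc k)
  have "dagger (matrix_pow A (Suc k)) = matrix_pow (dagger A) k ** dagger A"
    by (simp add: dagger_mult Suc)
  thus ?case by (simp only: matrix_pow_Suc2)
qed simp

section \<open>The matrix exponential\<close>

lemma matrix_pow_entry_bound:
  fixes A :: "complex^'n^'n"
  assumes "\<And>i j. cmod (A $ i $ j) \<le> m"
  shows "cmod (matrix_pow A k $ i $ j) \<le> (real CARD('n) * m) ^ k"
proof (induction k arbitrary: i j)
  case 0
  thus ?case by (simp add: mat_def)
next
  case (Suc k)
  have m: "m \<ge> 0" using assms[of i j] norm_ge_zero order_trans by blast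
  have "cmod (matrix_pow A (Suc k) $ i $ j) \<le> (\<Sum>l\<in>UNIV. cmod (A $ i $ l * matrix_pow A k $ l $ j))"
    by (simp add: matrix_matrix_mult_def norm_sum)
  also have "\<dots> \<le> (\<Sum>l\<in>(UNIV::'n set). m * (real CARD('n) * m) ^ k)"
    unfolding norm_mult by (intro sum_mono mult_mono assms Suc m) auto
  finally show ?case by (simp add: mult.assoc)
qed

text \<open>Entries of A^k grow at most like (N m)^k, N the size and m = norm A, so an exponential
  series dominates. The variable z is complex so that termwise differentiation of power series
  applies later.\<close>

lemma summable_mexp_entry:
  fixes A :: "complex^'n^'n"
  shows "summable (\<lambda>k. (matrix_pow A k $ i $ j / fact k) * z ^ k)"
proof (rule summable_comparison_test)
  define m where "m = norm A"
  have b: "cmod (A $ i $ j) \<le> m" for i j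
    unfolding m_def using Finite_Cartesian_Product.norm_nth_le[of "A $ i" j]
      Finite_Cartesian_Product.norm_nth_le[of A i] by linarith
  let ?r = "real CARD('n) * m * cmod z"
  show "\<exists>N. \<forall>k\<ge>N. norm (matrix_pow A k $ i $ j / fact k * z ^ k) \<le> inverse (fact k) * ?r ^ k"
  proof (intro exI[of _ 0] allI impI)
    fix k
    have "norm (matrix_pow A k $ i $ j / fact k * z ^ k)
        = cmod (matrix_pow A k $ i $ j) * (cmod z ^ k / fact k)"
      by (simp add: norm_mult norm_divide norm_power)
    also have "\<dots> \<le> (real CARD('n) * m) ^ k * (cmod z ^ k / fact k)"
      by (intro mult_right_mono matrix_pow_entry_bound b) auto
    finally show "norm (matrix_pow A k $ i $ j / fact k * z ^ k) \<le> inverse (fact k) * ?r ^ k"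
      by (simp add: power_mult_distrib field_simps)
  qed
  show "summable (\<lambda>k. inverse (fact k) * ?r ^ k)" by (rule summable_exp)
qed

lemma sums_vecI:
  fixes f :: "nat \<Rightarrow> 'a::real_normed_vector^'n"
  assumes "\<And>i. (\<lambda>k. f k $ i) sums (s $ i)" shows "f sums s"
  using assms unfolding sums_def by (intro vec_tendstoI) simp

lemma mexp_sums:
  fixes A :: "complex^'n^'n"
  shows "(\<lambda>k. (1 / fact k) *\<^sub>R matrix_pow A k) sums mexp A"
proof -
  have "summable (\<lambda>k. (1 / fact k) *\<^sub>R matrix_pow A k)"
  proof -
    have "(\<lambda>k. (1 / fact k) *\<^sub>R matrix_pow A k)
        sums (\<chi> i j. \<Sum>k. (matrix_pow A k $ i $ j / fact k) * 1 ^ k)"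
      using summable_mexp_entry[of A _ _ 1, THEN summable_sums]
      by (intro sums_vecI) (simp add: scaleR_conv_of_real[where 'a = complex])
    thus ?thesis by (rule sums_summable)
  qed
  thus ?thesis unfolding mexp_def by (rule summable_sums)
qed

lemma mexp_entry:
  "mexp (t *\<^sub>R A) $ i $ j = (\<Sum>k. (matrix_pow A k $ i $ j / fact k) * of_real t ^ k)"
proof (rule sums_unique)
  have "(\<lambda>k. ((1 / fact k) *\<^sub>R matrix_pow (t *\<^sub>R A) k) $ i $ j) sums (mexp (t *\<^sub>R A) $ i $ j)"
    by (intro bounded_linear.sums[OF bounded_linear_vec_nth] mexp_sums)
  thus "(\<lambda>k. (matrix_pow A k $ i $ j / fact k) * of_real t ^ k) sums (mexp (t *\<^sub>R A) $ i $ j)"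
    by (simp add: matrix_pow_scaleR scaleR_conv_of_real[where 'a = complex] field_simps)
qed

lemma has_vector_derivative_at_iff:
  "(f has_vector_derivative D) (at t) \<longleftrightarrow> ((\<lambda>h. (1 / h) *\<^sub>R (f (t + h) - f t)) \<longlongrightarrow> D) (at 0)"
proof -
  have "norm (f (t + h) - f t - h *\<^sub>R D) / norm h = norm ((1 / h) *\<^sub>R (f (t + h) - f t) - D)"
    if "h \<noteq> 0" for h
  proof -
    have "(1 / h) *\<^sub>R (f (t + h) - f t) - D = (1 / h) *\<^sub>R (f (t + h) - f t - h *\<^sub>R D)"
      using that by (simp add: algebra_simps)
    thus ?thesis by simp
  qed
  hence "((\<lambda>h. norm (f (t + h) - f t - h *\<^sub>R D) / norm h) \<longlongrightarrow> 0) (at 0)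
      \<longleftrightarrow> ((\<lambda>h. norm ((1 / h) *\<^sub>R (f (t + h) - f t) - D)) \<longlongrightarrow> 0) (at 0)"
    by (intro Lim_cong_within) auto
  also have "\<dots> \<longleftrightarrow> ((\<lambda>h. (1 / h) *\<^sub>R (f (t + h) - f t)) \<longlongrightarrow> D) (at 0)"
    by (simp add: tendsto_norm_zero_iff LIM_zero_iff)
  finally show ?thesis
    by (simp add: has_vector_derivative_def has_derivative_at bounded_linear_scaleR_left)
qed

lemma has_vector_derivative_vecI:
  fixes f :: "real \<Rightarrow> 'a::real_normed_vector^'n"
  assumes "\<And>i. ((\<lambda>t. f t $ i) has_vector_derivative (D $ i)) (at t)"
  shows "(f has_vector_derivative D) (at t)"
  using assms unfolding has_vector_derivative_at_iff by (intro vec_tendstoI) simp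

lemma mexp_has_vector_derivative:
  fixes A :: "complex^'n^'n"
  shows "((\<lambda>t. mexp (t *\<^sub>R A)) has_vector_derivative (A ** mexp (t *\<^sub>R A))) (at t)"
proof (intro has_vector_derivative_vecI)
  fix i j
  define c where "c i j k = matrix_pow A k $ i $ j / (fact k :: complex)" for i j k
  have dc: "diffs (c i j) k = (\<Sum>l\<in>UNIV. A $ i $ l * c l j k)" for k
    by (simp add: diffs_def c_def matrix_matrix_mult_def sum_divide_distrib sum_distrib_left
        field_simps del: of_nat_Suc)
  have "((\<lambda>z. \<Sum>k. c i j k * z ^ k) has_field_derivative (\<Sum>k. diffs (c i j) k * of_real t ^ k))
      (at (of_real t))"
    unfolding c_def by (intro termdiffs_strong_converges_everywhere summable_mexp_entry)
  moreover have "(\<Sum>k. diffs (c i j) k * of_real t ^ k) = (A ** mexp (t *\<^sub>R A)) $ i $ j"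
  proof -
    have "(\<Sum>k. diffs (c i j) k * of_real t ^ k)
        = (\<Sum>k. \<Sum>l\<in>UNIV. A $ i $ l * (c l j k * of_real t ^ k))"
      by (simp add: dc sum_distrib_right mult.assoc)
    also have "\<dots> = (\<Sum>l\<in>UNIV. A $ i $ l * (\<Sum>k. c l j k * of_real t ^ k))"
      unfolding c_def
      by (simp only: suminf_sum[OF summable_mult[OF summable_mexp_entry]]
          suminf_mult[OF summable_mexp_entry])
    finally show ?thesis
      by (simp add: matrix_matrix_mult_def mexp_entry c_def)
  qed
  ultimately have "((\<lambda>z. \<Sum>k. c i j k * z ^ k) has_field_derivative
      ((A ** mexp (t *\<^sub>R A)) $ i $ j)) (at (of_real t))" by simp
  from has_vector_derivative_real_field[OF this]
  show "((\<lambda>t. mexp (t *\<^sub>R A) $ i $ j) has_vector_derivative ((A ** mexp (t *\<^sub>R A)) $ i $ j)) (at t)"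
    by (simp add: mexp_entry c_def o_def)
qed

lemma mexp_zero [simp]: "mexp (0 :: complex^'n^'n) = mat 1"
proof -
  have "mexp (0 *\<^sub>R 0) $ i $ j = (mat 1 :: complex^'n^'n) $ i $ j" for i j :: 'n
    unfolding mexp_entry using powser_zero[of "\<lambda>k. matrix_pow 0 k $ i $ j / fact k"] by simp
  thus ?thesis by (simp add: vec_eq_iff)
qed

lemma matrix_mult_mexp_commute: "A ** mexp (t *\<^sub>R A) = mexp (t *\<^sub>R A) ** A"
proof -
  have c: "A ** matrix_pow (t *\<^sub>R A) k = matrix_pow (t *\<^sub>R A) k ** A" for k
    using matrix_pow_Suc2[of A k] by (simp add: matrix_pow_scaleR matrix_scaleR_right matrix_scaleR_left)
  have "(\<lambda>k. A ** ((1 / fact k) *\<^sub>R matrix_pow (t *\<^sub>R A) k)) sums (A ** mexp (t *\<^sub>R A))"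
    by (intro bounded_linear.sums[OF bounded_bilinear.bounded_linear_right[OF bounded_bilinear_matrix_mult]]
        mexp_sums)
  moreover have "(\<lambda>k. ((1 / fact k) *\<^sub>R matrix_pow (t *\<^sub>R A) k) ** A) sums (mexp (t *\<^sub>R A) ** A)"
    by (intro bounded_linear.sums[OF bounded_bilinear.bounded_linear_left[OF bounded_bilinear_matrix_mult]]
        mexp_sums)
  ultimately show ?thesis
    by (simp add: c matrix_scaleR_left matrix_scaleR_right sums_iff)
qed

lemma zero_derivative_constant:
  fixes f :: "real \<Rightarrow> 'a::real_normed_vector"
  assumes "\<And>t. (f has_vector_derivative 0) (at t)"
  shows "f s = f t"
  using has_derivative_zero_constant[of UNIV f] assms
  by (auto simp: has_vector_derivative_def)

text \<open>The function u -> exp(u A) exp((s + t - u) A) has derivative zero; its values at u = 0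
  and u = s are the two sides.\<close>

lemma mexp_add:
  fixes A :: "complex^'n^'n"
  shows "mexp ((s + t) *\<^sub>R A) = mexp (s *\<^sub>R A) ** mexp (t *\<^sub>R A)"
proof -
  define F where "F u = mexp (u *\<^sub>R A) ** mexp ((s + t - u) *\<^sub>R A)" for u
  have "(F has_vector_derivative 0) (at u)" for u
  proof -
    have "((\<lambda>u. mexp ((s + t - u) *\<^sub>R A)) has_vector_derivative
        - (A ** mexp ((s + t - u) *\<^sub>R A))) (at u)"
    proof -
      have "((\<lambda>u. s + t - u) has_vector_derivative - 1) (at u)"
        by (auto intro!: derivative_eq_intros)
      from vector_diff_chain_at[OF this mexp_has_vector_derivative]
      show ?thesis by (simp add: o_def)
    qed
    from bounded_bilinear.has_vector_derivative[OF bounded_bilinear_matrix_mult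
        mexp_has_vector_derivative[of A u] this]
    have "(F has_vector_derivative mexp (u *\<^sub>R A) ** - (A ** mexp ((s + t - u) *\<^sub>R A))
        + (A ** mexp (u *\<^sub>R A)) ** mexp ((s + t - u) *\<^sub>R A)) (at u)"
      by (simp add: F_def[abs_def])
    moreover have "X ** (- Y) = - (X ** Y)" for X Y :: "complex^'n^'n"
      using matrix_scaleR_right[of X "-1" Y] by simp
    ultimately show ?thesis
      by (simp add: matrix_mult_mexp_commute[of A u] matrix_mul_assoc)
  qed
  hence "F 0 = F s" by (rule zero_derivative_constant)
  thus ?thesis by (simp add: F_def)
qed

lemma mexp_conj:
  fixes g h A :: "complex^'n^'n"
  assumes "h ** g = mat 1" "g ** h = mat 1"
  shows "mexp (g ** A ** h) = g ** mexp A ** h"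
proof -
  have c: "matrix_pow (g ** A ** h) k = g ** matrix_pow A k ** h" for k
    using matrix_pow_conj[OF assms(1)] assms(2) by (cases k) simp_all
  have "(\<lambda>k. g ** ((1 / fact k) *\<^sub>R matrix_pow A k) ** h) sums (g ** mexp A ** h)"
    by (intro bounded_linear.sums[OF bounded_bilinear.bounded_linear_left[OF bounded_bilinear_matrix_mult]]
        bounded_linear.sums[OF bounded_bilinear.bounded_linear_right[OF bounded_bilinear_matrix_mult]]
        mexp_sums)
  moreover have "(\<lambda>k. g ** ((1 / fact k) *\<^sub>R matrix_pow A k) ** h) sums mexp (g ** A ** h)"
    using mexp_sums[of "g ** A ** h"] by (simp add: c matrix_scaleR_left matrix_scaleR_right)
  ultimately show ?thesis by (rule sums_unique2[symmetric])
qed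

lemma dagger_mexp: "dagger (mexp A) = mexp (dagger A)"
proof -
  have "(\<lambda>k. dagger ((1 / fact k) *\<^sub>R matrix_pow A k)) sums dagger (mexp A)"
    by (intro bounded_linear.sums[OF bounded_linear_dagger] mexp_sums)
  moreover have "(\<lambda>k. dagger ((1 / fact k) *\<^sub>R matrix_pow A k)) sums mexp (dagger A)"
    using mexp_sums[of "dagger A"] by (simp add: dagger_scaleR dagger_matrix_pow)
  ultimately show ?thesis by (rule sums_unique2)
qed

lemma mexp_vector_fixed:
  assumes "A *v x = 0" shows "mexp A *v x = (x::complex^'n)"
proof -
  have "(\<lambda>k. ((1 / fact k) *\<^sub>R matrix_pow A k) *v x) sums (mexp A *v x)"
    by (intro bounded_linear.sums[OF bounded_bilinear.bounded_linear_left[OF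
          bounded_bilinear_matrix_vector_mult]] mexp_sums)
  moreover have "((1 / fact k) *\<^sub>R matrix_pow A k) *v x = (if k = 0 then x else 0)" for k
    by (cases k) (simp_all add: matrix_vector_scaleR_left assms matrix_pow_Suc2
        matrix_vector_mul_assoc[symmetric] del: matrix_pow.simps(2))
  ultimately have "(\<lambda>k. if k = 0 then x else 0) sums (mexp A *v x)" by simp
  moreover have "(\<lambda>k. if k = 0 then x else 0) sums x"
    using sums_single[of 0 "\<lambda>_. x"] by simp
  ultimately show ?thesis by (rule sums_unique2)
qed

section \<open>The group SU(3) and its Lie algebra\<close>

definition su3 :: "(complex^3^3) set"
  where "su3 = {X. dagger X = - X \<and> trace X = 0}"

lemma su3_scaleR: "X \<in> su3 \<Longrightarrow> r *\<^sub>R X \<in> su3"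
  by (simp add: su3_def dagger_scaleR trace_scaleR)

lemma su3_add: "X \<in> su3 \<Longrightarrow> Y \<in> su3 \<Longrightarrow> X + Y \<in> su3"
  by (simp add: su3_def dagger_add trace_add)

lemma su3_0: "0 \<in> su3"
  using su3_scaleR[of _ 0] by (simp add: su3_def vec_eq_iff trace_def)

lemma SU3_inverse: "g \<in> SU3 \<Longrightarrow> dagger g ** g = mat 1" "g \<in> SU3 \<Longrightarrow> g ** dagger g = mat 1"
  using matrix_left_right_inverse[of "dagger g" g] by (simp_all add: SU3_def)

lemma SU3_one: "mat 1 \<in> SU3"
  by (simp add: SU3_def)

lemma SU3_mult: "g \<in> SU3 \<Longrightarrow> h \<in> SU3 \<Longrightarrow> g ** h \<in> SU3"
proof -
  assume "g \<in> SU3" "h \<in> SU3"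
  moreover have "dagger (g ** h) ** (g ** h) = dagger h ** (dagger g ** g) ** h"
    by (simp add: dagger_mult matrix_mul_assoc)
  ultimately show "g ** h \<in> SU3" by (simp add: SU3_def det_mul)
qed

lemma SU3_dagger: "g \<in> SU3 \<Longrightarrow> dagger g \<in> SU3"
proof -
  assume g: "g \<in> SU3"
  have "det (dagger g ** g) = 1" using SU3_inverse(1)[OF g] by simp
  thus ?thesis using g SU3_inverse(2)[OF g] by (simp add: SU3_def det_mul)
qed

lemma matrix_inv_eqI:
  assumes "A ** B = mat 1" "B ** A = mat 1" shows "matrix_inv A = B"
proof -
  have "A ** matrix_inv A = mat 1"
    using someI[of "\<lambda>B. A ** B = mat 1 \<and> B ** A = mat 1" B] assms unfolding matrix_inv_def by simp
  hence "B ** (A ** matrix_inv A) = B" by simp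
  thus ?thesis by (simp add: matrix_mul_assoc assms(2))
qed

lemma SU3_matrix_inv: "g \<in> SU3 \<Longrightarrow> matrix_inv g = dagger g"
  using matrix_inv_eqI[of g "dagger g"] SU3_inverse by simp

lemma su3_conj: "X \<in> su3 \<Longrightarrow> g \<in> SU3 \<Longrightarrow> g ** X ** dagger g \<in> su3"
proof -
  assume "X \<in> su3" and g: "g \<in> SU3"
  have "trace (g ** X ** dagger g) = trace (dagger g ** g ** X)"
    by (subst trace_mul_sym) (simp add: matrix_mul_assoc)
  moreover have "dagger (g ** X ** dagger g) = g ** dagger X ** dagger g"
    by (simp add: dagger_mult matrix_mul_assoc)
  moreover have "g ** (- X) ** dagger g = - (g ** X ** dagger g)"
    using matrix_scaleR_right[of g "-1" X] matrix_scaleR_left[of "-1" "g ** X" "dagger g"] by simp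
  ultimately show ?thesis using \<open>X \<in> su3\<close> SU3_inverse(1)[OF g] by (simp add: su3_def)
qed

text \<open>Jacobi's formula at the identity: in the expanded determinant every product with two or
  more off-diagonal factors has derivative zero there.\<close>

lemma det_has_derivative_one:
  fixes F :: "real \<Rightarrow> complex^3^3"
  assumes "(F has_vector_derivative D) (at 0)" "F 0 = mat 1"
  shows "((\<lambda>t. det (F t)) has_vector_derivative trace D) (at 0)"
proof -
  have e [derivative_intros]: "((\<lambda>t. F t $ i $ j) has_vector_derivative D $ i $ j) (at 0)" for i j
    by (intro bounded_linear.has_vector_derivative[OF bounded_linear_vec_nth] assms)
  show ?thesis unfolding det_3
    by (rule has_vector_derivative_eq_rhs, (rule derivative_intros)+)
      (simp add: assms(2) trace_def sum_3 mat_def)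
qed

lemma mexp_SU3:
  assumes X: "X \<in> su3" shows "mexp (t *\<^sub>R X) \<in> SU3"
proof -
  have "dagger (mexp (t *\<^sub>R X)) ** mexp (t *\<^sub>R X) = mexp ((- t) *\<^sub>R X) ** mexp (t *\<^sub>R X)"
    using X by (simp add: dagger_mexp dagger_scaleR su3_def)
  also have "\<dots> = mat 1" by (simp only: mexp_add[symmetric]) simp
  finally have u: "dagger (mexp (t *\<^sub>R X)) ** mexp (t *\<^sub>R X) = mat 1" .
  define f where "f t = det (mexp (t *\<^sub>R X))" for t
  have "(f has_vector_derivative 0) (at t)" for t
  proof -
    have f0: "(f has_vector_derivative 0) (at 0)"
      unfolding f_def using det_has_derivative_one[OF mexp_has_vector_derivative[of X 0]] X
      by (simp add: su3_def)
    \<comment> \<open>Multiplicativity f s = f t * f (s - t) carries the vanishing derivative at 0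
      over to t.\<close>
    have "(f \<circ> (\<lambda>s. s - t) has_vector_derivative 1 *\<^sub>R 0) (at t)"
      by (rule vector_diff_chain_at) (auto intro!: derivative_eq_intros f0)
    hence "((\<lambda>s. f t * f (s - t)) has_vector_derivative f t * 0) (at t)"
      by (intro has_vector_derivative_mult_right) (simp add: o_def)
    moreover have "f t * f (s - t) = f s" for s
      unfolding f_def det_mul[symmetric] mexp_add[symmetric] by simp
    ultimately show ?thesis by simp
  qed
  hence "f t = f 0" by (rule zero_derivative_constant)
  thus ?thesis using u by (simp add: SU3_def f_def)
qed

lemma mexp_continuous: "continuous_on S (\<lambda>t. mexp (t *\<^sub>R (A::complex^'n^'n)))"
  using mexp_has_vector_derivative[of A]
  by (intro continuous_at_imp_continuous_on) (auto intro: has_vector_derivative_continuous)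

section \<open>The Lie product formula\<close>

lemma matrix_pow_unitary:
  assumes "dagger A ** A = mat 1"
  shows "dagger (matrix_pow A k) ** matrix_pow A k = mat 1"
proof (induction k)
  case (Suc k)
  have "dagger (matrix_pow A (Suc k)) ** matrix_pow A (Suc k)
      = dagger (matrix_pow A k) ** (dagger A ** A) ** matrix_pow A k"
    by (simp add: dagger_mult matrix_mul_assoc)
  thus ?case by (simp add: assms Suc)
qed simp

text \<open>Telescoping A^(n+1) - B^(n+1) = A (A^n - B^n) + (A - B) B^n; multiplication by a unitary
  matrix preserves the norm, so each step costs norm (A - B).\<close>

lemma norm_matrix_pow_diff:
  fixes A B :: "complex^'n^'n"
  assumes A: "dagger A ** A = mat 1" and B: "dagger B ** B = mat 1"
  shows "norm (matrix_pow A n - matrix_pow B n) \<le> real n * norm (A - B)"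
proof (induction n)
  case (Suc n)
  have "matrix_pow A (Suc n) - matrix_pow B (Suc n)
      = A ** (matrix_pow A n - matrix_pow B n) + (A - B) ** matrix_pow B n"
    by (simp add: bounded_bilinear.diff_left[OF bounded_bilinear_matrix_mult]
        bounded_bilinear.diff_right[OF bounded_bilinear_matrix_mult])
  hence "norm (matrix_pow A (Suc n) - matrix_pow B (Suc n))
      \<le> norm (A ** (matrix_pow A n - matrix_pow B n)) + norm ((A - B) ** matrix_pow B n)"
    by (metis norm_triangle_ineq)
  also have "\<dots> = norm (matrix_pow A n - matrix_pow B n) + norm (A - B)"
  proof -
    have "matrix_pow B n ** dagger (matrix_pow B n) = mat 1"
      using matrix_pow_unitary[OF B] matrix_left_right_inverse by blast
    thus ?thesis by (simp add: norm_matrix_left[OF A] norm_matrix_right)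
  qed
  finally show ?case using Suc by (simp add: algebra_simps)
qed simp

lemma mexp_pow: "matrix_pow (mexp A) n = mexp (real n *\<^sub>R A)"
proof (induction n)
  case (Suc n)
  thus ?case using mexp_add[of 1 "real n" A] by (simp add: algebra_simps)
qed simp

text \<open>The difference quotient along the sequence h = t / n. For t = 0 this sequence does not
  avoid 0, hence the case split.\<close>

lemma o_over_n_tendsto:
  fixes F :: "real \<Rightarrow> 'a::real_normed_vector"
  assumes "(F has_vector_derivative D) (at 0)"
  shows "(\<lambda>n. real n *\<^sub>R (F (t / real n) - F 0)) \<longlonglongrightarrow> t *\<^sub>R D"
proof (cases "t = 0")
  case False
  have "((\<lambda>h. (1 / h) *\<^sub>R (F h - F 0)) \<longlongrightarrow> D) (at 0)"
    using assms unfolding has_vector_derivative_at_iff by simp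
  moreover have "filterlim (\<lambda>n. t / real n) (at 0) sequentially"
    unfolding filterlim_at using False
    by (auto intro!: lim_const_over_n eventually_sequentiallyI[of 1])
  ultimately have "(\<lambda>n. (1 / (t / real n)) *\<^sub>R (F (t / real n) - F 0)) \<longlonglongrightarrow> D"
    by (rule filterlim_compose)
  hence "(\<lambda>n. t *\<^sub>R ((1 / (t / real n)) *\<^sub>R (F (t / real n) - F 0))) \<longlonglongrightarrow> t *\<^sub>R D"
    by (intro tendsto_intros)
  thus ?thesis using False by simp
qed simp

lemma lie_product:
  assumes X: "X \<in> su3" and Y: "Y \<in> su3"
  shows "(\<lambda>n. matrix_pow (mexp ((t / real n) *\<^sub>R X) ** mexp ((t / real n) *\<^sub>R Y)) n)
    \<longlonglongrightarrow> mexp (t *\<^sub>R (X + Y))"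
proof -
  \<comment> \<open>F is o(h) at 0, and replacing one factor by the other in an n-th power costs n
    times the norm of F (t / n), which tends to 0.\<close>
  define F where "F h = mexp (h *\<^sub>R X) ** mexp (h *\<^sub>R Y) - mexp (h *\<^sub>R (X + Y))" for h
  have "(F has_vector_derivative 0) (at 0)"
    unfolding F_def
    by (rule has_vector_derivative_eq_rhs, rule has_vector_derivative_diff,
        rule bounded_bilinear.has_vector_derivative[OF bounded_bilinear_matrix_mult],
        (rule mexp_has_vector_derivative)+) simp
  from tendsto_norm[OF o_over_n_tendsto[OF this, of t]]
  have lim: "(\<lambda>n. real n * norm (F (t / real n))) \<longlonglongrightarrow> 0" by (simp add: F_def)
  have "(\<lambda>n. matrix_pow (mexp ((t / real n) *\<^sub>R X) ** mexp ((t / real n) *\<^sub>R Y)) n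
      - mexp (t *\<^sub>R (X + Y))) \<longlonglongrightarrow> 0"
  proof (rule Lim_null_comparison[OF _ lim], rule eventually_sequentiallyI[of 1])
    fix n :: nat assume n: "n \<ge> 1"
    let ?h = "t / real n"
    have S: "dagger Z ** Z = mat 1" if "Z \<in> SU3" for Z using that by (rule SU3_inverse)
    have "mexp (t *\<^sub>R (X + Y)) = matrix_pow (mexp (?h *\<^sub>R (X + Y))) n"
      using n by (simp add: mexp_pow)
    thus "norm (matrix_pow (mexp (?h *\<^sub>R X) ** mexp (?h *\<^sub>R Y)) n - mexp (t *\<^sub>R (X + Y)))
        \<le> real n * norm (F ?h)"
      unfolding F_def
      by (simp add: norm_matrix_pow_diff S SU3_mult mexp_SU3 X Y su3_add)
  qed
  thus ?thesis by (simp add: LIM_zero_iff)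
qed

section \<open>The derivative of a unitary representation\<close>

lemma mexp_in_SU3: "X \<in> su3 \<Longrightarrow> mexp X \<in> SU3"
  using mexp_SU3[of X 1] by simp

lemma cis_has_vector_derivative:
  "((\<lambda>t. cis (t * x)) has_vector_derivative \<i> * of_real x * cis (t * x)) (at t)"
proof -
  have "((\<lambda>z. exp (\<i> * of_real x * z)) has_field_derivative
      (\<i> * of_real x) * exp (\<i> * of_real x * of_real t)) (at (of_real t))"
    by (auto intro!: derivative_eq_intros)
  from has_vector_derivative_real_field[OF this]
  show ?thesis by (simp add: cis_conv_exp mult_ac)
qed

locale urep =
  fixes \<alpha> :: "complex^3^3 \<Rightarrow> 'v \<Rightarrow> 'v::complex_euclidean" and V :: "'v set"
  assumes rep: "unitary_rep \<alpha> V"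
begin

lemma csubspace: "complex_vector.subspace V"
  using rep by (simp add: unitary_rep_def)

lemma subspace: "subspace V"
  by (rule complex_subspace_imp_subspace[OF csubspace])

lemmas mem_add = complex_vector.subspace_add[OF csubspace]
lemmas mem_diff = complex_vector.subspace_diff[OF csubspace]
lemmas mem_scaleC = complex_vector.subspace_scale[OF csubspace]
lemmas mem_zero = complex_vector.subspace_0[OF csubspace]
lemmas mem_scaleR = subspace_scale[OF subspace]
lemmas mem_sum = complex_vector.subspace_sum[OF csubspace]

lemma mem: "g \<in> SU3 \<Longrightarrow> v \<in> V \<Longrightarrow> \<alpha> g v \<in> V"
  using rep by (simp add: unitary_rep_def)

lemma one: "v \<in> V \<Longrightarrow> \<alpha> (mat 1) v = v"
  using rep by (simp add: unitary_rep_def)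

lemma mult: "g \<in> SU3 \<Longrightarrow> h \<in> SU3 \<Longrightarrow> v \<in> V \<Longrightarrow> \<alpha> (g ** h) v = \<alpha> g (\<alpha> h v)"
  using rep by (simp add: unitary_rep_def)

lemma unitary: "g \<in> SU3 \<Longrightarrow> v \<in> V \<Longrightarrow> w \<in> V \<Longrightarrow> cinner (\<alpha> g v) (\<alpha> g w) = cinner v w"
  using rep by (simp add: unitary_rep_def)

lemma cont: "v \<in> V \<Longrightarrow> continuous_on SU3 (\<lambda>g. \<alpha> g v)"
  using rep by (simp add: unitary_rep_def)

lemma lin: "g \<in> SU3 \<Longrightarrow> v \<in> V \<Longrightarrow> w \<in> V \<Longrightarrow> \<alpha> g (a *\<^sub>C v + w) = a *\<^sub>C \<alpha> g v + \<alpha> g w"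
  using rep by (simp add: unitary_rep_def)

lemma add: "g \<in> SU3 \<Longrightarrow> v \<in> V \<Longrightarrow> w \<in> V \<Longrightarrow> \<alpha> g (v + w) = \<alpha> g v + \<alpha> g w"
  using lin[of g v w 1] by simp

lemma zero: "g \<in> SU3 \<Longrightarrow> \<alpha> g 0 = 0"
  using add[of g 0 0] mem_zero by simp

lemma scaleC: "g \<in> SU3 \<Longrightarrow> v \<in> V \<Longrightarrow> \<alpha> g (a *\<^sub>C v) = a *\<^sub>C \<alpha> g v"
  using lin[of g v 0 a] mem_zero zero by simp

lemma scaleR: "g \<in> SU3 \<Longrightarrow> v \<in> V \<Longrightarrow> \<alpha> g (r *\<^sub>R v) = r *\<^sub>R \<alpha> g v"
  using scaleC[of g v "of_real r"] by (simp add: scaleC_of_real)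

lemma diff: "g \<in> SU3 \<Longrightarrow> v \<in> V \<Longrightarrow> w \<in> V \<Longrightarrow> \<alpha> g (v - w) = \<alpha> g v - \<alpha> g w"
  using lin[of g w v "-1"] by simp

lemma sum: "g \<in> SU3 \<Longrightarrow> (\<And>i. i \<in> I \<Longrightarrow> f i \<in> V) \<Longrightarrow> \<alpha> g (\<Sum>i\<in>I. f i) = (\<Sum>i\<in>I. \<alpha> g (f i))"
  by (induction I rule: infinite_finite_induct) (auto simp: zero add mem_sum)

lemma norm: "g \<in> SU3 \<Longrightarrow> v \<in> V \<Longrightarrow> norm (\<alpha> g v) = norm v"
  using unitary[of g v v] by (simp add: cinner_self flip: of_real_power)

lemma inverse: "g \<in> SU3 \<Longrightarrow> v \<in> V \<Longrightarrow> \<alpha> (dagger g) (\<alpha> g v) = v"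
  "g \<in> SU3 \<Longrightarrow> v \<in> V \<Longrightarrow> \<alpha> g (\<alpha> (dagger g) v) = v"
  using mult[of "dagger g" g v] mult[of g "dagger g" v] one[of v]
  by (simp_all add: SU3_dagger SU3_inverse)

text \<open>The maps \<open>\<alpha> g\<close> are controlled on V only. Composed with this
  projection they become linear on the whole type, so that facts on bounded linear maps
  (integration, differentiation) apply.\<close>

lemma projection:
  obtains \<pi> where "linear \<pi>" "\<And>x. \<pi> x \<in> V" "\<And>x. x \<in> V \<Longrightarrow> \<pi> x = x"
proof -
  obtain B where B: "B \<subseteq> V" "independent B" "span B = V"
    by (metis basis_exists span_eq_iff subspace span_minimal subset_antisym)
  obtain \<pi> where \<pi>: "linear \<pi>" "\<forall>x\<in>B. \<pi> x = id x" "range \<pi> = span (id ` B)"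
    using real_vector.linear_independent_extend_subspace[OF B(2), of id] by (auto simp: linear_def)
  have "\<pi> x = x" if "x \<in> span B" for x
    using linear_eq_on_span[OF \<pi>(1) linear_id, of B] \<pi>(2) that by auto
  thus ?thesis using that[OF \<pi>(1)] \<pi>(3) B by auto
qed

abbreviation flow where "flow X t \<equiv> \<alpha> (mexp (t *\<^sub>R X))"

lemma flow_continuous:
  assumes "X \<in> su3" "v \<in> V"
  shows "continuous_on S (\<lambda>t. flow X t v)"
proof -
  have "continuous_on S ((\<lambda>g. \<alpha> g v) \<circ> (\<lambda>t. mexp (t *\<^sub>R X)))"
    using assms mexp_SU3
    by (intro continuous_on_compose mexp_continuous continuous_on_subset[OF cont]) auto
  thus ?thesis by (simp add: o_def)
qed

lemma flow_add:
  assumes "X \<in> su3" "v \<in> V"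
  shows "flow X (s + t) v = flow X s (flow X t v)"
  by (simp add: mexp_add mult mexp_SU3 assms)

text \<open>G is an antiderivative of the orbit of v, so G e - G 0 is its integral over [0,e]; by
  the group law \<open>flow X t\<close> moves this to the integral over [t, t+e]. The bounds on t
  and e keep t + s inside (-2,2), where G is known to be differentiable.\<close>

lemma flow_average:
  assumes X: "X \<in> su3" and v: "v \<in> V" and e: "0 < e" "e \<le> 1"
    and G: "\<And>x. x \<in> {-2<..<2} \<Longrightarrow> (G has_vector_derivative flow X x v) (at x)"
    and t: "t \<in> {-1<..<1}"
  shows "G e - G 0 \<in> V" "flow X t (G e - G 0) = G (t + e) - G t"
proof -
  obtain \<pi> where \<pi>: "linear \<pi>" "\<And>x. \<pi> x \<in> V" "\<And>x. x \<in> V \<Longrightarrow> \<pi> x = x"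
    using projection by blast
  define R where "R t v = flow X t v" for t v
  have RV: "R t w \<in> V" if "w \<in> V" for t w
    unfolding R_def by (intro mem mexp_SU3 X that)
  have i: "((\<lambda>s. R (t + s) v) has_integral G (t + e) - G t) {0..e}" if "t \<in> {-1<..<1}" for t
  proof -
    have "((\<lambda>s. R (t + s) v) has_integral (\<lambda>s. G (t + s)) e - (\<lambda>s. G (t + s)) 0) {0..e}"
    proof (rule fundamental_theorem_of_calculus)
      fix x assume x: "x \<in> {0..e}"
      have "((\<lambda>s. t + s) has_vector_derivative 1) (at x)"
        by (auto intro!: derivative_eq_intros)
      moreover have "(G has_vector_derivative R (t + x) v) (at (t + x))"
        unfolding R_def using x e that by (intro G) auto
      ultimately have "(G \<circ> (\<lambda>s. t + s) has_vector_derivative 1 *\<^sub>R R (t + x) v) (at x)"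
        by (rule vector_diff_chain_at)
      thus "((\<lambda>s. G (t + s)) has_vector_derivative R (t + x) v) (at x within {0..e})"
        by (simp add: o_def has_vector_derivative_at_within)
    qed (use e in auto)
    thus ?thesis by simp
  qed
  from i[of 0] have i0: "((\<lambda>s. R s v) has_integral G e - G 0) {0..e}" by simp
  \<comment> \<open>The projection fixes the integrand, hence the integral, which therefore lies in
    V.\<close>
  have "((\<lambda>s. \<pi> (R s v)) has_integral \<pi> (G e - G 0)) {0..e}"
    using has_integral_linear[OF i0, of \<pi>] \<pi>(1) by (simp add: o_def linear_conv_bounded_linear)
  hence "\<pi> (G e - G 0) = G e - G 0"
    using i0 by (simp add: \<pi>(3) RV v has_integral_unique)
  thus mem0: "G e - G 0 \<in> V" using \<pi>(2) by metis
  have L: "linear (\<lambda>x. R t (\<pi> x))"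
    unfolding R_def
    by (rule linearI) (simp_all add: linear_add[OF \<pi>(1)] linear_cmul[OF \<pi>(1)] add scaleR mexp_SU3 X \<pi>(2))
  have "((\<lambda>s. R t (\<pi> (R s v))) has_integral R t (\<pi> (G e - G 0))) {0..e}"
    using has_integral_linear[OF i0, of "\<lambda>x. R t (\<pi> x)"] L by (simp add: o_def linear_conv_bounded_linear)
  hence "((\<lambda>s. R (t + s) v) has_integral R t (G e - G 0)) {0..e}"
    using \<pi>(3)[OF mem0] \<pi>(3) RV[OF v] flow_add[OF X v, of t] by (simp add: R_def)
  thus "flow X t (G e - G 0) = G (t + e) - G t"
    using i[OF t] by (simp add: R_def has_integral_unique)
qed

text \<open>The averages of \<open>s \<mapsto> \<alpha> (mexp (s X)) v\<close> over short intervals are differentiable vectors and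
  converge to \<open>v\<close>; the differentiable vectors form a closed subspace, the dimension being finite.\<close>

lemma flow_differentiable_at_0:
  assumes X: "X \<in> su3" and v: "v \<in> V"
  shows "\<exists>D. ((\<lambda>t. flow X t v) has_vector_derivative D) (at 0)"
proof -
  define D where "D = {w \<in> V. \<exists>D. ((\<lambda>t. flow X t w) has_vector_derivative D) (at 0)}"
  have D: "subspace D"
    unfolding subspace_def D_def
    by (auto simp: mem_zero zero mem_add add mem_scaleR scaleR mexp_SU3 X
        intro: has_vector_derivative_const has_vector_derivative_add
          bounded_linear.has_vector_derivative[OF bounded_linear_scaleR_right])
  obtain G where G: "\<And>x. x \<in> {-2..2} \<Longrightarrow>
      (G has_vector_derivative flow X x v) (at x within {-2..2})"
    using antiderivative_continuous[OF flow_continuous[OF X v]] by metis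
  have G: "(G has_vector_derivative flow X x v) (at x)" if "x \<in> {-2<..<2}" for x
    using G[of x] that at_within_Icc_at[of "-2" x 2] by auto
  have w: "G e - G 0 \<in> D" if e: "0 < e" "e \<le> 1" for e
  proof -
    have "((\<lambda>t. G (t + e) - G t) has_vector_derivative
        flow X e v - flow X 0 v) (at 0)"
    proof (rule has_vector_derivative_diff)
      have "((\<lambda>t. t + e) has_vector_derivative 1) (at 0)"
        by (auto intro!: derivative_eq_intros)
      moreover have "(G has_vector_derivative flow X e v) (at (0 + e))"
        using G[of e] e by simp
      ultimately have "(G \<circ> (\<lambda>t. t + e) has_vector_derivative 1 *\<^sub>R flow X e v) (at 0)"
        by (rule vector_diff_chain_at)
      thus "((\<lambda>t. G (t + e)) has_vector_derivative flow X e v) (at 0)"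
        by (simp add: o_def)
    qed (rule G, simp)
    hence "((\<lambda>t. flow X t (G e - G 0)) has_vector_derivative
        flow X e v - flow X 0 v) (at 0)"
      by (rule has_vector_derivative_transform_within_open[of _ _ _ "{-1<..<1}"])
        (use flow_average(2)[OF X v e G] in auto)
    thus ?thesis using flow_average(1)[OF X v e G, of 0] by (auto simp: D_def)
  qed
  have "(\<lambda>n. real n *\<^sub>R (G (1 / real n) - G 0)) \<longlonglongrightarrow> 1 *\<^sub>R flow X 0 v"
    by (rule o_over_n_tendsto, rule G) simp
  hence "(\<lambda>n. real n *\<^sub>R (G (1 / real n) - G 0)) \<longlonglongrightarrow> v" by (simp add: one v)
  moreover have "eventually (\<lambda>n. real n *\<^sub>R (G (1 / real n) - G 0) \<in> D) sequentially"
    by (rule eventually_sequentiallyI[of 1], rule subspace_scale[OF D], rule w) auto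
  ultimately have "v \<in> D"
    using Lim_in_closed_set[OF closed_subspace[OF D]] by force
  thus ?thesis by (simp add: D_def)
qed

abbreviation d where "d \<equiv> su3_action \<alpha>"

lemma flow_derivative_0:
  assumes "X \<in> su3" "v \<in> V"
  shows "((\<lambda>t. flow X t v) has_vector_derivative d X v) (at 0)"
  using flow_differentiable_at_0[OF assms] unfolding su3_action_def
  by (metis vector_derivative_at)

lemma dI:
  assumes "((\<lambda>t. flow X t v) has_vector_derivative D) (at 0)"
  shows "d X v = D"
  unfolding su3_action_def by (rule vector_derivative_at[OF assms])

lemma d_mem:
  assumes "X \<in> su3" "v \<in> V"
  shows "d X v \<in> V"
proof -
  have "((\<lambda>h. (1 / h) *\<^sub>R (flow X (0 + h) v - flow X 0 v)) \<longlongrightarrow> d X v) (at 0)"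
    using flow_derivative_0[OF assms] unfolding has_vector_derivative_at_iff .
  thus ?thesis
    by (rule Lim_in_closed_set[OF closed_subspace[OF subspace], rotated 2])
      (auto intro!: always_eventually mem_scaleR mem_diff mem mexp_SU3 simp: one mexp_in_SU3 SU3_one assms su3_scaleR)
qed

lemma flow_derivative:
  assumes "X \<in> su3" "v \<in> V"
  shows "((\<lambda>t. flow X t v) has_vector_derivative d X (flow X t v)) (at t)"
  using flow_derivative_0[OF assms(1) mem[OF mexp_SU3[OF assms(1)] assms(2)]]
  unfolding has_vector_derivative_at_iff
  using flow_add[OF assms, of _ t] by (simp add: add.commute one assms mem mexp_SU3)

lemma d_add_right:
  assumes "X \<in> su3" "v \<in> V" "w \<in> V" shows "d X (v + w) = d X v + d X w"
  by (rule dI) (simp add: add mexp_SU3 assms has_vector_derivative_add flow_derivative_0)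

lemma d_scaleC_right:
  assumes "X \<in> su3" "v \<in> V" shows "d X (a *\<^sub>C v) = a *\<^sub>C d X v"
  by (rule dI) (simp add: scaleC mexp_SU3 assms flow_derivative_0
      bounded_linear.has_vector_derivative[OF bounded_linear_scaleC_right])

lemma d_minus_right:
  assumes "X \<in> su3" "v \<in> V" shows "d X (- v) = - d X v"
  using d_scaleC_right[OF assms, of "-1"] by simp

lemma d_diff_right:
  assumes "X \<in> su3" "v \<in> V" "w \<in> V" shows "d X (v - w) = d X v - d X w"
  using d_add_right[of X v "- w"] d_minus_right[of X w] mem_scaleC[of w "-1"] assms by simp

lemma d_zero_left: "v \<in> V \<Longrightarrow> d 0 v = 0"
  by (rule dI) (simp add: one)

lemma d_scaleR_left:
  assumes "X \<in> su3" "v \<in> V" shows "d (r *\<^sub>R X) v = r *\<^sub>R d X v"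
proof (rule dI)
  have "((\<lambda>t. t * r) has_vector_derivative r) (at 0)"
    by (auto intro!: derivative_eq_intros)
  moreover have "((\<lambda>t. flow X t v) has_vector_derivative d X v) (at (0 * r))"
    using flow_derivative_0[OF assms] by simp
  ultimately have "((\<lambda>t. flow X t v) \<circ> (\<lambda>t. t * r) has_vector_derivative r *\<^sub>R d X v) (at 0)"
    by (rule vector_diff_chain_at)
  thus "((\<lambda>t. flow (r *\<^sub>R X) t v) has_vector_derivative r *\<^sub>R d X v) (at 0)"
    by (simp add: o_def)
qed

lemma d_skew:
  assumes X: "X \<in> su3" and v: "v \<in> V" and w: "w \<in> V"
  shows "cinner (d X v) w = - cinner v (d X w)"
proof -
  have "((\<lambda>t. cinner (flow X t v) (flow X t w)) has_vector_derivative
      cinner (flow X 0 v) (d X w) + cinner (d X v) (flow X 0 w)) (at 0)"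
    by (intro bounded_bilinear.has_vector_derivative[OF bounded_bilinear_cinner] flow_derivative_0 assms)
  hence "((\<lambda>t. cinner v w) has_vector_derivative cinner v (d X w) + cinner (d X v) w) (at (0::real))"
    by (simp add: one unitary mexp_SU3 assms)
  hence "cinner v (d X w) + cinner (d X v) w = 0"
    by (metis has_vector_derivative_const vector_derivative_at)
  thus ?thesis by (simp add: eq_neg_iff_add_eq_0 add.commute)
qed

text \<open>Differentiates \<open>\<alpha> g\<close> applied to the orbit of v. This equivariance
  does the work of the commutation relations.\<close>

lemma d_conj:
  assumes X: "X \<in> su3" and g: "g \<in> SU3" and v: "v \<in> V"
  shows "d (g ** X ** dagger g) (\<alpha> g v) = \<alpha> g (d X v)"
proof (rule dI)
  obtain \<pi> where \<pi>: "linear \<pi>" "\<And>x. \<pi> x \<in> V" "\<And>x. x \<in> V \<Longrightarrow> \<pi> x = x"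
    using projection by blast
  have L: "bounded_linear (\<lambda>x. \<alpha> g (\<pi> x))"
    by (intro linear_conv_bounded_linear[THEN iffD1] linearI)
      (simp_all add: linear_add[OF \<pi>(1)] linear_cmul[OF \<pi>(1)] add scaleR g \<pi>(2))
  have "flow (g ** X ** dagger g) t (\<alpha> g v) = \<alpha> g (\<pi> (flow X t v))" for t
  proof -
    have "mexp (t *\<^sub>R (g ** X ** dagger g)) = g ** mexp (t *\<^sub>R X) ** dagger g"
      using mexp_conj[OF SU3_inverse[OF g], of "t *\<^sub>R X"]
      by (simp add: matrix_scaleR_left matrix_scaleR_right)
    thus ?thesis
      by (simp add: mult g SU3_mult SU3_dagger mexp_SU3 X v mem inverse \<pi>)
  qed
  moreover have "((\<lambda>t. \<alpha> g (\<pi> (flow X t v))) has_vector_derivative \<alpha> g (\<pi> (d X v))) (at 0)"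
    by (intro bounded_linear.has_vector_derivative[OF L] flow_derivative_0 X v)
  ultimately show "((\<lambda>t. flow (g ** X ** dagger g) t (\<alpha> g v))
      has_vector_derivative \<alpha> g (d X v)) (at 0)"
    by (simp add: \<pi> d_mem X v)
qed

text \<open>Expansion in an orthonormal basis. The bound is uniform in v but involves finitely many
  orbits only, so its behaviour for g near the identity follows from derivatives at the basis
  vectors.\<close>

lemma oscillation_bound:
  "\<exists>B. finite B \<and> B \<subseteq> V \<and>
    (\<forall>g\<in>SU3. \<forall>v\<in>V. norm (\<alpha> g v - v) \<le> (\<Sum>b\<in>B. norm (\<alpha> g b - b)) * norm v)"
proof -
  obtain B where B: "0 \<notin> B" "B \<subseteq> V" "pairwise orthogonal B" "\<And>x. x \<in> B \<Longrightarrow> norm x = 1"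
    "independent B" "span B = V"
    using orthonormal_basis_subspace[OF subspace] by (metis norm_zero zero_neq_one)
  have fin: "finite B" using B(5) independent_imp_finite by blast
  show ?thesis
  proof (intro exI[of _ B] conjI fin B(2) ballI)
    fix g v assume g: "g \<in> SU3" and v: "v \<in> V"
    obtain c where "v = (\<Sum>b\<in>B. c b *\<^sub>R b)"
      using v B(6) span_finite[OF fin] by auto
    moreover have "v \<bullet> b = c b" if "b \<in> B" for b
    proof -
      have "v \<bullet> b = (\<Sum>b'\<in>B. c b' * (b' \<bullet> b))" by (simp add: calculation inner_sum_left)
      also have "\<dots> = (\<Sum>b'\<in>B. if b' = b then c b else 0)"
        using B(3) that B(4)[OF that]
        by (intro sum.cong) (auto simp: pairwise_def orthogonal_def norm_eq_1)
      finally show ?thesis using that fin by simp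
    qed
    ultimately have e: "v = (\<Sum>b\<in>B. (v \<bullet> b) *\<^sub>R b)" by simp
    have "\<alpha> g v - v = (\<Sum>b\<in>B. (v \<bullet> b) *\<^sub>R (\<alpha> g b - b))"
    proof -
      have "\<alpha> g v = (\<Sum>b\<in>B. (v \<bullet> b) *\<^sub>R \<alpha> g b)"
        using B(2) by (subst e, subst sum[OF g]) (auto intro!: mem_scaleR sum.cong simp: scaleR g)
      hence "\<alpha> g v - v = (\<Sum>b\<in>B. (v \<bullet> b) *\<^sub>R \<alpha> g b) - (\<Sum>b\<in>B. (v \<bullet> b) *\<^sub>R b)"
        by (simp only: e[symmetric])
    thus ?thesis by (simp add: scaleR_diff_right sum_subtractf)
    qed
    also have "norm \<dots> \<le> (\<Sum>b\<in>B. norm v * norm (\<alpha> g b - b))"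
    proof (rule order_trans[OF norm_sum sum_mono])
      fix b assume "b \<in> B"
      thus "norm ((v \<bullet> b) *\<^sub>R (\<alpha> g b - b)) \<le> norm v * norm (\<alpha> g b - b)"
        using Cauchy_Schwarz_ineq2[of v b] B(4) by (simp add: mult_right_mono)
    qed
    finally show "norm (\<alpha> g v - v) \<le> (\<Sum>b\<in>B. norm (\<alpha> g b - b)) * norm v"
      by (simp add: sum_distrib_left mult.commute)
  qed
qed

lemma SU3_pow: "g \<in> SU3 \<Longrightarrow> matrix_pow g n \<in> SU3"
  by (induction n) (auto simp: SU3_one SU3_mult)

text \<open>With u = \<alpha> g v - v, the vector on the left is the sum of \<alpha> (g^k) u - u
  over k < n. Each term is at most k times the displacement of u, which is of second order in
  \<omega>.\<close>

lemma pow_diff_bound: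
  assumes g: "g \<in> SU3" and v: "v \<in> V"
    and \<omega>: "\<And>v. v \<in> V \<Longrightarrow> norm (\<alpha> g v - v) \<le> \<omega> * norm v"
  shows "norm (\<alpha> (matrix_pow g n) v - v - real n *\<^sub>R (\<alpha> g v - v)) \<le> (real n * \<omega>)\<^sup>2 * norm v"
\<comment> \<open>Nonnegativity of \<omega> is read off from the hypothesis at a nonzero
  vector.\<close>
proof (cases "v = 0")
  case True
  thus ?thesis by (simp add: zero g SU3_pow)
next
  case False
  have \<omega>0: "\<omega> \<ge> 0"
    using order_trans[OF norm_ge_zero \<omega>[OF v]] False by (simp add: zero_le_mult_iff)
  have p: "norm (\<alpha> (matrix_pow g k) u - u) \<le> real k * norm (\<alpha> g u - u)" if u: "u \<in> V" for k u
  proof (induction k)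
    case (Suc k)
    have "\<alpha> (matrix_pow g (Suc k)) u - u = \<alpha> g (\<alpha> (matrix_pow g k) u - u) + (\<alpha> g u - u)"
      by (simp add: mult diff g u SU3_pow mem)
    hence "norm (\<alpha> (matrix_pow g (Suc k)) u - u)
        \<le> norm (\<alpha> g (\<alpha> (matrix_pow g k) u - u)) + norm (\<alpha> g u - u)"
      by (metis norm_triangle_ineq)
    also have "norm (\<alpha> g (\<alpha> (matrix_pow g k) u - u)) = norm (\<alpha> (matrix_pow g k) u - u)"
      by (intro norm mem_diff mem SU3_pow g u)
    finally show ?case using Suc by (simp add: algebra_simps)
  qed (simp add: one u)
  let ?u = "\<alpha> g v - v"
  have u: "?u \<in> V" by (intro mem_diff mem g v)
  have uu: "norm (\<alpha> g ?u - ?u) \<le> \<omega>\<^sup>2 * norm v"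
    using order_trans[OF \<omega>[OF u] mult_left_mono[OF \<omega>[OF v] \<omega>0]] by (simp add: power2_eq_square mult.assoc)
  have "norm (\<alpha> (matrix_pow g n) v - v - real n *\<^sub>R ?u) \<le> real n * (real n * (\<omega>\<^sup>2 * norm v))"
  proof (induction n)
    case (Suc n)
    have "\<alpha> (matrix_pow g (Suc n)) v - v - real (Suc n) *\<^sub>R ?u
        = (\<alpha> (matrix_pow g n) v - v - real n *\<^sub>R ?u) + (\<alpha> (matrix_pow g n) ?u - ?u)"
      unfolding matrix_pow_Suc2 by (simp add: mult diff g v SU3_pow mem algebra_simps)
    hence "norm (\<alpha> (matrix_pow g (Suc n)) v - v - real (Suc n) *\<^sub>R ?u)
        \<le> norm (\<alpha> (matrix_pow g n) v - v - real n *\<^sub>R ?u) + norm (\<alpha> (matrix_pow g n) ?u - ?u)"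
      by (metis norm_triangle_ineq)
    also have "norm (\<alpha> (matrix_pow g n) ?u - ?u) \<le> real n * (\<omega>\<^sup>2 * norm v)"
      by (rule order_trans[OF p[OF u] mult_left_mono[OF uu]]) simp
    also note Suc
    also have "real n * (real n * (\<omega>\<^sup>2 * norm v)) + real n * (\<omega>\<^sup>2 * norm v)
        = real n * (real (Suc n) * (\<omega>\<^sup>2 * norm v))"
      by (simp add: algebra_simps)
    also have "\<dots> \<le> real (Suc n) * (real (Suc n) * (\<omega>\<^sup>2 * norm v))"
      using \<omega>0 by (intro mult_right_mono) auto
    finally show ?case by simp
  qed (simp add: one v)
  thus ?thesis by (simp add: power2_eq_square algebra_simps)
qed

text \<open>With \<open>g = mexp (h X) mexp (h Y)\<close>, \<open>h = t/n\<close>, the powers \<open>g\<^sup>n\<close> tend to \<open>mexp (t (X + Y))\<close>, and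
  \<open>\<alpha> (g\<^sup>n) v - v\<close> differs from \<open>n (\<alpha> g v - v) \<longlonglongrightarrow> t (d X v + d Y v)\<close> by at most \<open>O(t\<^sup>2)\<close>.\<close>

lemma d_add_left:
  assumes X: "X \<in> su3" and Y: "Y \<in> su3" and v: "v \<in> V"
  shows "d (X + Y) v = d X v + d Y v"
proof -
  define g where "g h = mexp (h *\<^sub>R X) ** mexp (h *\<^sub>R Y)" for h
  have gS: "g h \<in> SU3" for h unfolding g_def by (intro SU3_mult mexp_SU3 X Y)
  \<comment> \<open>The difference quotient of \<alpha> (g h) w is the quotient for X plus
    \<open>flow X h\<close> applied to the quotient for Y. The operator \<open>flow X h\<close>
    varies with h, but being isometric it still sends the error of the second quotient to 0.\<close>
  have gd: "((\<lambda>h. \<alpha> (g h) w) has_vector_derivative d X w + d Y w) (at 0)" if w: "w \<in> V" for w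
    unfolding has_vector_derivative_at_iff
  proof -
    let ?q = "\<lambda>h. (1 / h) *\<^sub>R (flow Y h w - w)"
    have q: "(?q \<longlongrightarrow> d Y w) (at 0)"
      using flow_derivative_0[OF Y w] unfolding has_vector_derivative_at_iff by (simp add: one w)
    have r: "((\<lambda>h. (1 / h) *\<^sub>R (flow X h w - w)) \<longlongrightarrow> d X w) (at 0)"
      using flow_derivative_0[OF X w] unfolding has_vector_derivative_at_iff by (simp add: one w)
    have dY: "d Y w \<in> V" by (rule d_mem[OF Y w])
    have "((\<lambda>h. flow X h (d Y w)) \<longlongrightarrow> flow X 0 (d Y w)) (at 0)"
      using bspec[OF flow_continuous[OF X dY, of UNIV, unfolded continuous_on_def], of 0] by simp
    hence s: "((\<lambda>h. flow X h (d Y w)) \<longlongrightarrow> d Y w) (at 0)" by (simp add: one dY)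
    have "((\<lambda>h. flow X h (?q h - d Y w)) \<longlongrightarrow> 0) (at 0)"
    proof (rule Lim_null_comparison)
      have "?q h - d Y w \<in> V" for h
        by (intro mem_diff mem_scaleR mem mexp_SU3 Y w dY)
      thus "\<forall>\<^sub>F h in at 0. norm (flow X h (?q h - d Y w)) \<le> norm (?q h - d Y w)"
        by (intro always_eventually) (simp add: norm mexp_SU3 X)
      show "((\<lambda>h. norm (?q h - d Y w)) \<longlongrightarrow> 0) (at 0)"
        using q by (simp add: tendsto_norm_zero_iff LIM_zero_iff)
    qed
    from tendsto_add[OF tendsto_add[OF this s] r]
    have "((\<lambda>h. flow X h (?q h - d Y w) + flow X h (d Y w)
          + (1 / h) *\<^sub>R (flow X h w - w)) \<longlongrightarrow> d X w + d Y w) (at 0)"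
      by (simp add: add.commute)
    thus "((\<lambda>h. (1 / h) *\<^sub>R (\<alpha> (g (0 + h)) w - \<alpha> (g 0) w)) \<longlongrightarrow> d X w + d Y w) (at 0)"
    proof (rule Lim_transform_eventually)
      show "\<forall>\<^sub>F h in at 0. flow X h (?q h - d Y w) + flow X h (d Y w)
          + (1 / h) *\<^sub>R (flow X h w - w)
          = (1 / h) *\<^sub>R (\<alpha> (g (0 + h)) w - \<alpha> (g 0) w)"
      proof (intro always_eventually allI)
        fix h
        have m: "?q h \<in> V" by (intro mem_diff mem_scaleR mem mexp_SU3 Y w dY)
        have "flow X h (?q h) = (1 / h) *\<^sub>R (\<alpha> (g h) w - flow X h w)"
          by (simp add: g_def scaleR diff mult mexp_SU3 X Y w mem mem_diff)
        thus "flow X h (?q h - d Y w) + flow X h (d Y w)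
          + (1 / h) *\<^sub>R (flow X h w - w)
          = (1 / h) *\<^sub>R (\<alpha> (g (0 + h)) w - \<alpha> (g 0) w)"
          unfolding diff[OF mexp_SU3[OF X] m dY] by (simp add: one w g_def scaleR_diff_right)
      qed
    qed
  qed
  obtain B where B: "finite B" "B \<subseteq> V"
    "\<And>g v. g \<in> SU3 \<Longrightarrow> v \<in> V \<Longrightarrow> norm (\<alpha> g v - v) \<le> (\<Sum>b\<in>B. norm (\<alpha> g b - b)) * norm v"
    using oscillation_bound by auto
  \<comment> \<open>A bound for the displacement of unit vectors by \<alpha> (g h). Since n \<omega>
    (t/n) tends to |t| \<Omega>, the error in \<open>pow_diff_bound\<close> becomes quadratic in
    t.\<close>
  define \<omega> where "\<omega> h = (\<Sum>b\<in>B. norm (\<alpha> (g h) b - b))" for h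
  define \<Omega> where "\<Omega> = (\<Sum>b\<in>B. norm (d X b + d Y b))"
  define L where "L = d X v + d Y v"
  have g0: "\<alpha> (g 0) w = w" if "w \<in> V" for w using that by (simp add: g_def one)
  have \<omega>: "(\<lambda>n. real n * \<omega> (t / real n)) \<longlonglongrightarrow> \<bar>t\<bar> * \<Omega>" for t
  proof -
    have "(\<lambda>n. real n * norm (\<alpha> (g (t / real n)) b - b)) \<longlonglongrightarrow> \<bar>t\<bar> * norm (d X b + d Y b)"
      if "b \<in> B" for b
      using tendsto_norm[OF o_over_n_tendsto[OF gd, of b t]] that B(2) g0[of b] by (auto simp: subset_iff)
    hence "(\<lambda>n. \<Sum>b\<in>B. real n * norm (\<alpha> (g (t / real n)) b - b))
        \<longlonglongrightarrow> (\<Sum>b\<in>B. \<bar>t\<bar> * norm (d X b + d Y b))"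
      by (rule tendsto_sum)
    thus ?thesis by (simp add: \<omega>_def \<Omega>_def sum_distrib_left)
  qed
  have bound: "norm (flow (X + Y) t v - v - t *\<^sub>R L) \<le> (\<bar>t\<bar> * \<Omega>)\<^sup>2 * norm v" for t
  proof (rule LIMSEQ_le)
    have "(\<lambda>n. \<alpha> (matrix_pow (g (t / real n)) n) v) \<longlonglongrightarrow> flow (X + Y) t v"
      using cont[OF v] lie_product[OF X Y, of t] SU3_pow[OF gS] mexp_SU3[OF su3_add[OF X Y]]
      unfolding continuous_on_sequentially g_def by (auto simp: o_def)
    moreover have "(\<lambda>n. real n *\<^sub>R (\<alpha> (g (t / real n)) v - v)) \<longlonglongrightarrow> t *\<^sub>R L"
      using o_over_n_tendsto[OF gd[OF v], of t] by (simp add: g0 v L_def)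
    ultimately show "(\<lambda>n. norm (\<alpha> (matrix_pow (g (t / real n)) n) v - v
          - real n *\<^sub>R (\<alpha> (g (t / real n)) v - v)))
        \<longlonglongrightarrow> norm (flow (X + Y) t v - v - t *\<^sub>R L)"
      by (intro tendsto_norm tendsto_diff tendsto_const)
    show "(\<lambda>n. (real n * \<omega> (t / real n))\<^sup>2 * norm v) \<longlonglongrightarrow> (\<bar>t\<bar> * \<Omega>)\<^sup>2 * norm v"
      by (intro tendsto_intros \<omega>)
    show "\<exists>N. \<forall>n\<ge>N. norm (\<alpha> (matrix_pow (g (t / real n)) n) v - v
          - real n *\<^sub>R (\<alpha> (g (t / real n)) v - v)) \<le> (real n * \<omega> (t / real n))\<^sup>2 * norm v"
      using pow_diff_bound[OF gS v B(3)[OF gS]] by (auto simp: \<omega>_def)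
  qed
  have "((\<lambda>t. flow (X + Y) t v) has_vector_derivative L) (at 0)"
    unfolding has_vector_derivative_at_iff
  proof (rule LIM_zero_cancel, rule Lim_null_comparison)
    show "\<forall>\<^sub>F h in at 0. norm ((1 / h) *\<^sub>R (flow (X + Y) (0 + h) v
        - flow (X + Y) 0 v) - L) \<le> \<bar>h\<bar> * (\<Omega>\<^sup>2 * norm v)"
      unfolding eventually_at_filter
    proof (intro always_eventually allI impI)
      fix h :: real assume h: "h \<noteq> 0"
      have "(1 / h) *\<^sub>R (flow (X + Y) (0 + h) v - flow (X + Y) 0 v) - L
          = (1 / h) *\<^sub>R (flow (X + Y) h v - v - h *\<^sub>R L)"
        using h by (simp add: one v scaleR_diff_right)
      hence "norm ((1 / h) *\<^sub>R (flow (X + Y) (0 + h) v - flow (X + Y) 0 v) - L)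
          = (1 / \<bar>h\<bar>) * norm (flow (X + Y) h v - v - h *\<^sub>R L)"
        by simp
      also have "\<dots> \<le> (1 / \<bar>h\<bar>) * ((\<bar>h\<bar> * \<Omega>)\<^sup>2 * norm v)"
        by (intro mult_left_mono bound) auto
      also have "\<dots> = \<bar>h\<bar> * (\<Omega>\<^sup>2 * norm v)"
        using h by (simp add: power2_eq_square field_simps)
      finally show "norm ((1 / h) *\<^sub>R (flow (X + Y) (0 + h) v
          - flow (X + Y) 0 v) - L) \<le> \<bar>h\<bar> * (\<Omega>\<^sup>2 * norm v)" .
    qed
    have "((\<lambda>h. \<bar>h\<bar> * (\<Omega>\<^sup>2 * norm v)) \<longlongrightarrow> \<bar>0\<bar> * (\<Omega>\<^sup>2 * norm v)) (at (0::real))"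
      by (intro tendsto_intros)
    thus "((\<lambda>h. \<bar>h\<bar> * (\<Omega>\<^sup>2 * norm v)) \<longlongrightarrow> 0) (at (0::real))" by simp
  qed
  thus ?thesis unfolding L_def by (rule dI)
qed

text \<open>Skewness makes the norm of a solution constant, so uniqueness for the flow equation
  needs no growth estimate.\<close>

lemma flow_equation_zero:
  assumes X: "X \<in> su3" and FV: "\<And>s. F s \<in> V" and F0: "F 0 = 0"
    and dF: "\<And>s. (F has_vector_derivative d X (F s)) (at s)"
  shows "F t = 0"
proof -
  have "((\<lambda>s. cinner (F s) (F s)) has_vector_derivative 0) (at s)" for s
    using bounded_bilinear.has_vector_derivative[OF bounded_bilinear_cinner dF[of s] dF[of s]]
    by (simp add: d_skew[OF X FV FV])
  hence "cinner (F t) (F t) = cinner (F 0) (F 0)" by (rule zero_derivative_constant)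
  thus ?thesis by (simp add: F0 cinner_eq_zero_iff)
qed

text \<open>The orbit and the curve cis (t l) v solve the same equation with the same initial value;
  their difference vanishes by \<open>flow_equation_zero\<close>.\<close>

lemma flow_eigenvector:
  assumes X: "X \<in> su3" and v: "v \<in> V" and eig: "d X v = (\<i> * of_real l) *\<^sub>C v"
  shows "flow X t v = cis (t * l) *\<^sub>C v"
proof -
  define F where "F s = flow X s v - cis (s * l) *\<^sub>C v" for s
  have FV: "F s \<in> V" for s unfolding F_def by (intro mem_diff mem mexp_SU3 X v mem_scaleC)
  have c: "((\<lambda>s. cis (s * l) *\<^sub>C v) has_vector_derivative (\<i> * of_real l) *\<^sub>C cis (s * l) *\<^sub>C v) (at s)" for s
  proof -
    from bounded_linear.has_vector_derivative[OF
        bounded_bilinear.bounded_linear_left[OF bounded_bilinear_scaleC] cis_has_vector_derivative[of l s]]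
    show ?thesis by (simp add: scaleC_scaleC scaleR_conv_of_real algebra_simps)
  qed
  have dF: "(F has_vector_derivative d X (F s)) (at s)" for s
  proof -
    have "d X (F s) = d X (flow X s v) - d X (cis (s * l) *\<^sub>C v)"
      unfolding F_def by (intro d_diff_right X mem mem_scaleC mexp_SU3 v)
    also have "d X (cis (s * l) *\<^sub>C v) = (\<i> * of_real l) *\<^sub>C cis (s * l) *\<^sub>C v"
      by (simp add: d_scaleC_right X v eig scaleC_scaleC mult.commute)
    finally show ?thesis
      unfolding F_def[abs_def] using flow_derivative[OF X v, of s] c[of s]
      by (auto intro: has_vector_derivative_diff)
  qed
  have "F t = 0"
    by (rule flow_equation_zero[OF X FV _ dF]) (simp add: F_def one v)
  thus ?thesis by (simp add: F_def)
qed

end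

section \<open>Generators of SU(3) and the isotropy group\<close>

text \<open>Uniqueness of the fundamental solution: exp(- u X) R u has derivative zero. It
  identifies the explicit torus and rotation matrices below.\<close>

lemma mexp_eqI:
  fixes X :: "complex^'n^'n"
  assumes R: "\<And>t. (R has_vector_derivative X ** R t) (at t)" and "R 0 = mat 1"
  shows "mexp (t *\<^sub>R X) = R t"
proof -
  define F where "F u = mexp (u *\<^sub>R (- X)) ** R u" for u
  have "(F has_vector_derivative 0) (at u)" for u
  proof -
    from bounded_bilinear.has_vector_derivative[OF bounded_bilinear_matrix_mult
        mexp_has_vector_derivative[of "- X" u] R[of u]]
    have "(F has_vector_derivative mexp (u *\<^sub>R (- X)) ** (X ** R u)
        + ((- X) ** mexp (u *\<^sub>R (- X))) ** R u) (at u)"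
      by (simp add: F_def[abs_def])
    moreover have "Y ** (- Z) = - (Y ** Z)" for Y Z :: "complex^'n^'n"
      using matrix_scaleR_right[of Y "-1" Z] by simp
    moreover have "(- Y) ** Z = - (Y ** Z)" for Y Z :: "complex^'n^'n"
      using matrix_scaleR_left[of "-1" Y Z] by simp
    ultimately show ?thesis
      using matrix_mult_mexp_commute[of "- X" u] by (simp add: matrix_mul_assoc)
  qed
  hence "F t = F 0" by (rule zero_derivative_constant)
  hence "mexp ((- t) *\<^sub>R X) ** R t = mat 1" by (simp add: F_def assms(2))
  hence "mexp (t *\<^sub>R X) ** (mexp ((- t) *\<^sub>R X) ** R t) = mexp (t *\<^sub>R X)" by simp
  moreover have "mexp (t *\<^sub>R X) ** mexp ((- t) *\<^sub>R X) = mat 1"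
    by (simp only: mexp_add[symmetric]) simp
  ultimately show ?thesis by (simp only: matrix_mul_assoc matrix_mul_lid)
qed

definition diag3 :: "complex \<Rightarrow> complex \<Rightarrow> complex \<Rightarrow> complex^3^3"
  where "diag3 a b c = vector [vector [a, 0, 0], vector [0, b, 0], vector [0, 0, c]]"

definition torus :: "real \<Rightarrow> real \<Rightarrow> real \<Rightarrow> complex^3^3"
  where "torus x y z = diag3 (cis x) (cis y) (cis z)"

definition torus_gen :: "real \<Rightarrow> real \<Rightarrow> real \<Rightarrow> complex^3^3"
  where "torus_gen x y z = diag3 (\<i> * of_real x) (\<i> * of_real y) (\<i> * of_real z)"

definition rot12 :: "real \<Rightarrow> complex^3^3"
  where "rot12 t = vector [vector [of_real (cos t), - of_real (sin t), 0],
    vector [of_real (sin t), of_real (cos t), 0], vector [0, 0, 1]]"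

definition rot23 :: "real \<Rightarrow> complex^3^3"
  where "rot23 t = vector [vector [1, 0, 0], vector [0, of_real (cos t), - of_real (sin t)],
    vector [0, of_real (sin t), of_real (cos t)]]"

lemmas mat3_simps = vec_eq_iff forall_3 matrix_matrix_mult_def matrix_vector_mult_def sum_3 mat_def
  unit_matrix_def

lemma dagger_torus: "dagger (torus x y z) = torus (- x) (- y) (- z)"
  by (simp add: torus_def diag3_def mat3_simps cis_cnj)

lemma dagger_rot12: "dagger (rot12 t) = rot12 (- t)"
  by (simp add: rot12_def mat3_simps)

lemma dagger_rot23: "dagger (rot23 t) = rot23 (- t)"
  by (simp add: rot23_def mat3_simps)

lemma torus_SU3: "x + y + z = 0 \<Longrightarrow> torus x y z \<in> SU3"
  by (simp add: SU3_def dagger_torus det_3)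
    (simp add: torus_def diag3_def mat3_simps cis_mult)

lemma of_real_sin_cos: "complex_of_real (sin t) * of_real (sin t) + of_real (cos t) * of_real (cos t) = 1"
  using sin_cos_squared_add[of t]
  by (metis (mono_tags, lifting) of_real_1 of_real_add of_real_mult power2_eq_square)

lemma rot12_SU3: "rot12 t \<in> SU3"
  using of_real_sin_cos[of t] unfolding SU3_def mem_Collect_eq dagger_rot12
  by (simp add: rot12_def mat3_simps det_3 algebra_simps)

lemma rot23_SU3: "rot23 t \<in> SU3"
  using of_real_sin_cos[of t] unfolding SU3_def mem_Collect_eq dagger_rot23
  by (simp add: rot23_def mat3_simps det_3 algebra_simps)

lemma torus_gen_su3: "x + y + z = 0 \<Longrightarrow> torus_gen x y z \<in> su3"
  by (simp add: su3_def torus_gen_def diag3_def mat3_simps trace_def flip: distrib_left of_real_add)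

lemma mexp_torus_gen: "mexp (t *\<^sub>R torus_gen x y z) = torus (t * x) (t * y) (t * z)"
proof (rule mexp_eqI)
  show "((\<lambda>t. torus (t * x) (t * y) (t * z)) has_vector_derivative
      torus_gen x y z ** torus (t * x) (t * y) (t * z)) (at t)" for t
  proof (intro has_vector_derivative_vecI)
    fix i j :: 3
    show "((\<lambda>t. torus (t * x) (t * y) (t * z) $ i $ j) has_vector_derivative
        (torus_gen x y z ** torus (t * x) (t * y) (t * z)) $ i $ j) (at t)"
      using exhaust_3[of i] exhaust_3[of j]
      by (elim disjE) (simp_all add: torus_def torus_gen_def diag3_def mat3_simps cis_has_vector_derivative)
  qed
qed (simp add: torus_def diag3_def mat3_simps)

lemma mexp_rot12: "mexp (t *\<^sub>R (unit_matrix 2 1 - unit_matrix 1 2)) = rot12 t"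
proof (rule mexp_eqI)
  show "(rot12 has_vector_derivative (unit_matrix 2 1 - unit_matrix 1 2) ** rot12 t) (at t)" for t
  proof (intro has_vector_derivative_vecI)
    fix i j :: 3
    show "((\<lambda>t. rot12 t $ i $ j) has_vector_derivative
        ((unit_matrix 2 1 - unit_matrix 1 2) ** rot12 t) $ i $ j) (at t)"
      using exhaust_3[of i] exhaust_3[of j]
      by (elim disjE) (auto simp: rot12_def mat3_simps intro!: derivative_eq_intros)
  qed
qed (simp add: rot12_def mat3_simps)

lemma mexp_rot23: "mexp (t *\<^sub>R (unit_matrix 3 2 - unit_matrix 2 3)) = rot23 t"
proof (rule mexp_eqI)
  show "(rot23 has_vector_derivative (unit_matrix 3 2 - unit_matrix 2 3) ** rot23 t) (at t)" for t
  proof (intro has_vector_derivative_vecI)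
    fix i j :: 3
    show "((\<lambda>t. rot23 t $ i $ j) has_vector_derivative
        ((unit_matrix 3 2 - unit_matrix 2 3) ** rot23 t) $ i $ j) (at t)"
      using exhaust_3[of i] exhaust_3[of j]
      by (elim disjE) (auto simp: rot23_def mat3_simps intro!: derivative_eq_intros)
  qed
qed (simp add: rot23_def mat3_simps)

section \<open>Factorization of SU(3) and of the isotropy group into torus elements and
  rotations\<close>

lemma cis_Arg_cancel: "cis (- Arg a) * a = of_real (cmod a)"
proof -
  have "cis (- Arg a) * rcis (cmod a) (Arg a) = of_real (cmod a)"
    by (simp add: rcis_def cis_mult)
  thus ?thesis by (simp add: rcis_cmod_Arg)
qed

text \<open>Rotates the planar vector a + i b onto the nonnegative real axis; the angle is minus its
  argument.\<close>

lemma rotate_to_axis: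
  fixes a b :: real
  obtains t where "sin t * a + cos t * b = 0" "cos t * a - sin t * b \<ge> 0"
proof -
  have "cis (- Arg (Complex a b)) * Complex a b = of_real (cmod (Complex a b))"
    by (rule cis_Arg_cancel)
  thus ?thesis
    by (intro that[of "- Arg (Complex a b)"]) (auto simp: complex_eq_iff algebra_simps)
qed

text \<open>Successively: a torus element makes the second and third coordinates nonnegative reals,
  \<open>rot23\<close> removes the third, a torus element makes the first real, and
  \<open>rot12\<close> removes the second.\<close>

lemma SU3_to_axis:
  obtains x y z t x' z' s R where
    "x + y + z = 0" "x' + z' = 0" "R \<ge> 0"
    "(rot12 s ** torus x' 0 z' ** rot23 t ** torus x y z) *v v = of_real R *\<^sub>C axis 1 1"
proof -
  let ?a = "v $ 1" and ?b = "v $ 2" and ?c = "v $ 3"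
  \<comment> \<open>Forced by determinant 1. It disturbs the phase of the first coordinate; the
    later torus element corrects that and puts the opposite phase on the third coordinate, by then
    0.\<close>
  define x where "x = Arg ?b + Arg ?c"
  define a' where "a' = cis x * ?a"
  obtain t where t: "sin t * cmod ?b + cos t * cmod ?c = 0"
    by (rule rotate_to_axis)
  define r where "r = cos t * cmod ?b - sin t * cmod ?c"
  obtain s where s: "sin s * cmod a' + cos s * r = 0" "cos s * cmod a' - sin s * r \<ge> 0"
    by (rule rotate_to_axis)
  have 1: "torus x (- Arg ?b) (- Arg ?c) *v v = vector [a', of_real (cmod ?b), of_real (cmod ?c)]"
    using cis_Arg_cancel[of ?b] cis_Arg_cancel[of ?c]
    by (simp add: torus_def diag3_def mat3_simps a'_def)
  have 2: "rot23 t *v vector [a', of_real (cmod ?b), of_real (cmod ?c)] = vector [a', of_real r, 0]"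
    using t unfolding r_def
    by (simp add: rot23_def mat3_simps del: of_real_mult of_real_add of_real_diff
        flip: of_real_mult of_real_add of_real_diff)
  have 3: "torus (- Arg a') 0 (Arg a') *v vector [a', of_real r, 0] = vector [of_real (cmod a'), of_real r, 0]"
    using cis_Arg_cancel[of a'] by (simp add: torus_def diag3_def mat3_simps)
  have 4: "rot12 s *v vector [of_real (cmod a'), of_real r, 0]
      = of_real (cos s * cmod a' - sin s * r) *\<^sub>C axis 1 1"
    using s(1) by (simp add: rot12_def mat3_simps axis_def
        del: of_real_mult of_real_add of_real_diff flip: of_real_mult of_real_add of_real_diff)
  show ?thesis
    by (rule that[of x "- Arg ?b" "- Arg ?c" "- Arg a'" "Arg a'" "cos s * cmod a' - sin s * r" s t])
      (use s(2) in \<open>simp_all add: x_def[symmetric] matrix_vector_mul_assoc[symmetric] 1 2 3 4\<close>, simp add: x_def)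
qed

lemma diag_SU3_torus:
  assumes "m \<in> SU3" "m = diag3 a b c"
  obtains x y z where "x + y + z = 0" "m = torus x y z"
proof -
  have "dagger m ** m = mat 1" "det m = 1" using assms by (auto simp: SU3_def)
  hence u: "cnj a * a = 1" "cnj b * b = 1" "a * b * c = 1"
    unfolding assms(2) by (simp_all add: diag3_def mat3_simps det_3)
  hence n: "cmod a = 1" "cmod b = 1"
    by (simp_all add: complex_mod_sqrt_Re_mult_cnj mult.commute)
  hence ab: "a = cis (Arg a)" "b = cis (Arg b)"
    using rcis_cmod_Arg[of a] rcis_cmod_Arg[of b] by (simp_all add: rcis_def)
  have "c = cis (- (Arg a + Arg b))"
  proof -
    have "c = inverse (a * b)" using u(3) inverse_unique by metis
    also have "\<dots> = inverse (cis (Arg a + Arg b))" using ab by (simp add: cis_mult[symmetric])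
    finally show ?thesis by (simp add: cis_inverse)
  qed
  thus ?thesis
    by (intro that[of "Arg a" "Arg b" "- (Arg a + Arg b)"]) (use ab in \<open>simp_all add: assms(2) torus_def\<close>)
qed

text \<open>Orthogonality of columns makes g block diagonal. A torus element and a rotation clear
  the (3,2) entry, and a unitary triangular matrix is diagonal.\<close>

lemma isotropy_decomp:
  assumes g: "g \<in> SU3" "g $ 2 $ 1 = 0" "g $ 3 $ 1 = 0"
  obtains x y z t x' y' z' where "x + y + z = 0" "x' + y' + z' = 0"
    "g = torus x y z ** rot23 t ** torus x' y' z'"
proof -
  let ?b = "g $ 2 $ 2" and ?c = "g $ 3 $ 2"
  define x where "x = Arg ?b + Arg ?c"
  obtain t where t: "sin t * cmod ?b + cos t * cmod ?c = 0"
    by (rule rotate_to_axis)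
  define r where "r = cos t * cmod ?b - sin t * cmod ?c"
  define T where "T = torus x (- Arg ?b) (- Arg ?c)"
  have T: "T \<in> SU3" unfolding T_def by (intro torus_SU3) (simp add: x_def)
  define m where "m = rot23 t ** (T ** g)"
  have m: "m \<in> SU3" unfolding m_def by (intro SU3_mult rot23_SU3 T g)
  have gg: "dagger g ** g = mat 1" using SU3_inverse g by blast
  have g11: "g $ 1 $ 1 \<noteq> 0"
  proof
    assume "g $ 1 $ 1 = 0"
    hence "(dagger g ** g) $ 1 $ 1 = 0" using g by (simp add: matrix_matrix_mult_def sum_3)
    thus False by (simp add: gg mat_def)
  qed
  have "(dagger g ** g) $ 1 $ 2 = cnj (g $ 1 $ 1) * g $ 1 $ 2"
    using g by (simp add: matrix_matrix_mult_def sum_3)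
  hence g12: "g $ 1 $ 2 = 0" using g11 by (simp add: gg mat_def)
  have m1: "m $ 1 $ 1 \<noteq> 0" "m $ 2 $ 1 = 0" "m $ 3 $ 1 = 0" "m $ 1 $ 2 = 0"
    using g g11 g12 by (simp_all add: m_def T_def torus_def diag3_def rot23_def mat3_simps)
  have m2: "m $ 3 $ 2 = 0"
    using t cis_Arg_cancel[of ?b] cis_Arg_cancel[of ?c]
    by (simp add: m_def T_def torus_def diag3_def rot23_def mat3_simps
        del: of_real_mult of_real_add of_real_diff flip: of_real_mult of_real_add of_real_diff)
  have mm: "dagger m ** m = mat 1" using SU3_inverse m by blast
  have m22: "m $ 2 $ 2 \<noteq> 0"
  proof
    assume "m $ 2 $ 2 = 0"
    hence "(dagger m ** m) $ 2 $ 2 = 0" using m1 m2 by (simp add: matrix_matrix_mult_def sum_3)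
    thus False by (simp add: mm mat_def)
  qed
  have "(dagger m ** m) $ 1 $ 3 = cnj (m $ 1 $ 1) * m $ 1 $ 3"
    "(dagger m ** m) $ 2 $ 3 = cnj (m $ 2 $ 2) * m $ 2 $ 3"
    using m1 m2 by (simp_all add: matrix_matrix_mult_def sum_3)
  hence m3: "m $ 1 $ 3 = 0" "m $ 2 $ 3 = 0" using m1 m22 by (simp_all add: mm mat_def)
  have "m = diag3 (m $ 1 $ 1) (m $ 2 $ 2) (m $ 3 $ 3)"
    using m1 m2 m3 by (simp add: diag3_def vec_eq_iff forall_3)
  then obtain x' y' z' where xyz: "x' + y' + z' = 0" "m = torus x' y' z'"
    using diag_SU3_torus[OF m] by metis
  have "g = dagger T ** (dagger (rot23 t) ** m)"
  proof -
    have "dagger T ** (dagger (rot23 t) ** m) = dagger T ** (dagger (rot23 t) ** rot23 t) ** T ** g"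
      by (simp only: m_def matrix_mul_assoc)
    thus ?thesis by (simp add: SU3_inverse[OF T] SU3_inverse[OF rot23_SU3])
  qed
  hence "g = torus (- x) (Arg ?b) (Arg ?c) ** rot23 (- t) ** torus x' y' z'"
    by (simp add: T_def dagger_torus dagger_rot23 xyz matrix_mul_assoc)
  moreover have "- x + Arg ?b + Arg ?c = 0" by (simp add: x_def)
  ultimately show ?thesis using that xyz(1) by blast
qed

lemma SU3_axis:
  assumes "v \<noteq> 0"
  obtains g where "g \<in> SU3" "g *v axis 1 1 = (1 / norm v) *\<^sub>R v"
proof -
  obtain x y z t x' z' s R where h: "x + y + z = 0" "x' + z' = 0" "R \<ge> 0"
    "(rot12 s ** torus x' 0 z' ** rot23 t ** torus x y z) *v v = of_real R *\<^sub>C axis 1 1"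
    by (rule SU3_to_axis)
  define h where "h = rot12 s ** torus x' 0 z' ** rot23 t ** torus x y z"
  have hS: "h \<in> SU3"
    unfolding h_def using h(1,2) by (intro SU3_mult rot12_SU3 rot23_SU3 torus_SU3) auto
  have "dagger h *v (h *v v) = v"
    by (simp add: matrix_vector_mul_assoc SU3_inverse[OF hS])
  hence v: "v = R *\<^sub>R (dagger h *v axis 1 1)"
    using h(4) by (simp add: h_def[symmetric] scaleC_of_real matrix_vector_scaleR_right)
  have "cinner (dagger h *v axis 1 1) (dagger h *v axis 1 1) = cinner (axis 1 1 :: complex^3) (axis 1 1)"
    by (simp add: cinner_matrix_vector matrix_vector_mul_assoc SU3_inverse[OF hS])
  hence "(norm (dagger h *v axis 1 1))\<^sup>2 = 1"
    by (simp add: cinner_self flip: of_real_power)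
  hence "norm (dagger h *v axis 1 1) = 1"
    using power2_eq_iff_nonneg[of "norm (dagger h *v axis 1 1)" 1] by simp
  hence "norm v = R" using v h(3) by (metis norm_scaleR abs_of_nonneg mult.right_neutral)
  moreover from this assms have "R \<noteq> 0" by auto
  hence "(1 / R) *\<^sub>R v = dagger h *v axis 1 1" by (subst v) simp
  ultimately have "dagger h *v axis 1 1 = (1 / norm v) *\<^sub>R v" by simp
  thus ?thesis using that SU3_dagger[OF hS] by blast
qed

text \<open>A product h of generators takes the first column of g to a multiple of the first axis;
  then h ** g is in the isotropy group, where \<open>isotropy_decomp\<close> applies, and g = h^-1
  (h g).\<close>

lemma SU3_induct [consumes 1, case_names torus rot12 rot23 mult]:
  assumes g: "g \<in> SU3"
    and T: "\<And>x y z. x + y + z = 0 \<Longrightarrow> P (torus x y z)"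
    and R1: "\<And>t. P (rot12 t)" and R2: "\<And>t. P (rot23 t)"
    and M: "\<And>g h. g \<in> SU3 \<Longrightarrow> h \<in> SU3 \<Longrightarrow> P g \<Longrightarrow> P h \<Longrightarrow> P (g ** h)"
  shows "P g"
proof -
  obtain x y z t x' z' s R where h: "x + y + z = 0" "x' + z' = 0" "R \<ge> 0"
    "(rot12 s ** torus x' 0 z' ** rot23 t ** torus x y z) *v (g *v axis 1 1) = of_real R *\<^sub>C axis 1 1"
    by (rule SU3_to_axis)
  define h where "h = rot12 s ** torus x' 0 z' ** rot23 t ** torus x y z"
  have hS: "h \<in> SU3"
    unfolding h_def using h(1,2) by (intro SU3_mult rot12_SU3 rot23_SU3 torus_SU3) auto
  have "h ** g \<in> SU3" by (intro SU3_mult hS g)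
  moreover have "(h ** g) *v axis 1 1 = of_real R *\<^sub>C axis 1 1"
    using h(4) by (simp add: h_def[symmetric] matrix_vector_mul_assoc)
  hence "(h ** g) $ 2 $ 1 = 0" "(h ** g) $ 3 $ 1 = 0"
    by (simp_all add: vec_eq_iff forall_3 matrix_vector_mult_def sum_3 axis_def)
  ultimately obtain x1 y1 z1 t1 x2 y2 z2 where k: "x1 + y1 + z1 = 0" "x2 + y2 + z2 = 0"
    "h ** g = torus x1 y1 z1 ** rot23 t1 ** torus x2 y2 z2"
    using isotropy_decomp by metis
  have "g = dagger h ** (h ** g)"
    by (simp add: matrix_mul_assoc SU3_inverse[OF hS])
  also have "dagger h = torus (- x) (- y) (- z) ** (rot23 (- t) ** (torus (- x') 0 (- z') ** rot12 (- s)))"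
    by (simp add: h_def dagger_mult dagger_torus dagger_rot12 dagger_rot23)
  finally have "g = torus (- x) (- y) (- z) ** (rot23 (- t) ** (torus (- x') 0 (- z') ** rot12 (- s)))
      ** (torus x1 y1 z1 ** rot23 t1 ** torus x2 y2 z2)"
    by (simp only: k)
  moreover have "P \<dots>"
    using h(1,2) k(1,2)
    by (intro M T R1 R2 SU3_mult torus_SU3 rot12_SU3 rot23_SU3) auto
  ultimately show ?thesis by simp
qed

section \<open>The complexified action and weight vectors\<close>

text \<open>The part A in Z = A + \<i> B. The part B is the skew part of - \<i> Z, so this one map
  describes both summands of \<open>sl3_action\<close>.\<close>

definition skew_part :: "complex^3^3 \<Rightarrow> complex^3^3"
  where "skew_part Z = (1 / 2) *\<^sub>C (Z - dagger Z)"

lemma su3_skew_part: "trace Z = 0 \<Longrightarrow> skew_part Z \<in> su3"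
  by (simp add: skew_part_def su3_def dagger_scaleC dagger_diff trace_scaleC trace_sub trace_dagger
      complex_vector.scale_right_diff_distrib)

lemma skew_part_i: "(1 / (2 * \<i>)) *\<^sub>C (Z + dagger Z) = skew_part ((- \<i>) *\<^sub>C Z)"
  by (simp add: skew_part_def vec_eq_iff field_simps)

lemma skew_part_add: "skew_part (Z + Z') = skew_part Z + skew_part Z'"
  by (simp add: skew_part_def vec_eq_iff algebra_simps)

lemma skew_part_scaleR: "skew_part (r *\<^sub>R Z) = r *\<^sub>R skew_part Z"
  by (simp add: skew_part_def vec_eq_iff algebra_simps)

lemma skew_part_minus: "skew_part (- Z) = - skew_part Z"
  by (simp add: skew_part_def vec_eq_iff field_simps)

lemma skew_part_dagger: "skew_part (dagger Z) = - skew_part Z"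
  by (simp add: skew_part_def vec_eq_iff field_simps)

lemma skew_part_conj: "g ** skew_part Z ** dagger g = skew_part (g ** Z ** dagger g)"
  by (simp add: skew_part_def matrix_scaleC_left matrix_scaleC_right dagger_mult matrix_mul_assoc
      bounded_bilinear.diff_left[OF bounded_bilinear_matrix_mult]
      bounded_bilinear.diff_right[OF bounded_bilinear_matrix_mult])

lemma skew_part_su3: "X \<in> su3 \<Longrightarrow> skew_part X = X"
  by (simp add: skew_part_def su3_def vec_eq_iff)

lemma scaleC_split: "a *\<^sub>C Z = Re a *\<^sub>R Z + Im a *\<^sub>R (\<i> *\<^sub>C Z)" for Z :: "'a::complex_euclidean"
  by (simp add: scaleR_scaleC scaleC_of_real[symmetric] complex_eq[symmetric] mult.commute
      flip: scaleC_add_left)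

lemma trace_unit_matrix: "i \<noteq> j \<Longrightarrow> trace (unit_matrix i j) = 0"
  by (auto simp: trace_def unit_matrix_def intro!: sum.neutral)

lemma dagger_unit_matrix: "dagger (unit_matrix i j) = unit_matrix j i"
  by (auto simp: unit_matrix_def vec_eq_iff)

context urep
begin

lemma sl3_def: "sl3_action \<alpha> Z v = d (skew_part Z) v + \<i> *\<^sub>C d (skew_part ((- \<i>) *\<^sub>C Z)) v"
  unfolding sl3_action_def skew_part_i by (simp add: skew_part_def)

lemma trace_i: "trace (Z::complex^3^3) = 0 \<Longrightarrow> trace ((- \<i>) *\<^sub>C Z) = 0"
  by (simp add: trace_scaleC del: complex_vector.scale_minus_left)

lemma sl3_mem: "trace Z = 0 \<Longrightarrow> v \<in> V \<Longrightarrow> sl3_action \<alpha> Z v \<in> V"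
  unfolding sl3_def by (intro mem_add mem_scaleC d_mem su3_skew_part trace_i)

lemma sl3_add_right:
  "trace Z = 0 \<Longrightarrow> v \<in> V \<Longrightarrow> w \<in> V \<Longrightarrow> sl3_action \<alpha> Z (v + w) = sl3_action \<alpha> Z v + sl3_action \<alpha> Z w"
  unfolding sl3_def by (simp only: d_add_right su3_skew_part trace_i) (simp add: scaleC_add_right)

lemma sl3_scaleC_right:
  "trace Z = 0 \<Longrightarrow> v \<in> V \<Longrightarrow> sl3_action \<alpha> Z (a *\<^sub>C v) = a *\<^sub>C sl3_action \<alpha> Z v"
  unfolding sl3_def by (simp only: d_scaleC_right su3_skew_part trace_i)
    (simp add: scaleC_add_right scaleC_scaleC mult.commute)

text \<open>The derived action of su(3) is skew, and the complex extension turns this into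
  compatibility with adjoints. In particular the raising operators are adjoint to the lowering
  ones.\<close>

lemma sl3_adjoint:
  assumes Z: "trace Z = 0" and v: "v \<in> V" and w: "w \<in> V"
  shows "cinner w (sl3_action \<alpha> Z v) = cinner (sl3_action \<alpha> (dagger Z) w) v"
proof -
  have "skew_part ((- \<i>) *\<^sub>C dagger Z) = skew_part ((- \<i>) *\<^sub>C Z)"
    by (simp add: skew_part_def vec_eq_iff field_simps)
  moreover have "d (- skew_part Z) w = - d (skew_part Z) w"
    using d_scaleR_left[OF su3_skew_part[OF Z] w, of "-1"] by simp
  ultimately have "sl3_action \<alpha> (dagger Z) w = - d (skew_part Z) w + \<i> *\<^sub>C d (skew_part ((- \<i>) *\<^sub>C Z)) w"
    unfolding sl3_def skew_part_dagger by simp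
  thus ?thesis
    by (simp only: sl3_def cinner_add_left cinner_add_right cinner_minus_left cinner_scaleC_left
        cinner_scaleC_right d_skew[OF su3_skew_part[OF Z] w v]
        d_skew[OF su3_skew_part[OF trace_i[OF Z]] w v]) simp
qed

text \<open>Multiplication by a mixes the two skew parts of Z with real coefficients, so additivity
  of d in the Lie algebra argument is needed, and with it the Lie product formula.\<close>

lemma sl3_scaleC_left:
  assumes Z: "trace Z = 0" and v: "v \<in> V"
  shows "sl3_action \<alpha> (a *\<^sub>C Z) v = a *\<^sub>C sl3_action \<alpha> Z v"
proof -
  let ?A = "d (skew_part Z) v" and ?B = "d (skew_part ((- \<i>) *\<^sub>C Z)) v"
  note s = su3_skew_part[OF Z] su3_skew_part[OF trace_i[OF Z]]
  have "skew_part (a *\<^sub>C Z) = Re a *\<^sub>R skew_part Z + (- Im a) *\<^sub>R skew_part ((- \<i>) *\<^sub>C Z)"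
    by (subst scaleC_split) (simp add: skew_part_add skew_part_scaleR skew_part_minus)
  hence 1: "d (skew_part (a *\<^sub>C Z)) v = Re a *\<^sub>R ?A + (- Im a) *\<^sub>R ?B"
    by (simp only: d_add_left d_scaleR_left su3_scaleR s v)
  have "(- \<i>) *\<^sub>C (a *\<^sub>C Z) = Re a *\<^sub>R ((- \<i>) *\<^sub>C Z) + Im a *\<^sub>R Z"
    by (simp add: vec_eq_iff scaleC_complex scaleR_conv_of_real[where 'a = complex] complex_eq_iff)
  hence "skew_part ((- \<i>) *\<^sub>C (a *\<^sub>C Z)) = Re a *\<^sub>R skew_part ((- \<i>) *\<^sub>C Z) + Im a *\<^sub>R skew_part Z"
    by (simp only: skew_part_add skew_part_scaleR)
  hence 2: "d (skew_part ((- \<i>) *\<^sub>C (a *\<^sub>C Z))) v = Re a *\<^sub>R ?B + Im a *\<^sub>R ?A"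
    by (simp only: d_add_left d_scaleR_left su3_scaleR s v)
  have "a *\<^sub>C (?A + \<i> *\<^sub>C ?B) = (of_real (Re a) *\<^sub>C ?A + (\<i> * of_real (Im a)) *\<^sub>C ?A)
      + ((\<i> * of_real (Re a)) *\<^sub>C ?B + (- of_real (Im a)) *\<^sub>C ?B)"
    unfolding scaleC_add_right scaleC_scaleC scaleC_add_left[symmetric]
    by (intro arg_cong2[where f = "(+)"] arg_cong2[where f = scaleC]) (auto simp: complex_eq_iff)
  thus ?thesis
    unfolding sl3_def 1 2 by (simp add: scaleC_add_right scaleC_scaleR scaleC_of_real[symmetric])
qed

lemma sl3_conj:
  assumes Z: "trace Z = 0" and v: "v \<in> V" and g: "g \<in> SU3"
  shows "\<alpha> g (sl3_action \<alpha> Z v) = sl3_action \<alpha> (g ** Z ** dagger g) (\<alpha> g v)"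
proof -
  note s = su3_skew_part[OF Z] su3_skew_part[OF trace_i[OF Z]]
  have "(- \<i>) *\<^sub>C (g ** Z ** dagger g) = g ** ((- \<i>) *\<^sub>C Z) ** dagger g"
    by (simp only: matrix_scaleC_left matrix_scaleC_right)
  thus ?thesis
    unfolding sl3_def
    by (simp only: add scaleC g d_mem s v mem_scaleC d_conj[symmetric] skew_part_conj)
qed

lemma sl3_su3: assumes X: "X \<in> su3" and v: "v \<in> V" shows "sl3_action \<alpha> X v = d X v"
proof -
  have "skew_part ((- \<i>) *\<^sub>C X) = 0"
    using X by (simp add: skew_part_def su3_def dagger_scaleC dagger_minus vec_eq_iff)
  thus ?thesis using d_zero_left[OF v] by (simp add: sl3_def skew_part_su3[OF X] del: complex_vector.scale_minus_left)
qed

text \<open>Expresses the generators of \<open>rot12\<close> and \<open>rot23\<close> through the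
  ladder operators, the only operators that a GT basis controls.\<close>

lemma skew_eq_lowering_minus_raising:
  assumes "i \<noteq> j" "v \<in> V"
  shows "d (unit_matrix i j - unit_matrix j i) v
    = sl3_action \<alpha> (unit_matrix i j) v - sl3_action \<alpha> (unit_matrix j i) v"
proof -
  let ?Z = "unit_matrix i j" and ?Y = "unit_matrix j i"
  have Z: "trace ?Z = 0" "trace ?Y = 0" using assms trace_unit_matrix by auto
  have e: "skew_part ((- \<i>) *\<^sub>C ?Y) = skew_part ((- \<i>) *\<^sub>C ?Z)" "skew_part ?Y = - skew_part ?Z"
    unfolding dagger_unit_matrix[of i j, symmetric]
    by (simp_all add: skew_part_def vec_eq_iff field_simps)
  have "d (- skew_part ?Z) v = - d (skew_part ?Z) v"
    using d_scaleR_left[OF su3_skew_part[OF Z(1)] assms(2), of "-1"] by simp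
  hence "sl3_action \<alpha> ?Z v - sl3_action \<alpha> ?Y v = 2 *\<^sub>R d (skew_part ?Z) v"
    unfolding sl3_def e by (simp add: scaleR_2)
  also have "\<dots> = d (2 *\<^sub>R skew_part ?Z) v"
    by (rule d_scaleR_left[OF su3_skew_part[OF Z(1)] assms(2), symmetric])
  also have "2 *\<^sub>R skew_part ?Z = ?Z - ?Y"
    unfolding dagger_unit_matrix[of i j, symmetric] by (simp add: skew_part_def vec_eq_iff scaleR_conv_of_real[where 'a = complex])
  finally show ?thesis by simp
qed

text \<open>Weights are characters of the torus, stated on the group. Because x + y + z = 0, the
  triple (a,b,c) matters only modulo (1,1,1), so GT labels can serve as weights as they
  stand.\<close>

definition weight_vector :: "int \<Rightarrow> int \<Rightarrow> int \<Rightarrow> 'v \<Rightarrow> bool"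
  where "weight_vector a b c v \<longleftrightarrow> (\<forall>x y z. x + y + z = 0 \<longrightarrow>
    \<alpha> (torus x y z) v = cis (of_int a * x + of_int b * y + of_int c * z) *\<^sub>C v)"

lemma weight_vectorD:
  "weight_vector a b c v \<Longrightarrow> x + y + z = 0 \<Longrightarrow>
    \<alpha> (torus x y z) v = cis (of_int a * x + of_int b * y + of_int c * z) *\<^sub>C v"
  by (simp add: weight_vector_def)

lemma weight_vector_scaleC: "v \<in> V \<Longrightarrow> weight_vector a b c v \<Longrightarrow> weight_vector a b c (k *\<^sub>C v)"
  by (simp add: weight_vector_def scaleC torus_SU3 scaleC_scaleC mult.commute)

lemma weight_vector_scaleR: "v \<in> V \<Longrightarrow> weight_vector a b c v \<Longrightarrow> weight_vector a b c (k *\<^sub>R v)"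
  using weight_vector_scaleC[of v a b c "of_real k"] by (simp add: scaleC_of_real)

lemma weight_vector_diff:
  "v \<in> V \<Longrightarrow> w \<in> V \<Longrightarrow> weight_vector a b c v \<Longrightarrow> weight_vector a b c w \<Longrightarrow> weight_vector a b c (v - w)"
  by (simp add: weight_vector_def diff torus_SU3 scaleC_diff_right)

lemma torus_conj_unit_matrix:
  "torus x y z ** unit_matrix 3 2 ** dagger (torus x y z) = cis (z - y) *\<^sub>C unit_matrix 3 2"
  "torus x y z ** unit_matrix 2 1 ** dagger (torus x y z) = cis (y - x) *\<^sub>C unit_matrix 2 1"
  unfolding dagger_torus by (simp_all add: torus_def diag3_def mat3_simps cis_mult)

text \<open>Conjugation by the torus multiplies E_32 and E_21 by a phase, which is exactly the shift
  of the weight.\<close>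

lemma weight_vector_lower:
  assumes v: "v \<in> V" and w: "weight_vector a b c v"
  shows "weight_vector a (b - 1) (c + 1) (U_minus \<alpha> v)"
    and "weight_vector (a - 1) (b + 1) c (T_minus \<alpha> v)"
  unfolding weight_vector_def
proof (safe)
  fix x y z :: real assume xyz: "x + y + z = 0"
  show "\<alpha> (torus x y z) (U_minus \<alpha> v)
      = cis (of_int a * x + of_int (b - 1) * y + of_int (c + 1) * z) *\<^sub>C U_minus \<alpha> v"
    unfolding U_minus_def using trace_unit_matrix[of 3 2]
    by (simp add: sl3_conj v torus_SU3[OF xyz] torus_conj_unit_matrix sl3_scaleC_left mem mem_scaleC
        weight_vectorD[OF w xyz] sl3_scaleC_right cis_mult algebra_simps)
  show "\<alpha> (torus x y z) (T_minus \<alpha> v)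
      = cis (of_int (a - 1) * x + of_int (b + 1) * y + of_int c * z) *\<^sub>C T_minus \<alpha> v"
    unfolding T_minus_def using trace_unit_matrix[of 2 1]
    by (simp add: sl3_conj v torus_SU3[OF xyz] torus_conj_unit_matrix sl3_scaleC_left mem mem_scaleC
        weight_vectorD[OF w xyz] sl3_scaleC_right cis_mult algebra_simps)
qed

lemma weight_vector_torus_gen:
  assumes v: "v \<in> V" and w: "weight_vector a b c v" and xyz: "x + y + z = 0"
  shows "d (torus_gen x y z) v = (\<i> * of_real (of_int a * x + of_int b * y + of_int c * z)) *\<^sub>C v"
proof (rule dI)
  let ?l = "of_int a * x + of_int b * y + of_int c * z"
  have "flow (torus_gen x y z) t v = cis (t * ?l) *\<^sub>C v" for t
  proof -
    have "t * x + t * y + t * z = 0" using xyz by (simp flip: distrib_left)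
    from weight_vectorD[OF w this] show ?thesis by (simp add: mexp_torus_gen algebra_simps)
  qed
  moreover have "((\<lambda>t. cis (t * ?l) *\<^sub>C v) has_vector_derivative
      (\<i> * of_real ?l * cis (0 * ?l)) *\<^sub>C v) (at 0)"
    by (intro bounded_linear.has_vector_derivative[OF
          bounded_bilinear.bounded_linear_left[OF bounded_bilinear_scaleC]] cis_has_vector_derivative)
  ultimately show "((\<lambda>t. flow (torus_gen x y z) t v) has_vector_derivative (\<i> * of_real ?l) *\<^sub>C v) (at 0)"
    by simp
qed

lemma weight_vectorI:
  assumes v: "v \<in> V"
    and "\<And>x y z. x + y + z = 0 \<Longrightarrow>
      d (torus_gen x y z) v = (\<i> * of_real (of_int a * x + of_int b * y + of_int c * z)) *\<^sub>C v"
  shows "weight_vector a b c v"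
  unfolding weight_vector_def
proof safe
  fix x y z :: real assume xyz: "x + y + z = 0"
  show "\<alpha> (torus x y z) v = cis (of_int a * x + of_int b * y + of_int c * z) *\<^sub>C v"
    using flow_eigenvector[OF torus_gen_su3[OF xyz] v assms(2)[OF xyz], of 1] mexp_torus_gen[of 1 x y z]
    by simp
qed

lemma weight_vector_orthogonal:
  assumes v: "v \<in> V" "w \<in> V" and w: "weight_vector a b c v" "weight_vector a' b' c' w"
    and ne: "a - b \<noteq> a' - b' \<or> b - c \<noteq> b' - c'"
  shows "cinner v w = 0"
proof -
  have e: "(of_int a * x + of_int b * y + of_int c * z)
      = (of_int a' * x + of_int b' * y + of_int c' * (z::real)) \<or> cinner v w = 0"
    if xyz: "x + y + z = 0" for x y z
  proof -
    define s where "s = of_int a * x + of_int b * y + of_int c * z"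
    define s' where "s' = of_int a' * x + of_int b' * y + of_int c' * z"
    have "d (torus_gen x y z) v = (\<i> * of_real s) *\<^sub>C v" "d (torus_gen x y z) w = (\<i> * of_real s') *\<^sub>C w"
      unfolding s_def s'_def using weight_vector_torus_gen v w xyz by blast+
    moreover have "cinner (d (torus_gen x y z) v) w = - cinner v (d (torus_gen x y z) w)"
      by (rule d_skew[OF torus_gen_su3[OF xyz] v])
    ultimately have "of_real s * cinner v w = of_real s' * cinner v w"
      by (simp add: cinner_scaleC_left cinner_scaleC_right)
    thus ?thesis unfolding s_def[symmetric] s'_def[symmetric] by auto
  qed
  \<comment> \<open>These two directions read off a - b and b - c.\<close>
  from e[of 1 "-1" 0] e[of 0 1 "-1"] ne show ?thesis by (auto simp flip: of_int_diff)
qed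

text \<open>The directions of \<open>T_three\<close> and \<open>U_three\<close> span the diagonal
  part of su(3), so their eigenvalues determine the weight by linearity; it is normalized here to
  have third entry 0.\<close>

lemma highest_weight_vector_weight:
  assumes v: "v \<in> V" and hw: "highest_weight_vector \<alpha> (p, q) v"
  shows "weight_vector (int p + int q) (int q) 0 v"
proof (rule weight_vectorI[OF v])
  fix x y z :: real assume xyz: "x + y + z = 0"
  let ?T = "unit_matrix 1 1 - unit_matrix 2 2" and ?U = "unit_matrix 2 2 - unit_matrix 3 3"
  have tr: "trace ?T = 0" "trace ?U = 0" by (simp_all add: trace_def sum_3 unit_matrix_def)
  have i: "\<i> *\<^sub>C ?T = torus_gen 1 (-1) 0" "\<i> *\<^sub>C ?U = torus_gen 0 1 (-1)"
    by (simp_all add: mat3_simps torus_gen_def diag3_def)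
  have gT: "torus_gen 1 (-1) 0 \<in> su3" "torus_gen 0 1 (-1) \<in> su3" by (simp_all add: torus_gen_su3)
  have T: "d (torus_gen 1 (-1) 0) v = (\<i> * of_nat p) *\<^sub>C v"
  proof -
    have "sl3_action \<alpha> ((1 / 2) *\<^sub>C ?T) v = (of_nat p / 2) *\<^sub>C v"
      using hw by (simp add: highest_weight_vector_def T_three_def flip: scaleC_of_real)
    hence "(1 / 2) *\<^sub>C sl3_action \<alpha> ?T v = (of_nat p / 2) *\<^sub>C v" by (simp add: sl3_scaleC_left tr v)
    hence "(2 * \<i>) *\<^sub>C (1 / 2) *\<^sub>C sl3_action \<alpha> ?T v = (2 * \<i>) *\<^sub>C (of_nat p / 2) *\<^sub>C v" by simp
    thus ?thesis using sl3_scaleC_left[OF tr(1) v, of \<i>] sl3_su3[OF gT(1) v]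
      by (simp add: scaleC_scaleC i)
  qed
  have U: "d (torus_gen 0 1 (-1)) v = (\<i> * of_nat q) *\<^sub>C v"
  proof -
    have "sl3_action \<alpha> ((1 / 2) *\<^sub>C ?U) v = (of_nat q / 2) *\<^sub>C v"
      using hw by (simp add: highest_weight_vector_def U_three_def flip: scaleC_of_real)
    hence "(1 / 2) *\<^sub>C sl3_action \<alpha> ?U v = (of_nat q / 2) *\<^sub>C v" by (simp add: sl3_scaleC_left tr v)
    hence "(2 * \<i>) *\<^sub>C (1 / 2) *\<^sub>C sl3_action \<alpha> ?U v = (2 * \<i>) *\<^sub>C (of_nat q / 2) *\<^sub>C v" by simp
    thus ?thesis using sl3_scaleC_left[OF tr(2) v, of \<i>] sl3_su3[OF gT(2) v]
      by (simp add: scaleC_scaleC i)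
  qed
  have "torus_gen x y z = x *\<^sub>R torus_gen 1 (-1) 0 + (x + y) *\<^sub>R torus_gen 0 1 (-1)"
  proof -
    have z: "z = - (x + y)" using xyz by simp
    show ?thesis unfolding z
      by (simp add: torus_gen_def diag3_def vec_eq_iff forall_3 scaleR_conv_of_real[where 'a = complex] algebra_simps)
  qed
  hence "d (torus_gen x y z) v = x *\<^sub>R (\<i> * of_nat p) *\<^sub>C v + (x + y) *\<^sub>R (\<i> * of_nat q) *\<^sub>C v"
    by (simp add: d_add_left d_scaleR_left su3_scaleR gT v T U)
  also have "\<dots> = (\<i> * of_real (of_int (int p + int q) * x + of_int (int q) * y + of_int 0 * z)) *\<^sub>C v"
    by (simp add: scaleR_scaleC algebra_simps flip: scaleC_add_left)
  finally show "d (torus_gen x y z) v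
    = (\<i> * of_real (of_int (int p + int q) * x + of_int (int q) * y + of_int 0 * z)) *\<^sub>C v" .
qed

end

section \<open>Gelfand-Tsetlin bases\<close>

lemma finite_gt_labels: "finite (gt_labels P)"
proof -
  obtain p q where P: "P = (p, q)" by force
  let ?I = "{0..int p + int q}"
  have "gt_labels P \<subseteq> (\<lambda>(r, s, k). ((int p + 2 * int q - (r + s), r + s - k, k), real_of_int (r - s) / 2))
      ` (?I \<times> ?I \<times> ?I)"
  proof
    fix x assume "x \<in> gt_labels P"
    then obtain r s k where
      "x = ((int p + 2 * int q - (r + s), r + s - k, k), real_of_int (r - s) / 2)"
      "(r, s, k) \<in> ?I \<times> ?I \<times> ?I"
      unfolding P gt_labels_def by auto
    thus "x \<in> (\<lambda>(r, s, k). ((int p + 2 * int q - (r + s), r + s - k, k), real_of_int (r - s) / 2))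
      ` (?I \<times> ?I \<times> ?I)" by (intro image_eqI[of _ _ "(r, s, k)"]) auto
  qed
  thus ?thesis by (rule finite_subset) auto
qed

lemma (in urep) raising_adjoint:
  assumes "v \<in> V" "w \<in> V"
  shows "cinner w (U_plus \<alpha> v) = cinner (U_minus \<alpha> w) v"
    and "cinner w (T_plus \<alpha> v) = cinner (T_minus \<alpha> w) v"
    and "cinner w (U_minus \<alpha> v) = cinner (U_plus \<alpha> w) v"
  unfolding U_plus_def U_minus_def T_plus_def T_minus_def
  by (subst sl3_adjoint[OF trace_unit_matrix assms]; simp add: dagger_unit_matrix)+

locale gt = urep +
  fixes p q :: nat and e :: "weight \<Rightarrow> real \<Rightarrow> 'a"
  assumes gt: "gt_basis \<alpha> V (p, q) e"
begin

text \<open>Labels are parametrized by \<open>r = r\<^sub>+\<close>, \<open>s = r\<^sub>-\<close> and \<open>k = \<nu>\<^sub>3\<close>: in these coordinates the coefficients of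
  \<open>U_minus\<close> and \<open>T_minus\<close> factor into integers, and \<open>T_minus\<close> raises \<open>s\<close> or \<open>r\<close> by one.\<close>

definition lab :: "int \<Rightarrow> int \<Rightarrow> int \<Rightarrow> bool"
  where "lab r s k \<longleftrightarrow> 0 \<le> s \<and> s \<le> int q \<and> int q \<le> r \<and> r \<le> int p + int q \<and> s \<le> k \<and> k \<le> r"

definition b :: "int \<Rightarrow> int \<Rightarrow> int \<Rightarrow> 'a"
  where "b r s k = e (int p + 2 * int q - (r + s), r + s - k, k) (real_of_int (r - s) / 2)"

lemma gt_labels_iff:
  "(\<nu>, J) \<in> gt_labels (p, q) \<longleftrightarrow> (\<exists>r s k. lab r s k \<and>
    \<nu> = (int p + 2 * int q - (r + s), r + s - k, k) \<and> J = real_of_int (r - s) / 2)"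
  unfolding gt_labels_def lab_def by fastforce

lemma lab_gt: "lab r s k \<Longrightarrow>
    ((int p + 2 * int q - (r + s), r + s - k, k), real_of_int (r - s) / 2) \<in> gt_labels (p, q)"
  unfolding gt_labels_iff by blast

lemma basis_cases:
  assumes "(\<nu>, J) \<in> gt_labels (p, q)"
  obtains r s k where "lab r s k" "e \<nu> J = b r s k"
    "\<nu> = (int p + 2 * int q - (r + s), r + s - k, k)" "J = real_of_int (r - s) / 2"
  using assms unfolding gt_labels_iff b_def by blast

lemma orthonormal:
  "(\<nu>, J) \<in> gt_labels (p, q) \<Longrightarrow> (\<mu>, L) \<in> gt_labels (p, q) \<Longrightarrow>
    cinner (e \<nu> J) (e \<mu> L) = (if (\<nu>, J) = (\<mu>, L) then 1 else 0)"
  using gt unfolding gt_basis_def Let_def by fastforce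

lemma b_orthonormal:
  assumes "lab r s k" "lab r' s' k'"
  shows "cinner (b r s k) (b r' s' k') = (if r = r' \<and> s = s' \<and> k = k' then 1 else 0)"
proof -
  have "r - s = r' - s'" if "real_of_int (r - s) / 2 = real_of_int (r' - s') / 2"
    using that by (simp flip: of_int_diff)
  thus ?thesis unfolding b_def orthonormal[OF lab_gt[OF assms(1)] lab_gt[OF assms(2)]]
    by auto
qed

lemma span: "complex_vector.span {e \<nu> J | \<nu> J. (\<nu>, J) \<in> gt_labels (p, q)} = V"
  using gt unfolding gt_basis_def Let_def by simp

lemma span': "complex_vector.span ((\<lambda>(\<nu>, J). e \<nu> J) ` gt_labels (p, q)) = V"
proof -
  have "(\<lambda>(\<nu>, J). e \<nu> J) ` gt_labels (p, q) = {e \<nu> J | \<nu> J. (\<nu>, J) \<in> gt_labels (p, q)}" by force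
  thus ?thesis using span by simp
qed

lemma span_b: "complex_vector.span {b r s k | r s k. lab r s k} = V"
proof -
  have "{b r s k | r s k. lab r s k} = {e \<nu> J | \<nu> J. (\<nu>, J) \<in> gt_labels (p, q)}"
  proof (intro subset_antisym subsetI)
    fix x assume "x \<in> {b r s k | r s k. lab r s k}"
    thus "x \<in> {e \<nu> J | \<nu> J. (\<nu>, J) \<in> gt_labels (p, q)}"
      unfolding b_def using lab_gt by blast
  next
    fix x assume "x \<in> {e \<nu> J | \<nu> J. (\<nu>, J) \<in> gt_labels (p, q)}"
    then obtain \<nu> J where x: "x = e \<nu> J" "(\<nu>, J) \<in> gt_labels (p, q)" by blast
    from x(2) show "x \<in> {b r s k | r s k. lab r s k}"
      unfolding x(1) by (rule basis_cases) blast
  qed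
  thus ?thesis using span by simp
qed

lemma e_mem: "(\<nu>, J) \<in> gt_labels (p, q) \<Longrightarrow> e \<nu> J \<in> V"
  unfolding span[symmetric] by (intro complex_vector.span_base) blast

lemma b_mem: "lab r s k \<Longrightarrow> b r s k \<in> V"
  unfolding b_def by (intro e_mem lab_gt)

lemma expand:
  assumes "v \<in> V"
  shows "v = (\<Sum>i\<in>gt_labels (p, q). cinner (case i of (\<nu>, J) \<Rightarrow> e \<nu> J) v *\<^sub>C (case i of (\<nu>, J) \<Rightarrow> e \<nu> J))"
  by (rule orthonormal_expand[OF finite_gt_labels span' assms]) (auto simp: orthonormal split: if_splits)

lemma basis_eqI:
  assumes "v \<in> V" "w \<in> V" "\<And>r s k. lab r s k \<Longrightarrow> cinner (b r s k) v = cinner (b r s k) w"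
  shows "v = w"
  by (rule cinner_eqI[OF span_b assms(1,2)]) (use assms(3) in blast)

abbreviation "cU r s k \<equiv> sqrt (real_of_int ((r - k) * (k - s + 1)))"

abbreviation "cS r s k \<equiv> sqrt (real_of_int ((k - s) * (int p + int q + 1 - s) * (int q - s) * (s + 1))
  / real_of_int ((r - s) * (r - s + 1)))"

abbreviation "cR r s k \<equiv> sqrt (real_of_int ((r - k + 1) * (int p + int q - r) * (r + 1 - int q) * (r + 2))
  / real_of_int ((r - s + 2) * (r - s + 1)))"

lemma lowering:
  assumes "lab r s k"
  shows "U_minus \<alpha> (b r s k) = cU r s k *\<^sub>R b r s (k + 1)"
    and "T_minus \<alpha> (b r s k) =
      cS r s k *\<^sub>R b r (s + 1) k
      + cR r s k *\<^sub>R b (r + 1) s k"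
proof -
  let ?n1 = "int p + 2 * int q - (r + s)" and ?n2 = "r + s - k" and ?J = "real_of_int (r - s) / 2"
  let ?u = "real_of_int (?n2 - k) / 2"
  have *: "let u = ?u; n = real_of_int k in
         U_minus \<alpha> (e (?n1, ?n2, k) ?J) =
           sqrt ((?J + u) * (?J - u + 1)) *\<^sub>R e (?n1, ?n2 - 1, k + 1) ?J
         \<and> T_minus \<alpha> (e (?n1, ?n2, k) ?J) =
           sqrt ((?J - u) * (p + q + ?J - u - n + 1) * (q + ?J - u - n) * (u - ?J + n + 1)
                 / (2 * ?J * (2 * ?J + 1))) *\<^sub>R e (?n1 - 1, ?n2 + 1, k) (?J - 1 / 2)
           + sqrt ((?J + u + 1) * (p + q - ?J - u - n) * (?J + u + 1 + n - q) * (?J + u + 2 + n)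
                 / (2 * (?J + 1) * (2 * ?J + 1))) *\<^sub>R e (?n1 - 1, ?n2 + 1, k) (?J + 1 / 2)"
    using gt lab_gt[OF assms] unfolding gt_basis_def Let_def by simp
  have u: "?J + ?u = real_of_int (r - k)" "?J - ?u = real_of_int (k - s)" "?u - ?J = real_of_int (s - k)"
    by (simp_all add: field_simps)
  have l: "e (?n1, ?n2 - 1, k + 1) ?J = b r s (k + 1)"
    "e (?n1 - 1, ?n2 + 1, k) (?J - 1 / 2) = b r (s + 1) k"
    "e (?n1 - 1, ?n2 + 1, k) (?J + 1 / 2) = b (r + 1) s k"
    unfolding b_def by (rule arg_cong2[where f = e]; simp add: field_simps)+
  have 1: "(?J + ?u) * (?J - ?u + 1) = real_of_int ((r - k) * (k - s + 1))"
    unfolding u by simp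
  show "U_minus \<alpha> (b r s k) = cU r s k *\<^sub>R b r s (k + 1)"
    using * unfolding Let_def l 1 by (simp add: b_def)
  have 2: "(?J - ?u) * (p + q + ?J - ?u - real_of_int k + 1) * (q + ?J - ?u - real_of_int k)
        * (?u - ?J + real_of_int k + 1)
      = real_of_int ((k - s) * (int p + int q + 1 - s) * (int q - s) * (s + 1))"
  proof -
    have *: "p + q + ?J - ?u - real_of_int k + 1 = real_of_int (int p + int q + 1 - s)"
      "q + ?J - ?u - real_of_int k = real_of_int (int q - s)"
      "?u - ?J + real_of_int k + 1 = real_of_int (s + 1)"
      by (simp_all add: field_simps)
    show ?thesis unfolding * u by simp
  qed
  have J: "2 * ?J = real_of_int (r - s)" "2 * (?J + 1) = real_of_int (r - s + 2)" by simp_all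
  have 3: "2 * ?J * (2 * ?J + 1) = real_of_int ((r - s) * (r - s + 1))" unfolding J by simp
  have 4: "(?J + ?u + 1) * (p + q - ?J - ?u - real_of_int k) * (?J + ?u + 1 + real_of_int k - q)
        * (?J + ?u + 2 + real_of_int k)
      = real_of_int ((r - k + 1) * (int p + int q - r) * (r + 1 - int q) * (r + 2))"
  proof -
    have *: "?J + ?u + 1 = real_of_int (r - k + 1)"
      "p + q - ?J - ?u - real_of_int k = real_of_int (int p + int q - r)"
      "?J + ?u + 1 + real_of_int k - q = real_of_int (r + 1 - int q)"
      "?J + ?u + 2 + real_of_int k = real_of_int (r + 2)"
      by (simp_all add: field_simps)
    show ?thesis unfolding * by simp
  qed
  have 5: "2 * (?J + 1) * (2 * ?J + 1) = real_of_int ((r - s + 2) * (r - s + 1))"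
    unfolding J by simp
  show "T_minus \<alpha> (b r s k) =
      cS r s k *\<^sub>R b r (s + 1) k
      + cR r s k *\<^sub>R b (r + 1) s k"
    using * unfolding Let_def l 2 3 4 5 by (simp add: b_def)
qed

lemma U_minus_mem: "v \<in> V \<Longrightarrow> U_minus \<alpha> v \<in> V"
  unfolding U_minus_def by (intro sl3_mem trace_unit_matrix) auto

lemma T_minus_mem: "v \<in> V \<Longrightarrow> T_minus \<alpha> v \<in> V"
  unfolding T_minus_def by (intro sl3_mem trace_unit_matrix) auto

lemma U_plus_mem: "v \<in> V \<Longrightarrow> U_plus \<alpha> v \<in> V"
  unfolding U_plus_def by (intro sl3_mem trace_unit_matrix) auto

lemma T_plus_mem: "v \<in> V \<Longrightarrow> T_plus \<alpha> v \<in> V"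
  unfolding T_plus_def by (intro sl3_mem trace_unit_matrix) auto

text \<open>A GT basis fixes the lowering operators; the raising one is obtained as the adjoint
  matrix.\<close>

lemma U_plus_b:
  assumes l: "lab r s k"
  shows "U_plus \<alpha> (b r s k) = sqrt (real_of_int ((r - k + 1) * (k - s))) *\<^sub>R b r s (k - 1)"
proof (rule basis_eqI)
  \<comment> \<open>For k = s the vector \<open>b r s (k - 1)\<close> carries no label and may be
    anything, but its coefficient is 0. The case k' = r' below is of the same kind.\<close>
  have l1: "k \<noteq> s \<Longrightarrow> lab r s (k - 1)" using l by (auto simp: lab_def)
  show "sqrt (real_of_int ((r - k + 1) * (k - s))) *\<^sub>R b r s (k - 1) \<in> V"
    using b_mem[OF l1] mem_zero by (cases "k = s") (auto intro: mem_scaleR)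
  fix r' s' k' assume l': "lab r' s' k'"
  have e: "cinner (b r' s' k') (U_plus \<alpha> (b r s k))
      = of_real (sqrt (real_of_int ((r' - k') * (k' - s' + 1)))) * cinner (b r' s' (k' + 1)) (b r s k)"
    by (simp add: raising_adjoint b_mem l l' lowering(1) cinner_scaleR_left)
  show "cinner (b r' s' k') (U_plus \<alpha> (b r s k))
      = cinner (b r' s' k') (sqrt (real_of_int ((r - k + 1) * (k - s))) *\<^sub>R b r s (k - 1))"
  proof (cases "k' = r'")
    case True
    have "cinner (b r' s' k') (b r s (k - 1)) = 0" if "k \<noteq> s"
      using l True by (subst b_orthonormal[OF l' l1[OF that]]) (auto simp: lab_def)
    thus ?thesis unfolding e cinner_scaleR_right using True by (cases "k = s") auto
  next
    case False
    hence l1': "lab r' s' (k' + 1)" using l' by (auto simp: lab_def)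
    show ?thesis
    proof (cases "k = s")
      case True
      thus ?thesis unfolding e cinner_scaleR_right b_orthonormal[OF l1' l] using l' by (auto simp: lab_def)
    next
      case False
      thus ?thesis unfolding e cinner_scaleR_right b_orthonormal[OF l1' l] b_orthonormal[OF l' l1[OF False]]
        by auto
    qed
  qed
qed (intro U_plus_mem b_mem l)

lemma coeff_pos:
  assumes l: "lab r s k"
  shows "k < r \<Longrightarrow> cU r s k \<noteq> 0"
    and "r < int p + int q \<Longrightarrow> cR r s k \<noteq> 0"
    and "s < k \<Longrightarrow> s < int q \<Longrightarrow> cS r s k \<noteq> 0"
  using l unfolding lab_def by (auto simp del: of_int_mult of_int_diff of_int_add)

lemma T_minus_bottom:
  assumes "lab r s s"
  shows "T_minus \<alpha> (b r s s) =
      cR r s s *\<^sub>R b (r + 1) s s"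
  using lowering(2)[OF assms] by simp

text \<open>All basis vectors except the highest weight vector arise by lowering: for s < k from
  \<open>U_minus\<close>; for s = k and r > q from \<open>T_minus\<close>, whose first term vanishes
  at the bottom of a string; for s = k > 0 and r = q from \<open>T_minus\<close> at (q, s-1, s),
  whose other term is of the first kind.\<close>

lemma lowering_range:
  assumes Q: "complex_vector.subspace Q" and QU: "\<And>v. v \<in> V \<Longrightarrow> U_minus \<alpha> v \<in> Q"
    and QT: "\<And>v. v \<in> V \<Longrightarrow> T_minus \<alpha> v \<in> Q"
    and l: "lab r s k" and nhw: "\<not> (r = int q \<and> s = 0 \<and> k = 0)"
  shows "b r s k \<in> Q"
proof -
  have sub: "subspace Q" by (rule complex_subspace_imp_subspace[OF Q])
  have sc: "v \<in> Q" if "c *\<^sub>R v \<in> Q" "c \<noteq> 0" for c v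
    using subspace_scale[OF sub that(1), of "1 / c"] that(2) by simp
  have up: "b r s k \<in> Q" if l: "lab r s k" and "s < k" for r s k
  proof -
    have l': "lab r s (k - 1)" using that by (auto simp: lab_def)
    have "cU r s (k - 1) *\<^sub>R b r s (k - 1 + 1) \<in> Q"
      using QU[OF b_mem[OF l']] unfolding lowering(1)[OF l'] .
    moreover have "k - 1 < r" using l by (auto simp: lab_def)
    ultimately show ?thesis using sc coeff_pos(1)[OF l'] by fastforce
  qed
  have "s < k \<or> (s = k \<and> int q < r) \<or> (s = k \<and> r = int q \<and> 0 < s)"
    using l nhw unfolding lab_def by arith
  then consider "s < k" | "s = k" "int q < r" | "s = k" "r = int q" "0 < s" by blast
  thus ?thesis
  proof cases
    case 1 thus ?thesis by (rule up[OF l])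
  next
    case 2
    have l': "lab (r - 1) s s" using l 2 by (auto simp: lab_def)
    have "r - 1 < int p + int q" using l by (auto simp: lab_def)
    from sc[OF QT[OF b_mem[OF l'], unfolded T_minus_bottom[OF l']] coeff_pos(2)[OF l' this]]
    show ?thesis using 2 by simp
  next
    case 3
    have l': "lab r (s - 1) s" and lt: "s - 1 < s" "s - 1 < int q" using l 3 by (auto simp: lab_def)
    have T: "T_minus \<alpha> (b r (s - 1) s) = cS r (s - 1) s *\<^sub>R b r (s - 1 + 1) s
        + cR r (s - 1) s *\<^sub>R b (r + 1) (s - 1) s"
      by (rule lowering(2)[OF l'])
    have "cR r (s - 1) s *\<^sub>R b (r + 1) (s - 1) s \<in> Q"
    proof (cases "r = int p + int q")
      case True thus ?thesis by (simp add: subspace_0[OF sub])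
    next
      case False
      hence "lab (r + 1) (s - 1) s" using l' by (auto simp: lab_def)
      thus ?thesis by (intro subspace_scale[OF sub] up) auto
    qed
    hence "cS r (s - 1) s *\<^sub>R b r (s - 1 + 1) s \<in> Q"
      using QT[OF b_mem[OF l']] subspace_diff[OF sub] unfolding T by fastforce
    from sc[OF this coeff_pos(3)[OF l' lt]] show ?thesis using 3 by simp
  qed
qed

lemma highest_weight: "highest_weight_vector \<alpha> (p, q) (b (int q) 0 0)"
  using gt unfolding gt_basis_def Let_def b_def by (simp add: algebra_simps)

lemma lab_hw: "lab (int q) 0 0"
  by (simp add: lab_def)

abbreviation "wt r s k \<equiv> weight_vector (int p + 2 * int q - (r + s)) (r + s - k) k"

lemma weight_vector_cancel:
  assumes "v \<in> V" "weight_vector x y z (c *\<^sub>R v)" "c \<noteq> 0"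
  shows "weight_vector x y z v"
  using weight_vector_scaleR[OF mem_scaleR[OF assms(1)] assms(2), of "1 / c"] assms(3) by simp

text \<open>For fixed s, \<open>T_minus\<close> climbs in r along k = s with a single term, and then
  \<open>U_minus\<close> climbs in k.\<close>

lemma weight_row:
  assumes s: "wt (int q) s s (b (int q) s s)" and l: "lab r s k"
  shows "wt r s k (b r s k)"
proof -
  have 1: "wt r s s (b r s s)" if "int q \<le> r" "r \<le> int p + int q" for r
    using that
  proof (induction r rule: int_ge_induct)
    case base show ?case by (rule s)
  next
    case (step r)
    have l': "lab r s s" "lab (r + 1) s s" using step l by (auto simp: lab_def)
    have "r < int p + int q" using step by simp
    note c = coeff_pos(2)[OF l'(1) this]
    have w: "wt r s s (b r s s)" using step by simp
    have "wt (r + 1) s s (T_minus \<alpha> (b r s s))"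
      using weight_vector_lower(2)[OF b_mem[OF l'(1)] w] by (simp add: algebra_simps)
    thus ?case unfolding T_minus_bottom[OF l'(1)]
      by (rule weight_vector_cancel[OF b_mem[OF l'(2)] _ c])
  qed
  have "wt r s k (b r s k)" if "s \<le> k" "k \<le> r" for k
    using that
  proof (induction k rule: int_ge_induct)
    case base show ?case using l by (intro 1) (auto simp: lab_def)
  next
    case (step k)
    have l': "lab r s k" "lab r s (k + 1)" using step l by (auto simp: lab_def)
    have "k < r" using step by simp
    note c = coeff_pos(1)[OF l'(1) this]
    have w: "wt r s k (b r s k)" using step by simp
    have "wt r s (k + 1) (U_minus \<alpha> (b r s k))"
      using weight_vector_lower(1)[OF b_mem[OF l'(1)] w] by (simp add: algebra_simps)
    thus ?case unfolding lowering(1)[OF l'(1)]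
      by (rule weight_vector_cancel[OF b_mem[OF l'(2)] _ c])
  qed
  thus ?thesis using l by (simp add: lab_def)
qed

text \<open>Passing from s to s + 1, \<open>T_minus\<close> yields two terms; the one with r + 1
  lies in the row of s, whose weights are known from \<open>weight_row\<close>, and is
  subtracted.\<close>

lemma weight:
  assumes l: "lab r s k"
  shows "wt r s k (b r s k)"
proof -
  have "wt (int q) s s (b (int q) s s)" if "0 \<le> s" "s \<le> int q" for s
    using that
  proof (induction s rule: int_ge_induct)
    case base
    show ?case using highest_weight_vector_weight[OF b_mem[OF lab_hw] highest_weight]
      by (simp add: algebra_simps)
  next
    case (step s)
    let ?r = "int q"
    have l': "lab ?r s (s + 1)" "lab ?r (s + 1) (s + 1)" using step by (auto simp: lab_def)
    have "s < s + 1" "s < int q" using step by auto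
    note c = coeff_pos(3)[OF l'(1) this]
    have T: "T_minus \<alpha> (b ?r s (s + 1)) = cS ?r s (s + 1) *\<^sub>R b ?r (s + 1) (s + 1)
        + cR ?r s (s + 1) *\<^sub>R b (?r + 1) s (s + 1)"
      by (rule lowering(2)[OF l'(1)])
    have row: "wt (int q) s s (b (int q) s s)" using step by simp
    note w = weight_row[OF row]
    have wT: "wt ?r (s + 1) (s + 1) (T_minus \<alpha> (b ?r s (s + 1)))"
      using weight_vector_lower(2)[OF b_mem[OF l'(1)] w[OF l'(1)]] by (simp add: algebra_simps)
    have "cR ?r s (s + 1) *\<^sub>R b (?r + 1) s (s + 1) \<in> V
        \<and> wt ?r (s + 1) (s + 1) (cR ?r s (s + 1) *\<^sub>R b (?r + 1) s (s + 1))"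
    \<comment> \<open>Then r + 1 exceeds p + q and is not part of a label, but the coefficient has
      the factor p + q - r = 0.\<close>
    proof (cases "p = 0")
      case True thus ?thesis by (simp add: mem_zero weight_vector_def zero torus_SU3)
    next
      case False
      hence l2: "lab (?r + 1) s (s + 1)" using step by (auto simp: lab_def)
      from weight_vector_scaleR[OF b_mem[OF l2] w[OF l2]]
      have "wt ?r (s + 1) (s + 1) (cR ?r s (s + 1) *\<^sub>R b (?r + 1) s (s + 1))" by (simp add: algebra_simps)
      thus ?thesis using mem_scaleR[OF b_mem[OF l2]] by blast
    qed
    with weight_vector_diff[OF T_minus_mem[OF b_mem[OF l'(1)]] _ wT]
    have "wt ?r (s + 1) (s + 1) (T_minus \<alpha> (b ?r s (s + 1)) - cR ?r s (s + 1) *\<^sub>R b (?r + 1) s (s + 1))" by blast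
    hence "wt ?r (s + 1) (s + 1) (cS ?r s (s + 1) *\<^sub>R b ?r (s + 1) (s + 1))" by (simp add: T)
    thus ?case by (rule weight_vector_cancel[OF b_mem[OF l'(2)] _ c])
  qed
  thus ?thesis using weight_row l by (auto simp: lab_def)
qed

lemma highest_weight_orthogonal:
  assumes T: "\<And>w. w \<in> V \<Longrightarrow> cinner (T_minus \<alpha> w) v = 0" and U: "\<And>w. w \<in> V \<Longrightarrow> cinner (U_minus \<alpha> w) v = 0"
    and l: "lab r s k" and nhw: "\<not> (r = int q \<and> s = 0 \<and> k = 0)"
  shows "cinner (b r s k) v = 0"
proof -
  define Q where "Q = {w. cinner w v = 0}"
  have "b r s k \<in> Q"
  proof (rule lowering_range[OF _ _ _ l nhw])
    show "complex_vector.subspace Q"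
      unfolding Q_def by (rule complex_vector.subspaceI) (auto simp: cinner_add_left cinner_scaleC_left)
  qed (use T U in \<open>auto simp: Q_def\<close>)
  thus ?thesis by (simp add: Q_def)
qed

text \<open>For J > 0 each vector of a \<open>U_minus\<close>-string is a nonzero multiple of an
  image under \<open>U_minus\<close> or, at the bottom, under \<open>U_plus\<close>. So only the
  strings of length one (r = s, that is J = 0) can contribute to v.\<close>

lemma isotropy_fixed_orthogonal:
  assumes m: "\<And>w. w \<in> V \<Longrightarrow> cinner (U_minus \<alpha> w) v = 0"
    and p: "\<And>w. w \<in> V \<Longrightarrow> cinner (U_plus \<alpha> w) v = 0"
    and l: "lab r s k" and ne: "r \<noteq> s"
  shows "cinner (b r s k) v = 0"
proof (cases "k = s")
  case True
  have l': "lab r s (s + 1)" using l ne by (auto simp: lab_def)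
  have "of_real (sqrt (real_of_int ((r - (s + 1) + 1) * (s + 1 - s)))) * cinner (b r s s) v
      = cinner (U_plus \<alpha> (b r s (s + 1))) v"
    unfolding U_plus_b[OF l'] by (simp add: cinner_scaleR_left)
  also have "\<dots> = 0" by (rule p[OF b_mem[OF l']])
  finally show ?thesis using True ne by simp
next
  case False
  have l': "lab r s (k - 1)" and lt: "k - 1 < r" using l False by (auto simp: lab_def)
  have "of_real (cU r s (k - 1)) * cinner (b r s k) v
      = cinner (U_minus \<alpha> (b r s (k - 1))) v"
    unfolding lowering(1)[OF l'] by (simp add: cinner_scaleR_left)
  also have "\<dots> = 0" by (rule m[OF b_mem[OF l']])
  finally show ?thesis using coeff_pos(1)[OF l' lt] by simp
qed

end

section \<open>Independence of the GT matrix elements from the realization\<close>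

lemma flow_intertwine:
  fixes \<alpha> :: "complex^3^3 \<Rightarrow> 'a \<Rightarrow> 'a::complex_euclidean"
    and \<beta> :: "complex^3^3 \<Rightarrow> 'b \<Rightarrow> 'b::complex_euclidean"
  assumes "urep \<alpha> V" "urep \<beta> W" and X: "X \<in> su3" and v: "v \<in> V"
    and \<Phi>: "bounded_linear \<Phi>" and \<Phi>W: "\<And>v. v \<in> V \<Longrightarrow> \<Phi> v \<in> W"
    and comm: "\<And>v. v \<in> V \<Longrightarrow> \<Phi> (su3_action \<alpha> X v) = su3_action \<beta> X (\<Phi> v)"
  shows "\<Phi> (\<alpha> (mexp (t *\<^sub>R X)) v) = \<beta> (mexp (t *\<^sub>R X)) (\<Phi> v)"
proof -
  interpret A: urep \<alpha> V by fact
  interpret B: urep \<beta> W by fact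
  \<comment> \<open>Both sides solve the flow equation in W with the same initial value, so their
    difference is covered by \<open>flow_equation_zero\<close>.\<close>
  define F where "F s = \<Phi> (\<alpha> (mexp (s *\<^sub>R X)) v) - \<beta> (mexp (s *\<^sub>R X)) (\<Phi> v)" for s
  note mA = A.mem[OF mexp_SU3[OF X] v] and mB = B.mem[OF mexp_SU3[OF X] \<Phi>W[OF v]]
  have FW: "F s \<in> W" for s unfolding F_def by (intro B.mem_diff \<Phi>W mA mB)
  have "(F has_vector_derivative su3_action \<beta> X (F s)) (at s)" for s
  proof -
    have "su3_action \<beta> X (F s) = \<Phi> (su3_action \<alpha> X (\<alpha> (mexp (s *\<^sub>R X)) v))
        - su3_action \<beta> X (\<beta> (mexp (s *\<^sub>R X)) (\<Phi> v))"
      unfolding F_def comm[OF mA] by (intro B.d_diff_right X \<Phi>W mA mB)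
    thus ?thesis
      using has_vector_derivative_diff[OF bounded_linear.has_vector_derivative[OF \<Phi>
          A.flow_derivative[OF X v, of s]] B.flow_derivative[OF X \<Phi>W[OF v], of s]]
      unfolding F_def[abs_def] by (simp only:)
  qed
  moreover have "F 0 = 0" by (simp add: F_def A.one B.one v \<Phi>W)
  ultimately have "F t = 0" using B.flow_equation_zero[of X F t, OF X FW] by blast
  thus ?thesis by (simp add: F_def)
qed

context gt
begin

lemma linear_eqI:
  fixes L L' :: "'a \<Rightarrow> 'b::complex_euclidean"
  assumes "\<And>a v w. v \<in> V \<Longrightarrow> w \<in> V \<Longrightarrow> L (a *\<^sub>C v + w) = a *\<^sub>C L v + L w"
    and "\<And>a v w. v \<in> V \<Longrightarrow> w \<in> V \<Longrightarrow> L' (a *\<^sub>C v + w) = a *\<^sub>C L' v + L' w"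
    and b: "\<And>r s k. lab r s k \<Longrightarrow> L (b r s k) = L' (b r s k)"
    and v: "v \<in> V"
  shows "L v = L' v"
proof -
  have 0: "L 0 = 0" "L' 0 = 0"
    using assms(1)[OF mem_zero mem_zero, of 1] assms(2)[OF mem_zero mem_zero, of 1] by simp_all
  have "v \<in> V \<and> L v = L' v" if "v \<in> complex_vector.span {b r s k | r s k. lab r s k}"
    using that
  proof (induction rule: complex_vector.span_induct_alt)
    case base thus ?case by (simp add: 0 mem_zero)
  next
    case (step c x y)
    then obtain r s k where "lab r s k" "x = b r s k" by blast
    thus ?case using step assms b_mem by (simp add: mem_add mem_scaleC)
  qed
  thus ?thesis using v by (simp add: span_b)
qed

end

text \<open>Matrix elements in a GT basis do not depend on the realization: the isometry \<open>\<Phi>\<close> matching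
  two GT bases commutes with the lowering operators, with their adjoints and with the torus, hence
  with the generators of the group.\<close>

lemma gt_matrix_elements:
  fixes \<alpha> :: "complex^3^3 \<Rightarrow> 'a \<Rightarrow> 'a::complex_euclidean"
    and \<beta> :: "complex^3^3 \<Rightarrow> 'b \<Rightarrow> 'b::complex_euclidean"
  assumes "gt \<alpha> V p q e" "gt \<beta> W p q f" and g: "g \<in> SU3"
    and i: "(\<nu>, J) \<in> gt_labels (p, q)" and j: "(\<mu>, L) \<in> gt_labels (p, q)"
  shows "cinner (e \<nu> J) (\<alpha> g (e \<mu> L)) = cinner (f \<nu> J) (\<beta> g (f \<mu> L))"
proof -
  interpret A: gt \<alpha> V p q e by fact
  interpret B: gt \<beta> W p q f by fact
  define EA where "EA i = (case i of (\<nu>, J) \<Rightarrow> e \<nu> J)" for i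
  define FB where "FB i = (case i of (\<nu>, J) \<Rightarrow> f \<nu> J)" for i
  define \<Phi> where "\<Phi> v = (\<Sum>i\<in>gt_labels (p, q). cinner (EA i) v *\<^sub>C FB i)" for v
  have bl: "bounded_linear \<Phi>"
    unfolding \<Phi>_def[abs_def]
    by (intro bounded_linear_sum bounded_linear_compose[OF
          bounded_bilinear.bounded_linear_left[OF bounded_bilinear_scaleC]]
        bounded_bilinear.bounded_linear_right[OF bounded_bilinear_cinner])
  have lin: "\<Phi> (a *\<^sub>C v + w) = a *\<^sub>C \<Phi> v + \<Phi> w" for a v w
    by (simp add: \<Phi>_def cinner_add_right cinner_scaleC_right scaleC_add_left sum.distrib
        complex_vector.scale_sum_right scaleC_scaleC)
  have \<Phi>e: "\<Phi> (e \<nu> J) = f \<nu> J" if "(\<nu>, J) \<in> gt_labels (p, q)" for \<nu> J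
  proof -
    have "cinner (EA i) (e \<nu> J) = (if i = (\<nu>, J) then 1 else 0)" if i: "i \<in> gt_labels (p, q)" for i
      using i \<open>(\<nu>, J) \<in> _\<close> by (cases i) (simp add: EA_def A.orthonormal)
    hence "\<Phi> (e \<nu> J) = (\<Sum>i\<in>gt_labels (p, q). if i = (\<nu>, J) then FB i else 0)"
      unfolding \<Phi>_def by (intro sum.cong) auto
    thus ?thesis using that by (simp add: finite_gt_labels FB_def)
  qed
  have \<Phi>b: "\<Phi> (A.b r s k) = B.b r s k" if "A.lab r s k" for r s k
    unfolding A.b_def B.b_def by (rule \<Phi>e[OF A.lab_gt[OF that]])
  have FBW: "FB i \<in> W" if "i \<in> gt_labels (p, q)" for i
    using that B.e_mem by (cases i) (simp add: FB_def)
  have \<Phi>W: "\<Phi> v \<in> W" for v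
    unfolding \<Phi>_def by (intro B.mem_sum B.mem_scaleC FBW)
  have cF: "cinner (FB i) (\<Phi> v) = cinner (EA i) v" if i: "i \<in> gt_labels (p, q)" for i v
  proof -
    have "cinner (FB i) (FB j) = (if i = j then 1 else 0)" if "j \<in> gt_labels (p, q)" for j
      using i that by (cases i; cases j) (auto simp: FB_def B.orthonormal)
    hence "cinner (FB i) (\<Phi> v) = (\<Sum>j\<in>gt_labels (p, q). if i = j then cinner (EA j) v else 0)"
      unfolding \<Phi>_def cinner_sum_right cinner_scaleC_right by (intro sum.cong) auto
    thus ?thesis using i by (simp add: finite_gt_labels)
  qed
  have cb: "cinner (B.b r s k) (\<Phi> v) = cinner (A.b r s k) v" if "A.lab r s k" for r s k v
    using cF[OF A.lab_gt[OF that], of v] by (simp add: EA_def FB_def A.b_def B.b_def)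
  have iso: "cinner (\<Phi> v) (\<Phi> w) = cinner v w" if v: "v \<in> V" for v w
  proof -
    have "cinner (\<Phi> v) (\<Phi> w) = (\<Sum>i\<in>gt_labels (p, q). cnj (cinner (EA i) v) * cinner (FB i) (\<Phi> w))"
      by (subst (1) \<Phi>_def) (simp add: cinner_sum_left cinner_scaleC_left)
    also have "\<dots> = cinner (\<Sum>i\<in>gt_labels (p, q). cinner (EA i) v *\<^sub>C EA i) w"
      by (simp add: cF cinner_sum_left cinner_scaleC_left)
    also have "(\<Sum>i\<in>gt_labels (p, q). cinner (EA i) v *\<^sub>C EA i) = v"
      unfolding EA_def by (rule A.expand[OF v, symmetric])
    finally show ?thesis .
  qed
  have sR: "\<Phi> (c *\<^sub>R v) = c *\<^sub>R \<Phi> v" for c v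
    using bl by (simp add: linear_simps)
  have \<Phi>0: "\<Phi> 0 = 0" by (simp add: \<Phi>_def)
  have U: "\<Phi> (U_minus \<alpha> v) = U_minus \<beta> (\<Phi> v)" if "v \<in> V" for v
  proof (rule A.linear_eqI[OF _ _ _ that, of "\<lambda>v. \<Phi> (U_minus \<alpha> v)" "\<lambda>v. U_minus \<beta> (\<Phi> v)"])
    show "\<Phi> (U_minus \<alpha> (a *\<^sub>C v + w)) = a *\<^sub>C \<Phi> (U_minus \<alpha> v) + \<Phi> (U_minus \<alpha> w)"
      if "v \<in> V" "w \<in> V" for a v w
      unfolding U_minus_def using that trace_unit_matrix[of 3 2]
      by (simp add: A.sl3_add_right A.sl3_scaleC_right A.mem_scaleC lin)
    show "U_minus \<beta> (\<Phi> (a *\<^sub>C v + w)) = a *\<^sub>C U_minus \<beta> (\<Phi> v) + U_minus \<beta> (\<Phi> w)"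
      for a v w
      unfolding U_minus_def using trace_unit_matrix[of 3 2]
      by (simp add: B.sl3_add_right B.sl3_scaleC_right B.mem_scaleC lin \<Phi>W)
    fix r s k assume l: "A.lab r s k"
    show "\<Phi> (U_minus \<alpha> (A.b r s k)) = U_minus \<beta> (\<Phi> (A.b r s k))"
    proof (cases "k = r")
      case True
      thus ?thesis using l by (simp add: A.lowering B.lowering \<Phi>b sR \<Phi>0)
    next
      case False
      hence "A.lab r s (k + 1)" using l by (auto simp: A.lab_def)
      thus ?thesis using l by (simp add: A.lowering B.lowering \<Phi>b sR \<Phi>0)
    qed
  qed
  have T: "\<Phi> (T_minus \<alpha> v) = T_minus \<beta> (\<Phi> v)" if "v \<in> V" for v
  proof (rule A.linear_eqI[OF _ _ _ that, of "\<lambda>v. \<Phi> (T_minus \<alpha> v)" "\<lambda>v. T_minus \<beta> (\<Phi> v)"])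
    show "\<Phi> (T_minus \<alpha> (a *\<^sub>C v + w)) = a *\<^sub>C \<Phi> (T_minus \<alpha> v) + \<Phi> (T_minus \<alpha> w)"
      if "v \<in> V" "w \<in> V" for a v w
      unfolding T_minus_def using that trace_unit_matrix[of 2 1]
      by (simp add: A.sl3_add_right A.sl3_scaleC_right A.mem_scaleC lin)
    show "T_minus \<beta> (\<Phi> (a *\<^sub>C v + w)) = a *\<^sub>C T_minus \<beta> (\<Phi> v) + T_minus \<beta> (\<Phi> w)"
      for a v w
      unfolding T_minus_def using trace_unit_matrix[of 2 1]
      by (simp add: B.sl3_add_right B.sl3_scaleC_right B.mem_scaleC lin \<Phi>W)
    fix r s k assume l: "A.lab r s k"
    \<comment> \<open>Either the target is a label, where \<Phi> matches the two bases, or its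
      coefficient is 0; at other indices the two families are unrelated.\<close>
    have 1: "k = s \<or> s = int q \<or> A.lab r (s + 1) k" "r = int p + int q \<or> A.lab (r + 1) s k"
      using l by (auto simp: A.lab_def)
    have comb: "c1 = 0 \<or> A.lab r (s + 1) k \<Longrightarrow> c2 = 0 \<or> A.lab (r + 1) s k \<Longrightarrow>
        \<Phi> (c1 *\<^sub>R A.b r (s + 1) k + c2 *\<^sub>R A.b (r + 1) s k)
        = c1 *\<^sub>R B.b r (s + 1) k + c2 *\<^sub>R B.b (r + 1) s k" for c1 c2
      using linear_add[OF bounded_linear.linear[OF bl]] by (auto simp: sR \<Phi>b \<Phi>0)
    show "\<Phi> (T_minus \<alpha> (A.b r s k)) = T_minus \<beta> (\<Phi> (A.b r s k))"
      unfolding \<Phi>b[OF l] A.lowering(2)[OF l] B.lowering(2)[OF l]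
      by (rule comb) (use 1 in auto)
  qed
  \<comment> \<open>Since \<Phi> is isometric and commutes with \<open>U_minus\<close>, testing
    against basis vectors transfers the adjoint.\<close>
  have Up: "\<Phi> (U_plus \<alpha> v) = U_plus \<beta> (\<Phi> v)" if v: "v \<in> V" for v
  proof (rule B.basis_eqI)
    fix r s k assume l: "B.lab r s k"
    show "cinner (B.b r s k) (\<Phi> (U_plus \<alpha> v)) = cinner (B.b r s k) (U_plus \<beta> (\<Phi> v))"
      using l v by (simp add: cb A.raising_adjoint B.raising_adjoint B.b_mem A.b_mem \<Phi>W iso
          A.U_minus_mem flip: U \<Phi>b)
  qed (intro \<Phi>W B.U_plus_mem)+
  have Tp: "\<Phi> (T_plus \<alpha> v) = T_plus \<beta> (\<Phi> v)" if v: "v \<in> V" for v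
  proof (rule B.basis_eqI)
    fix r s k assume l: "B.lab r s k"
    show "cinner (B.b r s k) (\<Phi> (T_plus \<alpha> v)) = cinner (B.b r s k) (T_plus \<beta> (\<Phi> v))"
      using l v by (simp add: cb A.raising_adjoint B.raising_adjoint B.b_mem A.b_mem \<Phi>W iso
          A.T_minus_mem flip: T \<Phi>b)
  qed (intro \<Phi>W B.T_plus_mem)+
  have dif: "\<Phi> (v - w) = \<Phi> v - \<Phi> w" for v w
    by (rule linear_diff[OF bounded_linear.linear[OF bl]])
  have in_su3: "unit_matrix 2 1 - unit_matrix 1 2 \<in> su3" "unit_matrix 3 2 - unit_matrix 2 3 \<in> su3"
    by (simp_all add: su3_def dagger_diff dagger_unit_matrix trace_sub trace_unit_matrix)
  have main: "\<Phi> (\<alpha> g v) = \<beta> g (\<Phi> v)" if "v \<in> V" for v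
    using g that
  proof (induction arbitrary: v rule: SU3_induct)
    case (torus x y z)
    note xyz = torus_SU3[OF torus(1)]
    show ?case
    proof (rule A.linear_eqI[OF _ _ _ torus(2), of "\<lambda>v. \<Phi> (\<alpha> (torus x y z) v)" "\<lambda>v. \<beta> (torus x y z) (\<Phi> v)"])
      fix r s k assume l: "A.lab r s k"
      show "\<Phi> (\<alpha> (torus x y z) (A.b r s k)) = \<beta> (torus x y z) (\<Phi> (A.b r s k))"
        using A.weight_vectorD[OF A.weight[OF l] torus(1)] B.weight_vectorD[OF B.weight[OF l] torus(1)]
          lin[of _ _ 0]
        by (simp add: \<Phi>b[OF l] \<Phi>0)
    qed (simp_all add: A.lin B.lin xyz lin \<Phi>W)
  next
    case (rot12 t)
    have "\<Phi> (\<alpha> (mexp (t *\<^sub>R (unit_matrix 2 1 - unit_matrix 1 2))) v)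
        = \<beta> (mexp (t *\<^sub>R (unit_matrix 2 1 - unit_matrix 1 2))) (\<Phi> v)"
    proof (rule flow_intertwine[OF A.urep_axioms B.urep_axioms in_su3(1) rot12 bl])
      show "\<Phi> (su3_action \<alpha> (unit_matrix 2 1 - unit_matrix 1 2) v)
          = su3_action \<beta> (unit_matrix 2 1 - unit_matrix 1 2) (\<Phi> v)" if "v \<in> V" for v
        using T[OF that] Tp[OF that] that \<Phi>W
        by (simp add: A.skew_eq_lowering_minus_raising B.skew_eq_lowering_minus_raising dif
            T_minus_def T_plus_def)
    qed (rule \<Phi>W)
    thus ?case by (simp add: mexp_rot12)
  next
    case (rot23 t)
    have "\<Phi> (\<alpha> (mexp (t *\<^sub>R (unit_matrix 3 2 - unit_matrix 2 3))) v)
        = \<beta> (mexp (t *\<^sub>R (unit_matrix 3 2 - unit_matrix 2 3))) (\<Phi> v)"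
    proof (rule flow_intertwine[OF A.urep_axioms B.urep_axioms in_su3(2) rot23 bl])
      show "\<Phi> (su3_action \<alpha> (unit_matrix 3 2 - unit_matrix 2 3) v)
          = su3_action \<beta> (unit_matrix 3 2 - unit_matrix 2 3) (\<Phi> v)" if "v \<in> V" for v
        using U[OF that] Up[OF that] that \<Phi>W
        by (simp add: A.skew_eq_lowering_minus_raising B.skew_eq_lowering_minus_raising dif
            U_minus_def U_plus_def)
    qed (rule \<Phi>W)
    thus ?case by (simp add: mexp_rot23)
  next
    case (mult g h)
    thus ?case by (simp add: A.mult B.mult A.mem \<Phi>W)
  qed
  have "cinner (e \<nu> J) (\<alpha> g (e \<mu> L)) = cinner (\<Phi> (e \<nu> J)) (\<Phi> (\<alpha> g (e \<mu> L)))"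
    by (rule iso[OF A.e_mem[OF i], symmetric])
  also have "\<dots> = cinner (f \<nu> J) (\<beta> g (f \<mu> L))"
    by (simp add: main A.e_mem j i \<Phi>e)
  finally show ?thesis .
qed

section \<open>The action on operators\<close>

context
  fixes \<rho> :: "complex^3^3 \<Rightarrow> complex^'d^'d"
  assumes rep: "unitary_rep (vector_action \<rho>) UNIV"
begin

interpretation vec: urep "vector_action \<rho>" UNIV by standard (rule rep)

lemma rho_mult: "g \<in> SU3 \<Longrightarrow> h \<in> SU3 \<Longrightarrow> \<rho> (g ** h) = \<rho> g ** \<rho> h"
  using vec.mult[of g h] by (simp add: vector_action_def matrix_eq matrix_vector_mul_assoc)

lemma rho_one: "\<rho> (mat 1) = mat 1"
  using vec.one by (simp add: vector_action_def matrix_eq)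

lemma rho_unitary:
  assumes g: "g \<in> SU3"
  shows "dagger (\<rho> g) ** \<rho> g = mat 1" "\<rho> g ** dagger (\<rho> g) = mat 1"
proof -
  have "cinner v ((dagger (\<rho> g) ** \<rho> g) *v w) = cinner v (mat 1 *v w)" for v w
    using vec.unitary[OF g, of v w]
    by (simp add: vector_action_def cinner_matrix_vector matrix_vector_mul_assoc[symmetric])
  hence "cinner v ((dagger (\<rho> g) ** \<rho> g) *v w - mat 1 *v w) = 0" for v w
    by (simp add: cinner_diff_right)
  hence "(dagger (\<rho> g) ** \<rho> g) *v w - mat 1 *v w = 0" for w
    by (rule cinner_eq_zero_iff[THEN iffD1])
  thus "dagger (\<rho> g) ** \<rho> g = mat 1" by (simp add: matrix_eq)
  thus "\<rho> g ** dagger (\<rho> g) = mat 1" using matrix_left_right_inverse by blast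
qed

lemma rho_dagger: "g \<in> SU3 \<Longrightarrow> \<rho> (dagger g) = dagger (\<rho> g)"
proof -
  assume g: "g \<in> SU3"
  have "\<rho> (dagger g) ** \<rho> g = mat 1"
    using rho_mult[OF SU3_dagger[OF g] g] by (simp add: SU3_inverse[OF g] rho_one)
  hence "\<rho> (dagger g) ** \<rho> g ** dagger (\<rho> g) = dagger (\<rho> g)" by simp
  hence "\<rho> (dagger g) ** (\<rho> g ** dagger (\<rho> g)) = dagger (\<rho> g)"
    unfolding matrix_mul_assoc .
  thus ?thesis unfolding rho_unitary(2)[OF g] by simp
qed

lemma operator_action_eq: "g \<in> SU3 \<Longrightarrow> operator_action \<rho> g A = \<rho> g ** A ** dagger (\<rho> g)"
  by (simp add: operator_action_def matrix_inv_eqI[OF rho_unitary(2,1)])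

lemma operator_action_dagger:
  "g \<in> SU3 \<Longrightarrow> dagger (operator_action \<rho> g A) = operator_action \<rho> g (dagger A)"
  by (simp add: operator_action_eq dagger_mult matrix_mul_assoc)

lemma rho_continuous: "continuous_on SU3 \<rho>"
proof -
  have "continuous_on SU3 (\<lambda>g. (\<chi> i j. (\<rho> g *v axis j 1) $ i))"
    using vec.cont[unfolded vector_action_def]
    by (intro continuous_on_vec_lambda continuous_on_component) simp
  moreover have "(\<chi> i j. (\<rho> g *v axis j 1) $ i) = \<rho> g" for g
    by (simp add: matrix_vector_mult_def axis_def vec_eq_iff if_distrib[of "\<lambda>x. _ * x"] cong: if_cong)
  ultimately show ?thesis by simp
qed

lemma operator_rep: "unitary_rep (operator_action \<rho>) UNIV"
  unfolding unitary_rep_def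
proof (intro conjI ballI allI)
  show "complex_vector.subspace UNIV" by (rule complex_vector.subspace_UNIV)
  fix v :: "complex^'d^'d"
  show "operator_action \<rho> (mat 1) v = v" by (simp add: operator_action_eq SU3_one rho_one)
  have "continuous_on SU3 (\<lambda>g. \<rho> g ** v ** dagger (\<rho> g))"
    by (intro bounded_bilinear.continuous_on[OF bounded_bilinear_matrix_mult] continuous_on_const
        bounded_linear.continuous_on[OF bounded_linear_dagger] rho_continuous)
  thus "continuous_on SU3 (\<lambda>g. operator_action \<rho> g v)"
    by (rule continuous_on_eq) (simp add: operator_action_eq)
  fix g assume g: "g \<in> SU3"
  show "operator_action \<rho> g v \<in> UNIV" by simp
  fix w :: "complex^'d^'d"
  show "operator_action \<rho> g (a *\<^sub>C v + w) = a *\<^sub>C operator_action \<rho> g v + operator_action \<rho> g w" for a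
    by (simp add: operator_action_eq g matrix_add_ldistrib matrix_mult_add_left matrix_scaleC_left
        matrix_scaleC_right)
  show "cinner (operator_action \<rho> g v) (operator_action \<rho> g w) = cinner v w"
    by (simp add: operator_action_eq g cinner_matrix_left cinner_matrix_right rho_unitary
        flip: matrix_mul_assoc)
next
  fix g h v assume g: "g \<in> SU3" and h: "h \<in> SU3"
  show "operator_action \<rho> (g ** h) v = operator_action \<rho> g (operator_action \<rho> h v)"
    by (simp add: operator_action_eq g h SU3_mult rho_mult dagger_mult matrix_mul_assoc)
qed

lemma trace_operator_action:
  assumes g: "g \<in> SU3"
  shows "trace (A ** operator_action \<rho> g B) = trace (operator_action \<rho> (dagger g) A ** B)"
proof -
  have "trace (A ** (\<rho> g ** B ** dagger (\<rho> g))) = trace (dagger (\<rho> g) ** (A ** \<rho> g ** B))"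
    by (subst trace_mul_sym) (simp add: matrix_mul_assoc)
  thus ?thesis
    by (simp add: operator_action_eq g SU3_dagger rho_dagger matrix_mul_assoc)
qed

end

section \<open>The projective plane as a homogeneous space\<close>

lemma Rep_proj: "v \<noteq> 0 \<Longrightarrow> Rep_cp2 (proj v) = range (\<lambda>c. c *\<^sub>C v)"
  unfolding proj_def by (intro Abs_cp2_inverse) blast

lemma proj_eq_iff:
  assumes "v \<noteq> 0" "w \<noteq> 0"
  shows "proj v = proj w \<longleftrightarrow> (\<exists>c. w = c *\<^sub>C v)"
proof
  assume "proj v = proj w"
  hence "range (\<lambda>c. c *\<^sub>C w) = range (\<lambda>c. c *\<^sub>C v)" using Rep_proj assms by metis
  moreover have "w \<in> range (\<lambda>c. c *\<^sub>C w)" by (rule range_eqI[of _ _ 1]) simp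
  ultimately show "\<exists>c. w = c *\<^sub>C v" by auto
next
  assume "\<exists>c. w = c *\<^sub>C v"
  then obtain c where w: "w = c *\<^sub>C v" by blast
  hence c: "c \<noteq> 0" using assms by auto
  have "range (\<lambda>a. a *\<^sub>C w) = range (\<lambda>a. a *\<^sub>C v)"
  proof (intro subset_antisym subsetI)
    fix x assume "x \<in> range (\<lambda>a. a *\<^sub>C w)"
    thus "x \<in> range (\<lambda>a. a *\<^sub>C v)" by (auto simp: w scaleC_scaleC)
  next
    fix x assume "x \<in> range (\<lambda>a. a *\<^sub>C v)"
    then obtain a where "x = a *\<^sub>C v" by blast
    hence "x = (a / c) *\<^sub>C w" using c by (simp add: w scaleC_scaleC)
    thus "x \<in> range (\<lambda>a. a *\<^sub>C w)" by blast
  qed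
  thus "proj v = proj w" by (simp add: proj_def)
qed

lemma cp2_cases:
  obtains v where "v \<noteq> 0" "x = proj v"
  using Rep_cp2[of x] Rep_cp2_inverse[of x] unfolding proj_def by auto

lemma vector_axis: "(vector [1, 0, 0] :: complex^3) = axis 1 1"
  by (simp add: vec_eq_iff forall_3 axis_def)

lemma SU3_nonzero: "g \<in> SU3 \<Longrightarrow> v \<noteq> 0 \<Longrightarrow> g *v v \<noteq> 0"
  by (metis SU3_inverse(1) matrix_vector_mul_assoc matrix_vector_mul_lid matrix_vector_mult_0_right)

lemma axis_nonzero: "(axis 1 1 :: complex^3) \<noteq> 0"
  by (simp add: axis_eq_0_iff)

lemma cp2_act_base: "cp2_act g base_point = proj (g *v axis 1 1)"
  unfolding base_point_def vector_axis by (rule cp2_act_proj[OF axis_nonzero])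

lemma cp2_act_mult: "g \<in> SU3 \<Longrightarrow> h \<in> SU3 \<Longrightarrow> cp2_act (g ** h) x = cp2_act g (cp2_act h x)"
  by (rule cp2_cases[of x]) (simp add: cp2_act_proj SU3_nonzero matrix_vector_mul_assoc)

lemma cp2_transitive:
  assumes "v \<noteq> 0"
  obtains g where "g \<in> SU3" "cp2_act g base_point = proj v" "g *v axis 1 1 = (1 / norm v) *\<^sub>R v"
proof -
  obtain g where g: "g \<in> SU3" "g *v axis 1 1 = (1 / norm v) *\<^sub>R v"
    using SU3_axis[OF assms] by blast
  have "proj v = proj ((1 / norm v) *\<^sub>R v)"
    using assms by (subst proj_eq_iff) (auto simp flip: scaleC_of_real)
  thus ?thesis using that g by (simp add: cp2_act_base)
qed

lemma cp2_obtain: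
  obtains g where "g \<in> SU3" "x = cp2_act g base_point"
  by (metis cp2_cases cp2_transitive)

text \<open>The group H in the form of the stabilizer of the line through the first axis: only the
  first column is constrained, and unitarity gives the block shape.\<close>

definition isotropy :: "(complex^3^3) set"
  where "isotropy = {h \<in> SU3. h $ 2 $ 1 = 0 \<and> h $ 3 $ 1 = 0}"

lemma cp2_act_base_eq_iff:
  assumes g: "g \<in> SU3" and g': "g' \<in> SU3"
  shows "cp2_act g base_point = cp2_act g' base_point \<longleftrightarrow> dagger g ** g' \<in> isotropy"
proof -
  let ?e = "axis 1 1 :: complex^3"
  have "cp2_act g base_point = cp2_act g' base_point \<longleftrightarrow> (\<exists>c. g' *v ?e = c *\<^sub>C (g *v ?e))"
    unfolding cp2_act_base by (intro proj_eq_iff SU3_nonzero g g' axis_nonzero)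
  also have "\<dots> \<longleftrightarrow> (\<exists>c. (dagger g ** g') *v ?e = c *\<^sub>C ?e)"
  proof (intro ex_cong1)
    fix c
    have "dagger g *v (c *\<^sub>C (g *v ?e)) = c *\<^sub>C ?e"
      by (simp add: matrix_vector_scaleC_right matrix_vector_mul_assoc SU3_inverse[OF g])
    moreover have "g *v ((dagger g ** g') *v ?e) = g' *v ?e"
      by (simp add: matrix_vector_mul_assoc matrix_mul_assoc SU3_inverse[OF g])
    ultimately show "g' *v ?e = c *\<^sub>C (g *v ?e) \<longleftrightarrow> (dagger g ** g') *v ?e = c *\<^sub>C ?e"
      by (metis matrix_vector_mul_assoc matrix_vector_scaleC_right)
  qed
  also have "\<dots> \<longleftrightarrow> dagger g ** g' \<in> isotropy"
    using SU3_mult[OF SU3_dagger[OF g] g']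
    by (auto simp: isotropy_def vec_eq_iff forall_3 matrix_vector_mult_def sum_3 axis_def)
  finally show ?thesis .
qed

lemma descend_eq:
  assumes F: "\<And>g h. g \<in> SU3 \<Longrightarrow> h \<in> isotropy \<Longrightarrow> F (g ** h) = F g" and g: "g \<in> SU3"
  shows "descend F (cp2_act g base_point) = F g"
  unfolding descend_def
proof (rule the_equality)
  show "\<forall>g'\<in>SU3. cp2_act g' base_point = cp2_act g base_point \<longrightarrow> F g' = F g"
  proof safe
    fix g' assume g': "g' \<in> SU3" "cp2_act g' base_point = cp2_act g base_point"
    hence "F (g ** (dagger g ** g')) = F g"
      using cp2_act_base_eq_iff[OF g g'(1)] by (intro F g) simp
    thus "F g' = F g" by (simp add: matrix_mul_assoc SU3_inverse[OF g])
  qed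
qed (use g in blast)

section \<open>Smoothness\<close>

lemma Ck_SucI:
  assumes "\<And>x. (f has_derivative f' x) (at x)" "\<And>v. Ck k (\<lambda>x. f' x v)"
  shows "Ck (Suc k) f"
proof -
  have "frechet_derivative f (at x) = f' x" for x
    using frechet_derivative_at[OF assms(1)] by simp
  thus ?thesis using assms by (auto simp: differentiable_def)
qed

lemma Ck_SucD:
  assumes "Ck (Suc k) f"
  obtains f' where "\<And>x. (f has_derivative f' x) (at x)" "\<And>v. Ck k (\<lambda>x. f' x v)"
  using assms that[of "\<lambda>x. frechet_derivative f (at x)"] by (auto simp: frechet_derivative_works)

lemma Ck_Suc_imp_Ck: "Ck (Suc k) f \<Longrightarrow> Ck k f"
proof (induction k arbitrary: f)
  case 0
  thus ?case by (auto simp: continuous_on_eq_continuous_at intro: differentiable_imp_continuous_within)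
next
  case (Suc k)
  from Suc.prems obtain f' where f': "\<And>x. (f has_derivative f' x) (at x)" "\<And>v. Ck (Suc k) (\<lambda>x. f' x v)"
    by (rule Ck_SucD) blast
  show ?case by (rule Ck_SucI[OF f'(1) Suc.IH[OF f'(2)]])
qed

lemma Ck_const: "Ck k (\<lambda>x. c)"
proof (induction k arbitrary: c)
  case (Suc k)
  show ?case by (rule Ck_SucI[of _ "\<lambda>x v. 0"]) (auto intro!: derivative_eq_intros Suc)
qed (simp add: continuous_on_const)

lemma Ck_ident: "Ck k (\<lambda>x. x)"
proof (cases k)
  case (Suc n)
  show ?thesis unfolding Suc by (rule Ck_SucI[of _ "\<lambda>x v. v"]) (auto intro!: derivative_eq_intros Ck_const)
qed (simp add: continuous_on_id)

lemma Ck_bounded_linear: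
  assumes L: "bounded_linear L" and "Ck k f" shows "Ck k (\<lambda>x. L (f x))"
  using assms(2)
proof (induction k arbitrary: f)
  case 0 thus ?case using bounded_linear.continuous_on[OF L, of UNIV f] by simp
next
  case (Suc k)
  from Suc.prems obtain f' where f': "\<And>x. (f has_derivative f' x) (at x)" "\<And>v. Ck k (\<lambda>x. f' x v)"
    by (rule Ck_SucD) blast
  show ?case
    by (rule Ck_SucI[OF bounded_linear.has_derivative[OF L f'(1)] Suc.IH[OF f'(2)]])
qed

lemma Ck_add:
  assumes "Ck k f" "Ck k g" shows "Ck k (\<lambda>x. f x + g x)"
  using assms
proof (induction k arbitrary: f g)
  case 0 thus ?case by (simp add: continuous_on_add)
next
  case (Suc k)
  obtain f' where f': "\<And>x. (f has_derivative f' x) (at x)" "\<And>v. Ck k (\<lambda>x. f' x v)"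
    by (rule Ck_SucD[OF Suc.prems(1)]) blast
  obtain g' where g': "\<And>x. (g has_derivative g' x) (at x)" "\<And>v. Ck k (\<lambda>x. g' x v)"
    by (rule Ck_SucD[OF Suc.prems(2)]) blast
  show ?case
    by (rule Ck_SucI[OF has_derivative_add[OF f'(1) g'(1)] Suc.IH[OF f'(2) g'(2)]])
qed

lemma Ck_sum:
  "(\<And>i. i \<in> I \<Longrightarrow> Ck k (f i)) \<Longrightarrow> Ck k (\<lambda>x. \<Sum>i\<in>I. f i x)"
  by (induction I rule: infinite_finite_induct) (auto simp: Ck_const Ck_add)

lemma Ck_bilinear:
  assumes B: "bounded_bilinear B" and "Ck k f" "Ck k g" shows "Ck k (\<lambda>x. B (f x) (g x))"
  using assms(2,3)
proof (induction k arbitrary: f g)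
  case 0 thus ?case using bounded_bilinear.continuous_on[OF B, of UNIV f g] by simp
next
  case (Suc k)
  obtain f' where f': "\<And>x. (f has_derivative f' x) (at x)" "\<And>v. Ck k (\<lambda>x. f' x v)"
    by (rule Ck_SucD[OF Suc.prems(1)]) blast
  obtain g' where g': "\<And>x. (g has_derivative g' x) (at x)" "\<And>v. Ck k (\<lambda>x. g' x v)"
    by (rule Ck_SucD[OF Suc.prems(2)]) blast
  note fg = Suc.prems[THEN Ck_Suc_imp_Ck]
  show ?case
    by (rule Ck_SucI[OF bounded_bilinear.FDERIV[OF B f'(1) g'(1)]
          Ck_add[OF Suc.IH[OF fg(1) g'(2)] Suc.IH[OF f'(2) fg(2)]]])
qed

text \<open>The derivative of 1/f again contains 1/f, but only to order k, so induction on k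
  closes.\<close>

lemma Ck_inverse:
  fixes f :: "'a::real_normed_vector \<Rightarrow> real"
  assumes "Ck k f" "\<And>x. f x \<noteq> 0" shows "Ck k (\<lambda>x. inverse (f x))"
  using assms(1)
proof (induction k)
  case 0 thus ?case using assms(2) by (simp add: continuous_on_inverse)
next
  case (Suc k)
  obtain f' where f': "\<And>x. (f has_derivative f' x) (at x)" "\<And>v. Ck k (\<lambda>x. f' x v)"
    by (rule Ck_SucD[OF Suc.prems]) blast
  note i = Suc.IH[OF Ck_Suc_imp_Ck[OF Suc.prems]]
  note m = Ck_bilinear[OF bounded_bilinear_mult]
  show ?case
    by (rule Ck_SucI[OF Deriv.has_derivative_inverse[OF assms(2) f'(1)]
          Ck_bounded_linear[OF bounded_linear_minus[OF bounded_linear_ident] m[OF m[OF i f'(2)] i]]])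
qed

lemma Ck_matrix_pow:
  "Ck k f \<Longrightarrow> Ck k (\<lambda>x. matrix_pow (f x) n)" for f :: "'a::real_normed_vector \<Rightarrow> complex^'n^'n"
  by (induction n) (simp_all add: Ck_const Ck_bilinear[OF bounded_bilinear_matrix_mult])

definition outer :: "complex^3 \<Rightarrow> complex^3 \<Rightarrow> complex^3^3"
  where "outer v w = (\<chi> i j. v $ i * cnj (w $ j))"

lemma bounded_bilinear_outer: "bounded_bilinear outer"
  by (intro bilinear_conv_bounded_bilinear[THEN iffD1])
    (auto simp: bilinear_def outer_def vec_eq_iff algebra_simps intro!: linearI)

definition line_projector :: "complex^3 \<Rightarrow> complex^3^3"
  where "line_projector v = inverse (v \<bullet> v) *\<^sub>R outer v v"

lemma Ck_line_projector:
  assumes "Ck k y" "\<And>x. y x \<noteq> 0" shows "Ck k (\<lambda>x. line_projector (y x))"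
  unfolding line_projector_def
  by (intro Ck_bilinear[OF bounded_bilinear_scaleR] Ck_inverse Ck_bilinear[OF bounded_bilinear_inner]
      Ck_bilinear[OF bounded_bilinear_outer] assms) (simp add: assms)

text \<open>The three charts are affine maps into nonzero vectors, so smoothness may be tested on
  any smooth nowhere vanishing lift.\<close>

lemma cp2_smoothI:
  assumes "\<And>k (y :: complex \<times> complex \<Rightarrow> complex^3). Ck k y \<Longrightarrow> (\<And>x. y x \<noteq> 0) \<Longrightarrow> Ck k (\<lambda>x. f (proj (y x)))"
  shows "cp2_smooth f"
proof -
  have c: "Ck k (\<lambda>x. fst x *\<^sub>C a + snd x *\<^sub>C b + c)" for k and a b c :: "complex^3"
    by (intro Ck_add Ck_const Ck_bounded_linear[OF _ Ck_ident] bounded_linear_compose[OF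
          bounded_bilinear.bounded_linear_left[OF bounded_bilinear_scaleC]] bounded_linear_fst bounded_linear_snd)
  have "Ck k (\<lambda>x. f (proj (fst x *\<^sub>C a + snd x *\<^sub>C b + c)))"
    if "\<And>x :: complex \<times> complex. fst x *\<^sub>C a + snd x *\<^sub>C b + c \<noteq> 0" for k a b c
    by (rule assms[OF c that])
  note this[of "axis 2 1" "axis 3 1" "axis 1 1"] this[of "axis 1 1" "axis 3 1" "axis 2 1"]
    this[of "axis 1 1" "axis 2 1" "axis 3 1"]
  moreover have e: "fst x *\<^sub>C axis 2 1 + snd x *\<^sub>C axis 3 1 + axis 1 1 = (vector [1, fst x, snd x] :: complex^3)"
    "fst x *\<^sub>C axis 1 1 + snd x *\<^sub>C axis 3 1 + axis 2 1 = (vector [fst x, 1, snd x] :: complex^3)"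
    "fst x *\<^sub>C axis 1 1 + snd x *\<^sub>C axis 2 1 + axis 3 1 = (vector [fst x, snd x, 1] :: complex^3)"
    for x :: "complex \<times> complex"
    by (simp_all add: vec_eq_iff forall_3 axis_def)
  ultimately show ?thesis
    unfolding cp2_smooth_def e case_prod_unfold by (simp add: vec_eq_iff forall_3)
qed

lemma interpolation:
  fixes \<kappa> :: "'a::field \<Rightarrow> 'a"
  assumes "finite S"
  shows "\<exists>a N. \<forall>s\<in>S. (\<Sum>k\<le>(N::nat). a k * s ^ k) = \<kappa> s"
proof -
  have "\<exists>p. \<forall>s\<in>S. poly p s = \<kappa> s"
    using assms
  proof induction
    case (insert x S)
    then obtain p where p: "\<forall>s\<in>S. poly p s = \<kappa> s" by blast
    \<comment> \<open>Newton interpolation: w vanishes at the old nodes and not at x, so a multiple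
      of it corrects the value at x alone.\<close>
    define w where "w = (\<Prod>s\<in>S. [:- s, 1:])"
    have w: "poly w y = (\<Prod>s\<in>S. y - s)" for y by (simp add: w_def poly_prod)
    have "poly w x \<noteq> 0" using insert by (auto simp: w)
    moreover have "poly w s = 0" if "s \<in> S" for s using insert that by (auto simp: w)
    ultimately have "\<forall>s\<in>insert x S. poly (p + smult ((\<kappa> x - poly p x) / poly w x) w) s = \<kappa> s"
      using p by simp
    thus ?case by blast
  qed simp
  then obtain p where "\<forall>s\<in>S. poly p s = \<kappa> s" by blast
  thus ?thesis by (intro exI[of _ "coeff p"] exI[of _ "degree p"]) (simp add: poly_altdef)
qed

section \<open>Measurability on the projective plane\<close>

text \<open>The universal property of the quotient topology.\<close>

lemma continuous_on_cp2:
  fixes f :: "cp2 \<Rightarrow> 'b::topological_space"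
  assumes "continuous_on (- {0}) (\<lambda>v. f (proj v))"
  shows "continuous_on UNIV f"
  unfolding continuous_on_open_vimage[OF open_UNIV]
proof (intro allI impI)
  fix S :: "'b set" assume "open S"
  hence "open ((\<lambda>v. f (proj v)) -` S \<inter> (- {0}))"
    using assms by (subst (asm) continuous_on_open_vimage) auto
  moreover have "(\<lambda>v. f (proj v)) -` S \<inter> (- {0}) = {v. v \<noteq> 0 \<and> proj v \<in> f -` S \<inter> UNIV}" by auto
  ultimately show "open (f -` S \<inter> UNIV)" by (simp add: open_cp2_def)
qed

lemma continuous_cp2_act:
  assumes g: "g \<in> SU3" shows "continuous_on UNIV (cp2_act g)"
  unfolding continuous_on_open_vimage[OF open_UNIV]
proof (intro allI impI)
  fix S :: "cp2 set" assume "open S"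
  hence "open ((\<lambda>v. g *v v) -` {v. v \<noteq> 0 \<and> proj v \<in> S})"
    using bounded_linear.continuous_on[OF bounded_bilinear.bounded_linear_right[OF
          bounded_bilinear_matrix_vector_mult] continuous_on_id, of UNIV g]
    by (intro open_vimage) (auto simp: open_cp2_def)
  moreover have "(\<lambda>v. g *v v) -` {v. v \<noteq> 0 \<and> proj v \<in> S} = {v. v \<noteq> 0 \<and> proj v \<in> cp2_act g -` S \<inter> UNIV}"
  proof (rule set_eqI)
    fix v :: "complex^3"
    have "g *v v = 0 \<longleftrightarrow> v = 0" using SU3_nonzero[OF g, of v] by (cases "v = 0") simp_all
    thus "v \<in> (\<lambda>v. g *v v) -` {v. v \<noteq> 0 \<and> proj v \<in> S}
        \<longleftrightarrow> v \<in> {v. v \<noteq> 0 \<and> proj v \<in> cp2_act g -` S \<inter> UNIV}"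
      by (cases "v = 0") (simp_all add: cp2_act_proj)
  qed
  ultimately show "open (cp2_act g -` S \<inter> UNIV)" by (simp add: open_cp2_def)
qed

lemma continuous_on_matrix_pow:
  "continuous_on S f \<Longrightarrow> continuous_on S (\<lambda>x. matrix_pow (f x :: complex^'n^'n) n)"
  by (induction n) (auto intro!: continuous_on_const bounded_bilinear.continuous_on[OF bounded_bilinear_matrix_mult])

lemma continuous_on_line_projector: "continuous_on (- {0}) line_projector"
  unfolding line_projector_def[abs_def]
  by (intro continuous_intros bounded_bilinear.continuous_on[OF bounded_bilinear_outer]) auto

locale invariant_measure =
  fixes M :: "cp2 measure" assumes inv: "invariant_probability M"
begin

lemma sets_M: "sets M = sets borel"
  using inv by (simp add: invariant_probability_def)

lemma finite: "finite_measure M"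
  using inv by (intro finite_measureI) (simp add: invariant_probability_def)

lemma measure_UNIV: "measure M (space M) = 1"
  using inv by (simp add: measure_def invariant_probability_def)

lemma measurable:
  fixes f :: "cp2 \<Rightarrow> 'b::topological_space"
  assumes "continuous_on UNIV f" shows "f \<in> borel_measurable M"
  using borel_measurable_continuous_onI[OF assms] measurable_cong_sets[OF sets_M refl] by blast

lemma integrable:
  fixes f :: "cp2 \<Rightarrow> 'b::euclidean_space"
  assumes "continuous_on UNIV f" "\<And>x. norm (f x) \<le> C" shows "integrable M f"
  by (rule finite_measure.integrable_const_bound[OF finite, where B = C])
    (use assms measurable in auto)

lemma integral_invariant:
  fixes f :: "cp2 \<Rightarrow> 'b::euclidean_space"
  assumes f: "continuous_on UNIV f" and g: "g \<in> SU3"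
  shows "(\<integral>x. f (cp2_act g x) \<partial>M) = (\<integral>x. f x \<partial>M)"
proof -
  have "cp2_act g \<in> measurable M M"
    using measurable[OF continuous_cp2_act[OF g]] measurable_cong_sets[OF refl sets_M] by blast
  hence "(\<integral>x. f x \<partial>distr M M (cp2_act g)) = (\<integral>x. f (cp2_act g x) \<partial>M)"
    by (intro integral_distr measurable f)
  thus ?thesis using inv g by (simp add: invariant_probability_def)
qed

end

section \<open>Coupled bases and operator kernels\<close>

lemma mexp_isotropy:
  assumes X: "X \<in> su3" "X *v axis 1 1 = 0" shows "mexp (t *\<^sub>R X) \<in> isotropy"
proof -
  have "(t *\<^sub>R X) *v axis 1 1 = 0" by (simp add: matrix_vector_scaleR_left X)
  hence "mexp (t *\<^sub>R X) *v axis 1 1 = axis 1 1" by (rule mexp_vector_fixed)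
  thus ?thesis using mexp_SU3[OF X(1)]
    by (simp add: isotropy_def vec_eq_iff forall_3 matrix_vector_mult_def sum_3 axis_def)
qed

lemma (in urep) isotropy_fixed_derivative:
  assumes X: "X \<in> su3" "X *v axis 1 1 = 0" and v: "v \<in> V" and fixd: "\<And>h. h \<in> isotropy \<Longrightarrow> \<alpha> h v = v"
  shows "d X v = 0"
  by (rule dI) (simp add: fixd mexp_isotropy[OF X])

lemma skew_part_isotropy:
  "skew_part (unit_matrix 3 2) *v axis 1 1 = 0" "skew_part ((- \<i>) *\<^sub>C unit_matrix 3 2) *v axis 1 1 = 0"
  "skew_part (unit_matrix 2 3) *v axis 1 1 = 0" "skew_part ((- \<i>) *\<^sub>C unit_matrix 2 3) *v axis 1 1 = 0"
  by (simp_all add: skew_part_def mat3_simps axis_def)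

text \<open>The skew parts of E_32 and E_23 annihilate the first axis, so they exponentiate into the
  isotropy group and the orbit of v is constant.\<close>

lemma (in urep) isotropy_fixed_U:
  assumes v: "v \<in> V" and fixd: "\<And>h. h \<in> isotropy \<Longrightarrow> \<alpha> h v = v"
  shows "U_minus \<alpha> v = 0" "U_plus \<alpha> v = 0"
proof -
  have tr: "trace (unit_matrix 3 2) = 0" "trace (unit_matrix 2 3) = 0" by (simp_all add: trace_unit_matrix)
  note z = isotropy_fixed_derivative[OF _ _ v fixd]
  show "U_minus \<alpha> v = 0" "U_plus \<alpha> v = 0"
    unfolding U_minus_def U_plus_def sl3_def
    by (simp_all only: z[OF su3_skew_part[OF tr(1)] skew_part_isotropy(1)]
        z[OF su3_skew_part[OF trace_i[OF tr(1)]] skew_part_isotropy(2)]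
        z[OF su3_skew_part[OF tr(2)] skew_part_isotropy(3)]
        z[OF su3_skew_part[OF trace_i[OF tr(2)]] skew_part_isotropy(4)]) simp_all
qed

lemma trace_cinner_self_adjoint: "dagger B = B \<Longrightarrow> trace (A ** B) = cinner B A"
  for A B :: "complex^'d^'d"
  unfolding cinner_matrix by (metis trace_mul_sym)

locale coupled =
  fixes p :: nat and P :: "nat \<times> nat"
    and \<rho> :: "complex^3^3 \<Rightarrow> complex^'d^'d"
    and e :: "weight \<Rightarrow> real \<Rightarrow> complex^'d"
    and E :: "nat \<Rightarrow> weight \<Rightarrow> real \<Rightarrow> complex^'d^'d"
  assumes P: "P = (p, 0) \<or> P = (0, p)"
    and irr: "irrep (vector_action \<rho>) UNIV P"
    and gt_e: "gt_basis (vector_action \<rho>) UNIV P e"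
    and coupled: "coupled_basis \<rho> P e E"
begin

lemma rep: "unitary_rep (vector_action \<rho>) UNIV"
  using irr by (simp add: irrep_def)

lemma size: "irrep_size P = p"
  using P by (auto simp: irrep_size_def)

lemma dim_pos: "irrep_dim P > 0"
  using P by (auto simp: irrep_dim_def add_pos_pos)

abbreviation act where "act \<equiv> operator_action \<rho>"

sublocale vec: gt "vector_action \<rho>" UNIV "fst P" "snd P" e
  by standard (simp_all add: rep gt_e)

sublocale op: urep act UNIV
  by standard (rule operator_rep[OF rep])

lemmas rho_mult = rho_mult[OF rep] and rho_unitary = rho_unitary[OF rep]
  and rho_dagger = rho_dagger[OF rep] and act_eq = operator_action_eq[OF rep]
  and act_dagger = operator_action_dagger[OF rep]

text \<open>The copy of (n,n), not the isotropy group. \<open>coupled_basis\<close> only asserts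
  that some carrier exists; its GT basis determines it as this span.\<close>

definition H :: "nat \<Rightarrow> (complex^'d^'d) set"
  where "H n = complex_vector.span {E n \<nu> J | \<nu> J. (\<nu>, J) \<in> gt_labels (n, n)}"

lemma H_irrep:
  assumes "n \<le> p"
  shows "irrep act (H n) (n, n)" "gt_basis act (H n) (n, n) (E n)"
proof -
  obtain V where "irrep act V (n, n)" "gt_basis act V (n, n) (E n)"
    using coupled assms unfolding coupled_basis_def size by blast
  moreover from this(2) have "V = H n"
    unfolding gt_basis_def Let_def H_def by blast
  ultimately show "irrep act (H n) (n, n)" "gt_basis act (H n) (n, n) (E n)" by simp_all
qed

lemma H_gt: "n \<le> p \<Longrightarrow> gt act (H n) n n (E n)"
  using H_irrep[of n] by unfold_locales (simp_all add: irrep_def)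

lemma E_orthogonal:
  "n \<le> p \<Longrightarrow> m \<le> p \<Longrightarrow> n \<noteq> m \<Longrightarrow> (\<nu>, J) \<in> gt_labels (n, n) \<Longrightarrow> (\<mu>, L) \<in> gt_labels (m, m) \<Longrightarrow>
    cinner (E n \<nu> J) (E m \<mu> L) = 0"
  using coupled unfolding coupled_basis_def size by fast

lemma H_orthogonal:
  assumes "n \<le> p" "m \<le> p" "n \<noteq> m" and A: "A \<in> H n" and B: "B \<in> H m"
  shows "cinner A B = 0"
  using A unfolding H_def
proof (induction rule: complex_vector.span_induct_alt)
  case (step c A' A)
  then obtain \<nu> J where nJ: "(\<nu>, J) \<in> gt_labels (n, n)" "A' = E n \<nu> J" by blast
  have "cinner (E n \<nu> J) B = 0"
    using B unfolding H_def
  proof (induction rule: complex_vector.span_induct_alt)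
    case (step c B' B)
    then obtain \<mu> L where "(\<mu>, L) \<in> gt_labels (m, m)" "B' = E m \<mu> L" by blast
    thus ?case using step E_orthogonal[OF assms(1,2,3) nJ(1)]
      by (simp add: cinner_add_right cinner_scaleC_right)
  qed simp
  thus ?case using step nJ by (simp add: cinner_add_left cinner_scaleC_left)
qed simp

lemma span_E: "complex_vector.span {E n \<nu> J | n \<nu> J. n \<le> p \<and> (\<nu>, J) \<in> gt_labels (n, n)} = UNIV"
  using coupled unfolding coupled_basis_def size by blast

lemma operator_eqI:
  assumes "\<And>n \<nu> J. n \<le> p \<Longrightarrow> (\<nu>, J) \<in> gt_labels (n, n) \<Longrightarrow> cinner (E n \<nu> J) A = cinner (E n \<nu> J) B"
  shows "A = B"
  by (rule cinner_eqI[OF span_E]) (use assms in auto)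

definition K0 :: "nat \<Rightarrow> complex^'d^'d" where "K0 n = E n (zero_weight n) 0"

lemma K0_eq: "K0 n = gt.b n n (E n) (int n) (int n) (int n)" if "n \<le> p"
  unfolding K0_def gt.b_def[OF H_gt[OF that]] by (simp add: zero_weight_def)

lemma zero_label: "(zero_weight n, 0) \<in> gt_labels (n, n)"
  unfolding gt_labels_def zero_weight_def by (auto intro!: exI[of _ "int n"])

lemma K0_0: "K0 0 = (1 / sqrt (irrep_dim P)) *\<^sub>R mat 1"
  using coupled unfolding coupled_basis_def K0_def zero_weight_def by simp

lemma K0_mem: "n \<le> p \<Longrightarrow> K0 n \<in> H n"
  unfolding K0_def by (intro gt.e_mem[OF H_gt] zero_label)

lemma K0_orthonormal: "n \<le> p \<Longrightarrow> m \<le> p \<Longrightarrow> cinner (K0 n) (K0 m) = (if n = m then 1 else 0)"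
  using H_orthogonal[OF _ _ _ K0_mem K0_mem, of n m]
    gt.orthonormal[OF H_gt zero_label zero_label, of n] by (auto simp: K0_def)

text \<open>The dimension formula is read off from the coupled basis: \<open>K0 0\<close> is a unit
  vector and equals the identity divided by the square root of \<open>irrep_dim P\<close>.\<close>

lemma trace_one: "trace (mat 1 :: complex^'d^'d) = of_real (irrep_dim P)"
proof -
  have "cinner (K0 0) (K0 0) = 1" using K0_orthonormal[of 0 0] by simp
  moreover have "cinner (mat 1) (mat 1 :: complex^'d^'d) = trace (mat 1 :: complex^'d^'d)"
    by (simp add: cinner_matrix)
  moreover have "of_real (1 / sqrt (irrep_dim P)) * (of_real (1 / sqrt (irrep_dim P)) * z)
      = of_real (1 / irrep_dim P) * z" for z :: complex
    unfolding mult.assoc[symmetric] of_real_mult[symmetric] using dim_pos by simp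
  ultimately have "of_real (1 / irrep_dim P) * trace (mat 1 :: complex^'d^'d) = 1"
    by (simp only: K0_0 cinner_scaleR_left cinner_scaleR_right)
  thus ?thesis using dim_pos by (simp add: field_simps)
qed

text \<open>The weight (n,n,n) is trivial on the torus, and J = 0 makes \<open>U_minus\<close> and
  \<open>U_plus\<close> vanish, so \<open>rot23\<close> acts trivially as well; these generate the
  isotropy group by \<open>isotropy_decomp\<close>.\<close>

lemma K0_isotropy:
  assumes n: "n \<le> p" and h: "h \<in> isotropy"
  shows "act h (K0 n) = K0 n"
proof -
  interpret gt act "H n" n n "E n" by (rule H_gt[OF n])
  have l: "lab n n n" by (simp add: lab_def)
  note mem0 = b_mem[OF l]
  have tor: "act (torus x y z) (K0 n) = K0 n" if "x + y + z = 0" for x y z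
  proof -
    have "int n * x + int n * y + int n * z = 0" using that by (simp flip: distrib_left)
    thus ?thesis using weight_vectorD[OF weight[OF l] that] by (simp add: K0_eq n)
  qed
  have R: "act (rot23 t) (K0 n) = K0 n" for t
  proof -
    have "d (unit_matrix 3 2 - unit_matrix 2 3) (K0 n) = (\<i> * of_real 0) *\<^sub>C K0 n"
      using skew_eq_lowering_minus_raising[OF _ mem0, of 3 2] lowering(1)[OF l] U_plus_b[OF l]
      by (simp add: K0_eq n U_minus_def U_plus_def)
    moreover have "unit_matrix 3 2 - unit_matrix 2 3 \<in> su3"
      by (simp add: su3_def dagger_diff dagger_unit_matrix trace_sub trace_unit_matrix)
    ultimately show ?thesis
      using flow_eigenvector[of "unit_matrix 3 2 - unit_matrix 2 3" "K0 n" 0 t] K0_mem[OF n]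
      by (simp add: mexp_rot23)
  qed
  obtain x y z t x' y' z' where "x + y + z = 0" "x' + y' + z' = 0"
    "h = torus x y z ** rot23 t ** torus x' y' z'"
    using h isotropy_decomp[of h thesis] unfolding isotropy_def by auto
  thus ?thesis
    by (simp add: op.mult SU3_mult torus_SU3 rot23_SU3 tor R)
qed

lemma isotropy_fixed_expand:
  assumes B: "\<And>h. h \<in> isotropy \<Longrightarrow> act h B = B"
  shows "B = (\<Sum>n\<le>p. cinner (K0 n) B *\<^sub>C K0 n)"
proof (rule operator_eqI)
  fix m \<nu> J assume m: "m \<le> p" and l: "(\<nu>, J) \<in> gt_labels (m, m)"
  interpret gt act "H m" m m "E m" by (rule H_gt[OF m])
  obtain r s k where rsk: "lab r s k" "E m \<nu> J = b r s k" by (rule basis_cases[OF l]) blast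
  have orth: "cinner (b r s k) B = 0" if "\<And>h. h \<in> isotropy \<Longrightarrow> act h B = B" "r \<noteq> s" for B
  proof (rule isotropy_fixed_orthogonal[OF _ _ rsk(1) that(2)])
    show "cinner (U_minus act w) B = 0" "cinner (U_plus act w) B = 0" for w
      using op.raising_adjoint(1)[of B w] op.raising_adjoint(3)[of B w]
        op.isotropy_fixed_U[of B] that(1) by simp_all
  qed
  show "cinner (E m \<nu> J) B = cinner (E m \<nu> J) (\<Sum>n\<le>p. cinner (K0 n) B *\<^sub>C K0 n)"
  proof (cases "r = s")
    case False
    have "cinner (b r s k) (K0 n) = 0" if "n \<le> p" for n
      by (rule orth[OF K0_isotropy[OF that] False])
    thus ?thesis using orth[OF B False] by (simp add: rsk cinner_sum_right cinner_scaleC_right)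
  next
    case True
    \<comment> \<open>In (m,m) the label inequalities s <= m <= r leave a single label with r =
      s.\<close>
    hence "r = m" "s = m" "k = m" using rsk(1) by (auto simp: lab_def)
    hence "E m \<nu> J = K0 m" using rsk(2) by (simp add: K0_eq m)
    moreover have "(\<Sum>n\<le>p. cinner (K0 n) B * cinner (K0 m) (K0 n)) = (\<Sum>n\<le>p. if n = m then cinner (K0 m) B else 0)"
      using m by (intro sum.cong) (auto simp: K0_orthonormal)
    ultimately show ?thesis using m by (simp add: cinner_sum_right cinner_scaleC_right)
  qed
qed

subsection \<open>Isotropy-fixed operators are diagonal in the GT basis\<close>

text \<open>One of the two parameters is frozen: s = 0 for (p,0) and r = p for (0,p). Hence all
  weights of P are simple.\<close>

lemma label_weight_inj:
  fixes r s k r' s' k' :: int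
  assumes "vec.lab r s k" "vec.lab r' s' k'"
    and "(int (fst P) + 2 * int (snd P) - (r + s)) - (r + s - k) = (int (fst P) + 2 * int (snd P) - (r' + s')) - (r' + s' - k')"
    and "(r + s - k) - k = (r' + s' - k') - k'"
  shows "r = r' \<and> s = s' \<and> k = k'"
  using P assms unfolding vec.lab_def by auto

lemma isotropy_fixed_commute:
  assumes K: "\<And>h. h \<in> isotropy \<Longrightarrow> act h K = K" and h: "h \<in> isotropy"
  shows "\<rho> h ** K = K ** \<rho> h"
proof -
  have S: "h \<in> SU3" using h by (simp add: isotropy_def)
  have "\<rho> h ** K = \<rho> h ** K ** (dagger (\<rho> h) ** \<rho> h)" by (simp add: rho_unitary[OF S])
  also have "\<dots> = act h K ** \<rho> h" by (simp add: act_eq[OF S] matrix_mul_assoc)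
  finally show ?thesis using K[OF h] by simp
qed

lemma torus_isotropy: "x + y + z = 0 \<Longrightarrow> torus x y z \<in> isotropy"
  by (simp add: isotropy_def torus_SU3) (simp add: torus_def diag3_def)

text \<open>K commutes with the torus, so it preserves weights, and by
  \<open>label_weight_inj\<close> different labels have different weights.\<close>

lemma isotropy_fixed_diagonal:
  assumes K: "\<And>h. h \<in> isotropy \<Longrightarrow> act h K = K" and l: "vec.lab r s k"
  shows "K *v vec.b r s k = cinner (vec.b r s k) (K *v vec.b r s k) *\<^sub>C vec.b r s k"
proof (rule vec.basis_eqI)
  let ?v = "vec.b r s k"
  have w: "vec.weight_vector (int (fst P) + 2 * int (snd P) - (r + s)) (r + s - k) k (K *v ?v)"
    unfolding vec.weight_vector_def
  proof safe
    fix x y z :: real assume xyz: "x + y + z = 0"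
    have "\<rho> (torus x y z) *v (K *v ?v) = K *v (\<rho> (torus x y z) *v ?v)"
      by (simp add: matrix_vector_mul_assoc isotropy_fixed_commute[OF K torus_isotropy[OF xyz]])
    thus "vector_action \<rho> (torus x y z) (K *v ?v) = cis (of_int (int (fst P) + 2 * int (snd P) - (r + s)) * x
        + of_int (r + s - k) * y + of_int k * z) *\<^sub>C (K *v ?v)"
      using vec.weight_vectorD[OF vec.weight[OF l] xyz]
      by (simp add: vector_action_def matrix_vector_scaleC_right)
  qed
  fix r' s' k' assume l': "vec.lab r' s' k'"
  show "cinner (vec.b r' s' k') (K *v ?v) = cinner (vec.b r' s' k') (cinner ?v (K *v ?v) *\<^sub>C ?v)"
  proof (cases "r' = r \<and> s' = s \<and> k' = k")
    case False
    have "cinner (vec.b r' s' k') (K *v ?v) = 0"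
      by (rule vec.weight_vector_orthogonal[OF _ _ vec.weight[OF l'] w])
        (use label_weight_inj[OF l' l] False in auto)
    thus ?thesis using False by (auto simp: cinner_scaleC_right vec.b_orthonormal[OF l' l])
  qed (auto simp: cinner_scaleC_right vec.b_orthonormal[OF l l])
qed simp_all

lemma dual_label:
  assumes "(\<nu>, J) \<in> gt_labels P"
  shows "(dual_weight P \<nu>, J) \<in> gt_labels (irrep_dual P)"
proof -
  obtain a c where Pac: "P = (a, c)" by force
  obtain r s k where "0 \<le> s" "s \<le> int c" "int c \<le> r" "r \<le> int a + int c" "s \<le> k" "k \<le> r"
    "\<nu> = (int a + 2 * int c - (r + s), r + s - k, k)" "J = real_of_int (r - s) / 2"
    using assms unfolding Pac gt_labels_def by auto
  note * = this
  show ?thesis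
    unfolding Pac gt_labels_def irrep_dual_def mem_Collect_eq case_prod_conv
    \<comment> \<open>Duality reflects all parameters in a + c and thereby exchanges the roles of r
      and s.\<close>
    by (rule exI[of _ "int a + int c - s"], rule exI[of _ "int a + int c - r"],
        rule exI[of _ "int a + int c - k"]) (use * in \<open>auto simp: dual_weight_def irrep_size_def\<close>)
qed

lemma cinner_tensor: "cinner (tensor v (covector w)) A = cinner v (A *v w)"
  unfolding cinner_vec_def tensor_def covector_def cinner_complex_def matrix_vector_mult_def
  by (simp add: sum_distrib_left mult_ac)

text \<open>For the dual label of \<nu> the induced dual vector is the covector of e \<nu> J up to
  sign, so the corresponding Clebsch-Gordan coefficient is this diagonal entry up to sign.\<close>

lemma K0_diagonal_real:
  assumes n: "n \<le> p" and l: "(\<nu>, J) \<in> gt_labels P"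
  shows "cinner (e \<nu> J) (K0 n *v e \<nu> J) \<in> \<real>"
proof -
  obtain n1 n2 n3 where \<nu>: "\<nu> = (n1, n2, n3)" by (cases \<nu>)
  define \<epsilon> :: complex where "\<epsilon> = (- 1) powi (n1 - n3)"
  have \<epsilon>: "\<epsilon> = 1 \<or> \<epsilon> = -1"
    unfolding \<epsilon>_def by (cases "even (n1 - n3)") (simp_all add: power_int_minus_left)
  have "dual_gt P e (dual_weight P \<nu>) J = \<epsilon> *\<^sub>C covector (e \<nu> J)"
    by (simp add: dual_gt_def dual_weight_def \<nu> \<epsilon>_def)
  hence "tensor (e \<nu> J) (dual_gt P e (dual_weight P \<nu>) J) = \<epsilon> *\<^sub>C tensor (e \<nu> J) (covector (e \<nu> J))"
    by (simp add: tensor_def vec_eq_iff)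
  moreover have "cinner (tensor (e \<nu> J) (dual_gt P e (dual_weight P \<nu>) J)) (K0 n) \<in> \<real>"
    using coupled l dual_label[OF l] zero_label n unfolding coupled_basis_def size K0_def by fast
  ultimately have "cnj \<epsilon> * cinner (e \<nu> J) (K0 n *v e \<nu> J) \<in> \<real>"
    by (simp add: cinner_scaleC_left cinner_tensor)
  thus ?thesis using \<epsilon> by auto
qed

lemma K0_self_adjoint:
  assumes n: "n \<le> p" shows "dagger (K0 n) = K0 n"
proof -
  have "dagger (K0 n) *v v = K0 n *v v" for v
  proof (rule vec.linear_eqI[of "\<lambda>v. dagger (K0 n) *v v" "\<lambda>v. K0 n *v v"])
    fix r s k assume l: "vec.lab r s k"
    show "dagger (K0 n) *v vec.b r s k = K0 n *v vec.b r s k"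
    proof (rule vec.basis_eqI)
      fix r' s' k' assume l': "vec.lab r' s' k'"
      have dg: "K0 n *v vec.b r s k = cinner (vec.b r s k) (K0 n *v vec.b r s k) *\<^sub>C vec.b r s k"
        if "vec.lab r s k" for r s k
        by (rule isotropy_fixed_diagonal[OF _ that]) (rule K0_isotropy[OF n])
      have re: "cnj (cinner (vec.b r s k) (K0 n *v vec.b r s k)) = cinner (vec.b r s k) (K0 n *v vec.b r s k)"
        using K0_diagonal_real[OF n, of _ "real_of_int (r - s) / 2"] vec.lab_gt[OF l]
        unfolding vec.b_def by (simp add: Reals_cnj_iff)
      have "cinner (vec.b r' s' k') (dagger (K0 n) *v vec.b r s k)
          = cinner (K0 n *v vec.b r' s' k') (vec.b r s k)"
        by (simp add: cinner_matrix_vector)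
      also have "\<dots> = cinner (vec.b r' s' k') (K0 n *v vec.b r s k)"
      proof -
        obtain \<kappa> where \<kappa>: "K0 n *v vec.b r s k = \<kappa> *\<^sub>C vec.b r s k" "cnj \<kappa> = \<kappa>"
          using dg[OF l] re by blast
        obtain \<kappa>' where \<kappa>': "K0 n *v vec.b r' s' k' = \<kappa>' *\<^sub>C vec.b r' s' k'"
          using dg[OF l'] by blast
        show ?thesis
        proof (cases "r' = r \<and> s' = s \<and> k' = k")
          case True
          thus ?thesis using \<kappa> by (simp add: cinner_scaleC_left cinner_scaleC_right)
        next
          case False
          thus ?thesis
            by (auto simp: \<kappa>(1) \<kappa>' cinner_scaleC_left cinner_scaleC_right vec.b_orthonormal l l')
        qed
      qed
      finally show "cinner (vec.b r' s' k') (dagger (K0 n) *v vec.b r s k)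
          = cinner (vec.b r' s' k') (K0 n *v vec.b r s k)" .
    qed simp_all
  qed (simp_all add: matrix_vector_right_distrib matrix_vector_scaleC_right)
  thus ?thesis by (simp add: matrix_eq)
qed

end

context coupled
begin

subsection \<open>The kernel as a polynomial in the moment map\<close>

definition DX :: "complex^3^3 \<Rightarrow> complex^'d^'d"
  where "DX X = matrix (vec.d X)"

lemma DX: assumes X: "X \<in> su3" shows "DX X *v v = vec.d X v"
proof -
  have "Vector_Spaces.linear (*s) (*s) (vec.d X)"
  proof (unfold_locales)
    show "vec.d X (a + b) = vec.d X a + vec.d X b" for a b by (rule vec.d_add_right[OF X]) auto
    have "c *s x = c *\<^sub>C x" for c and x :: "complex^'d" by (simp add: vec_eq_iff)
    thus "vec.d X (r *s b) = r *s vec.d X b" for r b using vec.d_scaleC_right[OF X, of b r] by simp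
  qed
  thus ?thesis unfolding DX_def by (rule matrix_works)
qed

lemma DX_conj:
  assumes X: "X \<in> su3" and g: "g \<in> SU3"
  shows "DX (g ** X ** dagger g) = \<rho> g ** DX X ** dagger (\<rho> g)"
proof -
  have "DX (g ** X ** dagger g) *v v = (\<rho> g ** DX X ** dagger (\<rho> g)) *v v" for v
  proof -
    have "v = \<rho> g *v (dagger (\<rho> g) *v v)"
      by (simp add: matrix_vector_mul_assoc rho_unitary[OF g])
    hence "DX (g ** X ** dagger g) *v v = vec.d (g ** X ** dagger g) (vector_action \<rho> g (dagger (\<rho> g) *v v))"
      by (simp add: DX[OF su3_conj[OF X g]] vector_action_def)
    also have "\<dots> = \<rho> g *v (DX X *v (dagger (\<rho> g) *v v))"
      using vec.d_conj[OF X g UNIV_I, of "dagger (\<rho> g) *v v"] by (simp add: vector_action_def DX[OF X])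
    finally show ?thesis by (simp add: matrix_vector_mul_assoc matrix_mul_assoc)
  qed
  thus ?thesis by (simp add: matrix_eq)
qed

text \<open>Turns the derived representation into a linear map on all 3x3 matrices, so that it can
  be composed with the smooth map \<open>moment\<close> without tracking membership in
  su(3).\<close>

lemma DX_linear_extension:
  obtains L where "linear L" "\<And>X. X \<in> su3 \<Longrightarrow> L X = DX X"
proof -
  have sub: "subspace su3"
    by (rule subspaceI) (auto simp: su3_0 su3_add su3_scaleR)
  obtain B where B: "B \<subseteq> su3" "independent B" "span B = su3"
    by (metis basis_exists span_eq_iff sub span_minimal subset_antisym)
  obtain L where L: "linear L" "\<forall>x\<in>B. L x = DX x"
    using linear_independent_extend[OF B(2)] by blast
  have "X \<in> su3 \<and> L X = DX X" if "X \<in> span B" for X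
    using that
  proof (induction rule: span_induct_alt)
    case base
    thus ?case using linear_0[OF L(1)] DX[OF su3_0] vec.d_zero_left by (simp add: su3_0 matrix_eq)
  next
    case (step c x y)
    have x: "x \<in> su3" "L x = DX x" using step B L by auto
    have "DX (c *\<^sub>R x + y) = c *\<^sub>R DX x + DX y"
      using x step by (simp add: matrix_eq DX su3_add su3_scaleR vec.d_add_left vec.d_scaleR_left
          matrix_vector_mult_add_rdistrib matrix_vector_scaleR_left)
    thus ?case using x step by (simp add: linear_add[OF L(1)] linear_cmul[OF L(1)] su3_add su3_scaleR)
  qed
  thus ?thesis using that L(1) B(3) by blast
qed

text \<open>Both skew parts of E_32 generate flows inside the isotropy group, with which K commutes;
  differentiate and extend complex linearly.\<close>

lemma isotropy_fixed_U_minus_commute: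
  assumes K: "\<And>h. h \<in> isotropy \<Longrightarrow> act h K = K"
  shows "U_minus (vector_action \<rho>) (K *v v) = K *v U_minus (vector_action \<rho>) v"
proof -
  have *: "vec.d X (K *v v) = K *v vec.d X v" if X: "X \<in> su3" "X *v axis 1 1 = 0" for X
  proof (rule vec.dI)
    have "vector_action \<rho> (mexp (t *\<^sub>R X)) (K *v v) = K *v vector_action \<rho> (mexp (t *\<^sub>R X)) v" for t
      by (simp add: vector_action_def matrix_vector_mul_assoc isotropy_fixed_commute[OF K] mexp_isotropy[OF X])
    moreover have "((\<lambda>t. K *v vector_action \<rho> (mexp (t *\<^sub>R X)) v) has_vector_derivative K *v vec.d X v) (at 0)"
      by (intro bounded_linear.has_vector_derivative[OF bounded_bilinear.bounded_linear_right[OF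
            bounded_bilinear_matrix_vector_mult]] vec.flow_derivative_0 X) simp
    ultimately show "((\<lambda>t. vector_action \<rho> (mexp (t *\<^sub>R X)) (K *v v)) has_vector_derivative K *v vec.d X v) (at 0)"
      by simp
  qed
  have tr: "trace (unit_matrix 3 2) = 0" by (simp add: trace_unit_matrix)
  show ?thesis
    unfolding U_minus_def vec.sl3_def
    by (simp only: *[OF su3_skew_part[OF tr] skew_part_isotropy(1)]
        *[OF su3_skew_part[OF vec.trace_i[OF tr]] skew_part_isotropy(2)]
        matrix_vector_right_distrib matrix_vector_scaleC_right)
qed

text \<open>By \<open>isotropy_fixed_U_minus_commute\<close> the eigenvalues of \<open>K\<close> are constant along the
  \<open>U_minus\<close>-strings; for \<open>P = (p, 0)\<close> or \<open>P = (0, p)\<close> these are the eigenspaces of \<open>DX (torus_gen 2 (-1) (-1))\<close>,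
  so that \<open>K\<close> is a polynomial in that operator.\<close>

lemma isotropy_fixed_polynomial:
  assumes K: "\<And>h. h \<in> isotropy \<Longrightarrow> act h K = K"
  shows "\<exists>a N. K = (\<Sum>k\<le>(N::nat). a k *\<^sub>C matrix_pow (DX (torus_gen 2 (-1) (-1))) k)"
proof -
  define \<kappa> where "\<kappa> r s k = cinner (vec.b r s k) (K *v vec.b r s k)" for r s k
  have dg: "K *v vec.b r s k = \<kappa> r s k *\<^sub>C vec.b r s k" if "vec.lab r s k" for r s k
    unfolding \<kappa>_def by (rule isotropy_fixed_diagonal[OF K that])
  have string: "\<kappa> r s k = \<kappa> r s s" if l: "vec.lab r s k" for r s k
  proof -
    have "s \<le> k" "k \<le> r" using l by (auto simp: vec.lab_def)
    thus ?thesis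
    proof (induction k rule: int_ge_induct)
      case (step k)
      have l': "vec.lab r s k" "vec.lab r s (k + 1)" using step l by (auto simp: vec.lab_def)
      let ?c = "sqrt (real_of_int ((r - k) * (k - s + 1)))"
      have c: "?c \<noteq> 0" using vec.coeff_pos(1)[OF l'(1)] step by simp
      have "?c *\<^sub>R (\<kappa> r s (k + 1) *\<^sub>C vec.b r s (k + 1)) = K *v U_minus (vector_action \<rho>) (vec.b r s k)"
        by (simp add: vec.lowering(1)[OF l'(1)] matrix_vector_scaleR_right dg[OF l'(2)])
      also have "\<dots> = U_minus (vector_action \<rho>) (\<kappa> r s k *\<^sub>C vec.b r s k)"
        by (simp add: isotropy_fixed_U_minus_commute[OF K, symmetric] dg[OF l'(1)])
      also have "\<dots> = \<kappa> r s k *\<^sub>C ?c *\<^sub>R vec.b r s (k + 1)"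
        unfolding U_minus_def
        by (simp add: vec.sl3_scaleC_right trace_unit_matrix vec.lowering(1)[OF l'(1), unfolded U_minus_def])
      finally have "?c *\<^sub>R ((\<kappa> r s (k + 1) - \<kappa> r s k) *\<^sub>C vec.b r s (k + 1)) = 0"
        by (simp add: complex_vector.scale_left_diff_distrib scaleC_scaleR scaleR_scaleC scaleR_diff_right mult.commute)
      hence "(\<kappa> r s (k + 1) - \<kappa> r s k) *\<^sub>C vec.b r s (k + 1) = 0" using c by simp
      moreover have "vec.b r s (k + 1) \<noteq> 0"
        using vec.b_orthonormal[OF l'(2) l'(2)] by auto
      ultimately have "\<kappa> r s (k + 1) = \<kappa> r s k" by simp
      thus ?case using step by simp
    qed simp
  qed
  define Y where "Y = torus_gen 2 (-1) (-1)"
  have Y: "Y \<in> su3" unfolding Y_def by (rule torus_gen_su3) simp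
  \<comment> \<open>The pairing of the weight with (2,-1,-1) is 2 \<nu>_1 - \<nu>_2 - \<nu>_3, which
    depends on r + s only.\<close>
  define \<eta> :: "int \<Rightarrow> complex"
    where "\<eta> t = \<i> * of_int (2 * (int (fst P) + 2 * int (snd P)) - 3 * t)" for t
  have \<eta>_inj: "\<eta> t = \<eta> t' \<longleftrightarrow> t = t'" for t t' unfolding \<eta>_def by (simp only: mult_cancel_left of_int_eq_iff) simp
  have YV: "DX Y *v vec.b r s k = \<eta> (r + s) *\<^sub>C vec.b r s k" if l: "vec.lab r s k" for r s k
  proof -
    have "vec.d Y (vec.b r s k) = (\<i> * of_real (of_int (int (fst P) + 2 * int (snd P) - (r + s)) * 2
        + of_int (r + s - k) * (-1) + of_int k * (-1))) *\<^sub>C vec.b r s k"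
      unfolding Y_def by (rule vec.weight_vector_torus_gen[OF _ vec.weight[OF l]]) simp_all
    also have "(\<i> * of_real (of_int (int (fst P) + 2 * int (snd P) - (r + s)) * 2
        + of_int (r + s - k) * (-1) + of_int k * (-1))) = \<eta> (r + s)"
      by (simp add: \<eta>_def algebra_simps)
    finally show ?thesis by (simp add: DX[OF Y])
  qed
  have "\<exists>c. \<forall>r s k. vec.lab r s k \<longrightarrow> \<eta> (r + s) = z \<longrightarrow> \<kappa> r s k = c" for z
  proof (cases "\<exists>r s k. vec.lab r s k \<and> \<eta> (r + s) = z")
    case True
    then obtain r s k where l: "vec.lab r s k" "\<eta> (r + s) = z" by blast
    have "\<kappa> r' s' k' = \<kappa> r s s" if l': "vec.lab r' s' k'" "\<eta> (r' + s') = z" for r' s' k'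
    proof -
      have "\<eta> (r' + s') = \<eta> (r + s)" using l l' by simp
      hence "r' + s' = r + s" by (simp only: \<eta>_inj)
      hence "r' = r" "s' = s" using P l l' unfolding vec.lab_def by auto
      thus ?thesis using string[OF l'(1)] by simp
    qed
    thus ?thesis by blast
  qed blast
  then obtain \<kappa>' where \<kappa>': "\<And>r s k. vec.lab r s k \<Longrightarrow> \<kappa> r s k = \<kappa>' (\<eta> (r + s))" by metis
  \<comment> \<open>The interval contains every r + s occurring in a label of P.\<close>
  obtain a N where a: "\<And>z. z \<in> \<eta> ` {0..2 * int p} \<Longrightarrow> (\<Sum>k\<le>(N::nat). a k * z ^ k) = \<kappa>' z"
    using interpolation[of "\<eta> ` {0..2 * int p}" \<kappa>'] by blast
  have pow: "matrix_pow A n *v v = (c ^ n) *\<^sub>C v" if "A *v v = c *\<^sub>C v" for A :: "complex^'d^'d" and v c n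
  proof (induction n)
    case (Suc n)
    thus ?case using that by (simp add: matrix_vector_mul_assoc[symmetric] matrix_vector_scaleC_right mult.commute)
  qed simp
  let ?F = "\<Sum>k\<le>N. a k *\<^sub>C matrix_pow (DX Y) k"
  have "K *v v = ?F *v v" for v
  proof (rule vec.linear_eqI[of "\<lambda>v. K *v v" "\<lambda>v. ?F *v v"])
    fix r s k assume l: "vec.lab r s k"
    have "?F *v vec.b r s k = (\<Sum>k\<le>N. a k * \<eta> (r + s) ^ k) *\<^sub>C vec.b r s k"
    proof -
      have "(\<Sum>k\<le>N. a k *\<^sub>C matrix_pow (DX Y) k) *v u = (\<Sum>k\<le>N. (a k *\<^sub>C matrix_pow (DX Y) k) *v u)" for u
        by (rule bounded_bilinear.sum_left[OF bounded_bilinear_matrix_vector_mult])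
      thus ?thesis
        by (simp add: matrix_vector_scaleC_left pow[OF YV[OF l]] complex_vector.scale_sum_left)
    qed
    also have "(\<Sum>k\<le>N. a k * \<eta> (r + s) ^ k) = \<kappa> r s k"
      unfolding \<kappa>'[OF l] by (rule a) (use l P in \<open>auto simp: vec.lab_def\<close>)
    finally show "K *v vec.b r s k = ?F *v vec.b r s k" using dg[OF l] by simp
  qed (simp_all add: matrix_vector_right_distrib matrix_vector_scaleC_right)
  hence "K = ?F" by (simp add: matrix_eq)
  thus ?thesis unfolding Y_def by blast
qed

definition moment :: "complex^3 \<Rightarrow> complex^3^3"
  where "moment v = \<i> *\<^sub>C (3 *\<^sub>R line_projector v - mat 1)"

text \<open>The diagonal generator is the moment of the first axis, and rank-one projectors
  transform by conjugation. The left side does not involve g, so any g over the point may be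
  used.\<close>

lemma moment_SU3:
  assumes "v \<noteq> 0" "g *v axis 1 1 = (1 / norm v) *\<^sub>R v" and g: "g \<in> SU3"
  shows "moment v = g ** torus_gen 2 (-1) (-1) ** dagger g"
proof -
  have 1: "torus_gen 2 (-1) (-1) = \<i> *\<^sub>C (3 *\<^sub>R outer (axis 1 1) (axis 1 1) - mat 1)"
    by (simp add: torus_gen_def diag3_def mat3_simps outer_def axis_def scaleR_conv_of_real[where 'a = complex])
  have 2: "g ** outer u u ** dagger g = outer (g *v u) (g *v u)" for u
    by (simp add: outer_def vec_eq_iff matrix_matrix_mult_def matrix_vector_mult_def
        sum_distrib_left sum_distrib_right sum_3 algebra_simps)
  have "line_projector v = outer (g *v axis 1 1) (g *v axis 1 1)"
    unfolding assms(2) line_projector_def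
    using bounded_bilinear.scaleR_left[OF bounded_bilinear_outer]
      bounded_bilinear.scaleR_right[OF bounded_bilinear_outer]
    by (simp add: dot_square_norm power2_eq_square divide_inverse)
  also have "\<dots> = g ** outer (axis 1 1) (axis 1 1) ** dagger g" by (simp add: 2)
  finally show ?thesis
    unfolding moment_def 1
    by (simp add: matrix_scaleC_left matrix_scaleC_right matrix_scaleR_left matrix_scaleR_right
        bounded_bilinear.diff_left[OF bounded_bilinear_matrix_mult]
        bounded_bilinear.diff_right[OF bounded_bilinear_matrix_mult] SU3_inverse[OF g])
qed

lemma kernel_at_base:
  assumes K: "\<And>h. h \<in> isotropy \<Longrightarrow> act h K = K" and g: "g \<in> SU3"
  shows "kernel_at \<rho> K (cp2_act g base_point) = act g K"
  unfolding kernel_at_def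
proof (rule descend_eq[OF _ g])
  fix g h assume "g \<in> SU3" "h \<in> isotropy"
  thus "act (g ** h) K = act g K" using K[of h] by (simp add: op.mult isotropy_def)
qed

lemma kernel_at_formula:
  assumes K: "\<And>h. h \<in> isotropy \<Longrightarrow> act h K = K"
  obtains a N L where "bounded_linear L"
    "\<And>v. v \<noteq> 0 \<Longrightarrow> kernel_at \<rho> K (proj v) = (\<Sum>k\<le>(N::nat). a k *\<^sub>C matrix_pow (L (moment v)) k)"
proof -
  obtain a N where a: "K = (\<Sum>k\<le>(N::nat). a k *\<^sub>C matrix_pow (DX (torus_gen 2 (-1) (-1))) k)"
    using isotropy_fixed_polynomial[OF K] by blast
  obtain L where L: "linear L" "\<And>X. X \<in> su3 \<Longrightarrow> L X = DX X"
    by (rule DX_linear_extension) blast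
  define Y where "Y = torus_gen 2 (-1) (-1)"
  have Y: "Y \<in> su3" unfolding Y_def by (rule torus_gen_su3) simp
  have "kernel_at \<rho> K (proj v) = (\<Sum>k\<le>N. a k *\<^sub>C matrix_pow (L (moment v)) k)" if v: "v \<noteq> 0" for v
  proof -
    obtain g where g: "g \<in> SU3" "cp2_act g base_point = proj v" "g *v axis 1 1 = (1 / norm v) *\<^sub>R v"
      using cp2_transitive[OF v] by blast
    have "L (moment v) = \<rho> g ** DX Y ** dagger (\<rho> g)"
      using L(2)[OF su3_conj[OF Y g(1)]] DX_conj[OF Y g(1)] by (simp add: moment_SU3[OF v g(3,1)] Y_def)
    moreover have "matrix_pow (\<rho> g ** A ** dagger (\<rho> g)) k = \<rho> g ** matrix_pow A k ** dagger (\<rho> g)" for A k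
      using matrix_pow_conj[OF rho_unitary(1)[OF g(1)]] rho_unitary(2)[OF g(1)] by (cases k) simp_all
    ultimately have "(\<Sum>k\<le>N. a k *\<^sub>C matrix_pow (L (moment v)) k)
        = (\<Sum>k\<le>N. \<rho> g ** (a k *\<^sub>C matrix_pow (DX Y) k) ** dagger (\<rho> g))"
      by (simp add: matrix_scaleC_left matrix_scaleC_right)
    also have "\<dots> = act g K"
      unfolding act_eq[OF g(1)]
      by (subst a) (simp add: Y_def bounded_bilinear.sum_left[OF bounded_bilinear_matrix_mult]
          bounded_bilinear.sum_right[OF bounded_bilinear_matrix_mult])
    finally show ?thesis using kernel_at_base[OF K g(1)] g(2) by simp
  qed
  thus ?thesis using that L(1) linear_conv_bounded_linear by blast
qed

lemma kernel_smooth: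
  assumes K: "\<And>h. h \<in> isotropy \<Longrightarrow> act h K = K" and T: "bounded_linear T"
  shows "cp2_smooth (\<lambda>x. T (kernel_at \<rho> K x))"
proof (rule cp2_smoothI)
  obtain a N L where L: "bounded_linear L"
    "\<And>v. v \<noteq> 0 \<Longrightarrow> kernel_at \<rho> K (proj v) = (\<Sum>k\<le>(N::nat). a k *\<^sub>C matrix_pow (L (moment v)) k)"
    by (rule kernel_at_formula[OF K]) blast+
  fix k and y :: "complex \<times> complex \<Rightarrow> complex^3"
  assume y: "Ck k y" "\<And>x. y x \<noteq> 0"
  have "Ck k (\<lambda>x. moment (y x))"
    unfolding moment_def diff_conv_add_uminus
    by (intro Ck_bounded_linear[OF bounded_linear_scaleC_right] Ck_add Ck_const
        Ck_bounded_linear[OF bounded_linear_scaleR_right] Ck_line_projector y)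
  hence "Ck k (\<lambda>x. T (\<Sum>k\<le>N. a k *\<^sub>C matrix_pow (L (moment (y x))) k))"
    by (intro Ck_bounded_linear[OF T] Ck_sum Ck_bounded_linear[OF bounded_linear_scaleC_right]
        Ck_matrix_pow Ck_bounded_linear[OF L(1)])
  thus "Ck k (\<lambda>x. T (kernel_at \<rho> K (proj (y x))))" by (simp add: L(2) y(2))
qed

lemma kernel_continuous:
  assumes K: "\<And>h. h \<in> isotropy \<Longrightarrow> act h K = K"
  shows "continuous_on UNIV (kernel_at \<rho> K)"
proof (rule continuous_on_cp2)
  obtain a N L where L: "bounded_linear L"
    "\<And>v. v \<noteq> 0 \<Longrightarrow> kernel_at \<rho> K (proj v) = (\<Sum>k\<le>(N::nat). a k *\<^sub>C matrix_pow (L (moment v)) k)"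
    by (rule kernel_at_formula[OF K]) blast+
  have "continuous_on (- {0}) moment"
    unfolding moment_def[abs_def]
    by (intro bounded_linear.continuous_on[OF bounded_linear_scaleC_right] continuous_intros
        continuous_on_line_projector)
  hence "continuous_on (- {0}) (\<lambda>v. \<Sum>k\<le>N. a k *\<^sub>C matrix_pow (L (moment v)) k)"
    by (intro continuous_on_sum bounded_linear.continuous_on[OF bounded_linear_scaleC_right]
        continuous_on_matrix_pow bounded_linear.continuous_on[OF L(1)])
  thus "continuous_on (- {0}) (\<lambda>v. kernel_at \<rho> K (proj v))"
    by (rule continuous_on_eq) (simp add: L(2))
qed

subsection \<open>Highest weight vectors and invariant subspaces\<close>

definition hw :: "nat \<Rightarrow> complex^'d^'d"
  where "hw n = gt.b n n (E n) (int n) 0 0"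

lemma hw_mem: "n \<le> p \<Longrightarrow> hw n \<in> H n"
  unfolding hw_def by (intro gt.b_mem[OF H_gt] gt.lab_hw[OF H_gt])

lemma hw_norm: "n \<le> p \<Longrightarrow> cinner (hw n) (hw n) = 1"
  unfolding hw_def by (simp add: gt.b_orthonormal[OF H_gt gt.lab_hw[OF H_gt] gt.lab_hw[OF H_gt]])

lemma hw_raising: "n \<le> p \<Longrightarrow> T_plus act (hw n) = 0" "n \<le> p \<Longrightarrow> U_plus act (hw n) = 0"
  using gt.highest_weight[OF H_gt, of n] unfolding hw_def highest_weight_vector_def by simp_all

lemma hw_weight: "n \<le> p \<Longrightarrow> op.weight_vector (2 * int n) (int n) 0 (hw n)"
  using op.highest_weight_vector_weight[OF _ gt.highest_weight[OF H_gt], of n] unfolding hw_def by simp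

text \<open>A vector killed by both raising operators is orthogonal to everything obtained by
  lowering, so only the vectors \<open>hw m\<close> can contribute; the weight excludes m different
  from n.\<close>

lemma hw_unique:
  assumes n: "n \<le> p" and v: "T_plus act v = 0" "U_plus act v = 0"
    "op.weight_vector (2 * int n) (int n) 0 v"
  shows "v = cinner (hw n) v *\<^sub>C hw n"
proof (rule operator_eqI)
  have gen: "cinner (E m \<nu> J) v = 0"
    if m: "m \<le> p" and l: "(\<nu>, J) \<in> gt_labels (m, m)" and ne: "\<not> (m = n \<and> E m \<nu> J = hw n)"
      and v: "T_plus act v = 0" "U_plus act v = 0" "op.weight_vector (2 * int n) (int n) 0 v" for m \<nu> J v
  proof -
    interpret gt act "H m" m m "E m" by (rule H_gt[OF m])
    obtain r s k where rsk: "lab r s k" "E m \<nu> J = b r s k" by (rule basis_cases[OF l]) blast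
    show ?thesis
    proof (cases "r = int m \<and> s = 0 \<and> k = 0")
      case False
      show ?thesis unfolding rsk
      proof (rule highest_weight_orthogonal[OF _ _ rsk(1) False])
        show "cinner (T_minus act w) v = 0" "cinner (U_minus act w) v = 0" for w
          using op.raising_adjoint(1,2)[of v w] v(1,2) by simp_all
      qed
    next
      case True
      hence "E m \<nu> J = hw m" by (simp add: rsk hw_def)
      moreover from this ne have "m \<noteq> n" by auto
      ultimately show ?thesis
        using op.weight_vector_orthogonal[OF _ _ hw_weight[OF m] v(3)] by simp
    qed
  qed
  fix m \<nu> J assume m: "m \<le> p" and l: "(\<nu>, J) \<in> gt_labels (m, m)"
  show "cinner (E m \<nu> J) v = cinner (E m \<nu> J) (cinner (hw n) v *\<^sub>C hw n)"
  proof (cases "m = n \<and> E m \<nu> J = hw n")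
    case True
    hence eq: "E m \<nu> J = hw n" ..
    show ?thesis unfolding eq by (simp add: cinner_scaleC_right hw_norm[OF n])
  next
    case False
    thus ?thesis
      using gen[OF m l False v] gen[OF m l False hw_raising(1)[OF n] hw_raising(2)[OF n] hw_weight[OF n]]
      by (simp add: cinner_scaleC_right)
  qed
qed

lemma invariant_subspace_rep:
  assumes "complex_vector.subspace N" "\<And>g A. g \<in> SU3 \<Longrightarrow> A \<in> N \<Longrightarrow> act g A \<in> N"
  shows "urep act N"
  using operator_rep[OF rep] assms unfolding urep_def unitary_rep_def by blast

definition perp :: "(complex^'d^'d) set \<Rightarrow> (complex^'d^'d) set"
  where "perp N = {B. \<forall>A\<in>N. cinner A B = 0}"

lemma perp_invariant:
  assumes "\<And>g A. g \<in> SU3 \<Longrightarrow> A \<in> N \<Longrightarrow> act g A \<in> N"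
  shows "complex_vector.subspace (perp N)" "g \<in> SU3 \<Longrightarrow> B \<in> perp N \<Longrightarrow> act g B \<in> perp N"
proof -
  show "complex_vector.subspace (perp N)"
    unfolding perp_def by (rule complex_vector.subspaceI) (auto simp: cinner_add_right cinner_scaleC_right)
  assume g: "g \<in> SU3" and B: "B \<in> perp N"
  have "cinner A (act g B) = 0" if "A \<in> N" for A
  proof -
    have "cinner A (act g B) = cinner (act g (act (dagger g) A)) (act g B)"
      by (simp add: op.inverse g)
    also have "\<dots> = cinner (act (dagger g) A) B" by (simp add: op.unitary g)
    also have "\<dots> = 0" using B assms[OF SU3_dagger[OF g] that] by (simp add: perp_def)
    finally show ?thesis .
  qed
  thus "act g B \<in> perp N" by (simp add: perp_def)
qed

text \<open>The decomposition used is orthogonal for the real inner product; testing also against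
  \<i> A, which lies in N, removes the imaginary part.\<close>

lemma perp_decomp:
  assumes N: "complex_vector.subspace N"
  obtains a b where "v = a + b" "a \<in> N" "b \<in> perp N"
proof -
  have sN: "subspace N" by (rule complex_subspace_imp_subspace[OF N])
  obtain a b where ab: "a \<in> span N" "\<And>w. w \<in> span N \<Longrightarrow> orthogonal b w" "v = a + b"
    using orthogonal_subspace_decomp_exists[of N v] by blast
  have sp: "span N = N" using sN by (simp add: span_eq_iff)
  have "cinner A b = 0" if A: "A \<in> N" for A
  proof -
    have 1: "Re (cinner A b) = 0" if "A \<in> N" for A
      using ab(2)[of A] that by (simp add: sp orthogonal_def Re_cinner inner_commute)
    have "\<i> *\<^sub>C A \<in> N" by (rule complex_vector.subspace_scale[OF N A])
    from 1[OF this] have "Im (cinner A b) = 0" by (simp add: cinner_scaleC_left)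
    thus ?thesis using 1[OF A] by (simp add: complex_eq_iff)
  qed
  thus ?thesis using that[OF ab(3)] ab(1) sp by (auto simp: perp_def)
qed

text \<open>A highest weight vector splits into highest weight vectors along an invariant subspace and its
  orthogonal complement; both are multiples of it, so one of them vanishes.\<close>

lemma invariant_subspace_dichotomy:
  assumes N: "complex_vector.subspace N" "\<And>g A. g \<in> SU3 \<Longrightarrow> A \<in> N \<Longrightarrow> act g A \<in> N" and n: "n \<le> p"
  shows "H n \<subseteq> N \<or> H n \<subseteq> perp N"
proof -
  note M = perp_invariant[of N, OF N(2)]
  interpret N: urep act N by (rule invariant_subspace_rep[OF N])
  interpret M: urep act "perp N" by (rule invariant_subspace_rep[OF M])
  obtain a b where ab: "hw n = a + b" "a \<in> N" "b \<in> perp N" by (rule perp_decomp[OF N(1)])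
  \<comment> \<open>N and its orthogonal complement meet in 0, so an equation for a + b splits into
    equations for a and for b.\<close>
  have z: "x = 0" if "x + y = 0" "x \<in> N" "y \<in> perp N" for x y
  proof -
    have "cinner x y = 0" using that by (simp add: perp_def)
    moreover have "y = - x" using that(1) by (simp add: add_eq_0_iff)
    ultimately have "cinner x x = 0" by (simp add: cinner_minus_right)
    thus ?thesis by (simp add: cinner_eq_zero_iff)
  qed
  have tr: "trace (unit_matrix 1 2) = 0" "trace (unit_matrix 2 3) = 0" by (simp_all add: trace_unit_matrix)
  have T: "T_plus act a = 0"
  proof (rule z[of _ "T_plus act b"])
    show "T_plus act a + T_plus act b = 0"
      using hw_raising(1)[OF n] by (simp add: T_plus_def ab(1) op.sl3_add_right tr)
    show "T_plus act a \<in> N" "T_plus act b \<in> perp N"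
      unfolding T_plus_def by (rule N.sl3_mem[OF tr(1) ab(2)], rule M.sl3_mem[OF tr(1) ab(3)])
  qed
  have U: "U_plus act a = 0"
  proof (rule z[of _ "U_plus act b"])
    show "U_plus act a + U_plus act b = 0"
      using hw_raising(2)[OF n] by (simp add: U_plus_def ab(1) op.sl3_add_right tr)
    show "U_plus act a \<in> N" "U_plus act b \<in> perp N"
      unfolding U_plus_def by (rule N.sl3_mem[OF tr(2) ab(2)], rule M.sl3_mem[OF tr(2) ab(3)])
  qed
  have w: "op.weight_vector (2 * int n) (int n) 0 a"
    unfolding op.weight_vector_def
  proof safe
    fix x y z :: real assume xyz: "x + y + z = 0"
    let ?c = "cis (of_int (2 * int n) * x + of_int (int n) * y + of_int 0 * z)"
    note S = torus_SU3[OF xyz]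
    have "(act (torus x y z) a - ?c *\<^sub>C a) + (act (torus x y z) b - ?c *\<^sub>C b) = 0"
      using op.weight_vectorD[OF hw_weight[OF n] xyz]
      by (simp add: ab(1) op.add S scaleC_add_right algebra_simps)
    from z[OF this N.mem_diff[OF N.mem[OF S ab(2)] N.mem_scaleC[OF ab(2)]]
        M.mem_diff[OF M.mem[OF S ab(3)] M.mem_scaleC[OF ab(3)]]]
    show "act (torus x y z) a = ?c *\<^sub>C a" by simp
  qed
  have a: "a = cinner (hw n) a *\<^sub>C hw n" by (rule hw_unique[OF n T U w])
  have irr: "complex_vector.subspace U \<Longrightarrow> U \<subseteq> H n \<Longrightarrow> (\<And>g A. g \<in> SU3 \<Longrightarrow> A \<in> U \<Longrightarrow> act g A \<in> U)
      \<Longrightarrow> hw n \<in> U \<Longrightarrow> U = H n" for U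
    using H_irrep(1)[OF n] hw_norm[OF n] unfolding irrep_def irreducible_rep_def
    by (metis cinner_zero_left singletonD zero_neq_one)
  have Hinv: "A \<in> H n \<Longrightarrow> g \<in> SU3 \<Longrightarrow> act g A \<in> H n" for g A
    using H_irrep(1)[OF n] by (auto simp: irrep_def unitary_rep_def)
  have Hsub: "complex_vector.subspace (H n)" by (simp add: H_def)
  show ?thesis
  proof (cases "cinner (hw n) a = 0")
    case True
    hence "a = 0" using a by simp
    hence "hw n \<in> perp N" using ab by simp
    hence "perp N \<inter> H n = H n"
      using hw_mem[OF n] M Hinv by (intro irr complex_vector.subspace_inter Hsub) auto
    thus ?thesis by blast
  next
    case False
    have "(1 / cinner (hw n) a) *\<^sub>C a \<in> N" by (rule N.mem_scaleC[OF ab(2)])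
    hence "hw n \<in> N" using False by (subst (asm) a) (simp add: scaleC_scaleC)
    hence "N \<inter> H n = H n"
      using hw_mem[OF n] N Hinv by (intro irr complex_vector.subspace_inter Hsub) auto
    thus ?thesis by blast
  qed
qed

text \<open>Stands in for Schur's lemma: an invariant operator is a highest weight vector of weight
  0, and \<open>hw_unique\<close> at n = 0 applies.\<close>

lemma invariant_operator:
  assumes B: "\<And>g. g \<in> SU3 \<Longrightarrow> act g B = B"
  shows "B = cinner (K0 0) B *\<^sub>C K0 0"
proof -
  have fixd: "act h B = B" if "h \<in> isotropy" for h using B that by (simp add: isotropy_def)
  have d0: "op.d X B = 0" if "X \<in> su3" for X
    by (rule op.dI) (simp add: B mexp_SU3 that)
  have tr: "trace (unit_matrix 1 2) = 0" "trace (unit_matrix 2 3) = 0" by (simp_all add: trace_unit_matrix)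
  have "T_plus act B = 0" "U_plus act B = 0"
    unfolding T_plus_def U_plus_def op.sl3_def
    by (simp_all only: d0 su3_skew_part op.trace_i tr) simp_all
  moreover have "op.weight_vector (2 * int 0) (int 0) 0 B"
    by (simp add: op.weight_vector_def B torus_SU3)
  ultimately have "B = cinner (hw 0) B *\<^sub>C hw 0" by (intro hw_unique) simp
  moreover have "hw 0 = K0 0" by (simp add: hw_def K0_eq)
  ultimately show ?thesis by simp
qed

end

context coupled
begin

subsection \<open>The symbol correspondences\<close>

lemma act_H: "n \<le> p \<Longrightarrow> g \<in> SU3 \<Longrightarrow> A \<in> H n \<Longrightarrow> act g A \<in> H n"
  using H_irrep(1)[of n] by (auto simp: irrep_def unitary_rep_def)

text \<open>The components are invariant and mutually orthogonal, so only the n-th term of the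
  kernel is seen by \<open>H n\<close>.\<close>

lemma cinner_act_combination:
  assumes n: "n \<le> p" and g: "g \<in> SU3" and A: "A \<in> H n"
  shows "cinner (act g (\<Sum>m\<le>p. \<kappa> m *\<^sub>C K0 m)) A = cnj (\<kappa> n) * cinner (act g (K0 n)) A"
proof -
  have "cinner (act g (\<Sum>m\<le>p. \<kappa> m *\<^sub>C K0 m)) A = (\<Sum>m\<le>p. cnj (\<kappa> m) * cinner (act g (K0 m)) A)"
    by (simp add: op.sum g op.scaleC cinner_sum_left cinner_scaleC_left)
  also have "\<dots> = (\<Sum>m\<le>p. if m = n then cnj (\<kappa> n) * cinner (act g (K0 n)) A else 0)"
    using H_orthogonal[OF _ n _ act_H[OF _ g K0_mem] A] by (intro sum.cong) auto
  finally show ?thesis using n by simp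
qed

definition ker_coeff :: "(nat \<Rightarrow> real) \<Rightarrow> nat \<Rightarrow> real"
  where "ker_coeff c n = c n * sqrt ((real n + 1) ^ 3 / irrep_dim P)"

abbreviation ker where "ker \<equiv> operator_kernel P E"

lemma ker_eq: "ker c = (\<Sum>n\<le>p. of_real (ker_coeff c n) *\<^sub>C K0 n)"
  unfolding operator_kernel_def size ker_coeff_def K0_def scaleC_of_real by (simp add: atLeast0AtMost)

lemma ker_isotropy: "h \<in> isotropy \<Longrightarrow> act h (ker c) = ker c"
  unfolding ker_eq by (subst op.sum) (auto simp: isotropy_def op.scaleC K0_isotropy intro!: sum.cong)

lemma ker_self_adjoint: "dagger (ker c) = ker c"
  unfolding ker_eq dagger_sum by (intro sum.cong) (simp_all add: dagger_scaleC K0_self_adjoint)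

lemma kernel_at_ker: "g \<in> SU3 \<Longrightarrow> kernel_at \<rho> (ker c) (cp2_act g base_point) = act g (ker c)"
  by (rule kernel_at_base[OF ker_isotropy])

lemma kernel_at_ker_act:
  assumes g: "g \<in> SU3"
  shows "kernel_at \<rho> (ker c) (cp2_act g x) = act g (kernel_at \<rho> (ker c) x)"
proof -
  obtain h where h: "h \<in> SU3" "x = cp2_act h base_point" by (rule cp2_obtain)
  thus ?thesis
    by (simp add: kernel_at_ker SU3_mult g op.mult cp2_act_mult[symmetric])
qed

lemma kernel_at_self_adjoint: "dagger (kernel_at \<rho> (ker c) x) = kernel_at \<rho> (ker c) x"
proof -
  obtain g where g: "g \<in> SU3" "x = cp2_act g base_point" by (rule cp2_obtain)
  thus ?thesis by (simp add: kernel_at_ker act_dagger ker_self_adjoint)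
qed

lemma trace_kernel_at:
  "g \<in> SU3 \<Longrightarrow> trace (A ** kernel_at \<rho> (ker c) (cp2_act g base_point)) = cinner (act g (ker c)) A"
  by (subst trace_cinner_self_adjoint[OF kernel_at_self_adjoint]) (simp add: kernel_at_ker)

lemma trace_act: "g \<in> SU3 \<Longrightarrow> trace (act g A) = trace A"
  using trace_operator_action[OF rep, of g "mat 1" A]
  by (simp add: act_eq SU3_dagger rho_dagger rho_unitary)

lemma trace_K0: assumes n: "n \<le> p" shows "trace (K0 n) = (if n = 0 then of_real (sqrt (irrep_dim P)) else 0)"
proof -
  have 1: "mat 1 = sqrt (irrep_dim P) *\<^sub>R K0 0" using dim_pos by (simp add: K0_0)
  have "trace (K0 n) = cinner (mat 1) (K0 n)" by (simp add: cinner_matrix)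
  hence "trace (K0 n) = of_real (sqrt (irrep_dim P)) * cinner (K0 0) (K0 n)"
    by (simp only: 1 cinner_scaleR_left)
  thus ?thesis using K0_orthonormal[of 0 n] n by simp
qed

lemma trace_ker: assumes "c 0 = 1" shows "trace (ker c) = 1"
proof -
  have "trace (ker c) = (\<Sum>n\<le>p. of_real (ker_coeff c n) * trace (K0 n))"
  proof -
    have "trace (\<Sum>n\<in>I. f n) = (\<Sum>n\<in>I. trace (f n))" for I :: "nat set" and f :: "nat \<Rightarrow> complex^'d^'d"
      unfolding trace_def by (simp add: sum.swap[of _ _ I])
    thus ?thesis by (simp add: ker_eq trace_scaleC)
  qed
  also have "\<dots> = (\<Sum>n\<le>p. if n = 0 then of_real (ker_coeff c 0 * sqrt (irrep_dim P)) else 0)"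
    by (intro sum.cong) (auto simp: trace_K0)
  also have "\<dots> = 1" using assms dim_pos by (simp add: ker_coeff_def real_sqrt_divide)
  finally show ?thesis .
qed

lemma coeff_nonzero: "c n \<noteq> 0 \<Longrightarrow> ker_coeff c n \<noteq> 0"
  using dim_pos by (simp add: ker_coeff_def add_pos_pos)

text \<open>The operators orthogonal to the orbit of the kernel form an invariant subspace N. It
  misses \<open>K0 n\<close> because c n is nonzero, so by the dichotomy every \<open>H n\<close> is
  orthogonal to N, and N = 0.\<close>

lemma kernel_injective:
  assumes c: "\<And>n. n \<le> p \<Longrightarrow> c n \<noteq> 0" and A: "\<And>g. g \<in> SU3 \<Longrightarrow> cinner (act g (ker c)) A = 0"
  shows "A = 0"
proof -
  define N where "N = {A. \<forall>g\<in>SU3. cinner (act g (ker c)) A = 0}"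
  have N: "complex_vector.subspace N"
    unfolding N_def by (rule complex_vector.subspaceI) (auto simp: cinner_add_right cinner_scaleC_right)
  have Ninv: "act g B \<in> N" if g: "g \<in> SU3" and B: "B \<in> N" for g B
  proof -
    have "cinner (act h (ker c)) (act g B) = 0" if h: "h \<in> SU3" for h
    proof -
      have "cinner (act h (ker c)) (act g B) = cinner (act g (act (dagger g ** h) (ker c))) (act g B)"
        by (simp add: op.mult SU3_dagger g h op.inverse)
      also have "\<dots> = cinner (act (dagger g ** h) (ker c)) B" by (simp add: op.unitary g)
      also have "\<dots> = 0" using B SU3_mult[OF SU3_dagger[OF g] h] by (simp add: N_def)
      finally show ?thesis .
    qed
    thus ?thesis by (simp add: N_def)
  qed
  have H: "H n \<subseteq> perp N" if n: "n \<le> p" for n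
  proof -
    have "K0 n \<notin> N"
    proof
      assume "K0 n \<in> N"
      hence "cinner (act (mat 1) (ker c)) (K0 n) = 0" unfolding N_def using SU3_one by blast
      hence "ker_coeff c n = 0"
        using cinner_act_combination[OF n SU3_one K0_mem[OF n], of "\<lambda>m. of_real (ker_coeff c m)"]
        by (simp add: ker_eq op.one K0_orthonormal n)
      thus False using coeff_nonzero[of c n, OF c[OF n]] by simp
    qed
    thus ?thesis using invariant_subspace_dichotomy[OF N Ninv n] K0_mem[OF n] by blast
  qed
  have AN: "A \<in> N" using A by (simp add: N_def)
  show ?thesis
  proof (rule operator_eqI)
    fix n \<nu> J assume "n \<le> p" "(\<nu>, J) \<in> gt_labels (n, n)"
    hence "E n \<nu> J \<in> perp N" using H gt.e_mem[OF H_gt] by blast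
    hence "cinner A (E n \<nu> J) = 0" using AN by (simp add: perp_def)
    thus "cinner (E n \<nu> J) A = cinner (E n \<nu> J) 0"
      using cinner_commute[of "E n \<nu> J" A] by simp
  qed
qed

text \<open>Invariance of the measure makes the operator-valued integral an invariant operator,
  hence a multiple of the identity, and its trace is 1. Integrability holds because unitarity keeps
  the norm of the kernel constant.\<close>

lemma kernel_integral:
  assumes M: "invariant_probability M" and c: "c 0 = 1"
  shows "(\<integral>x. trace (A ** kernel_at \<rho> (ker c) x) \<partial>M) = trace A / of_real (irrep_dim P)"
proof -
  interpret invariant_measure M by standard (rule M)
  let ?K = "kernel_at \<rho> (ker c)"
  have cont: "continuous_on UNIV ?K" by (rule kernel_continuous[OF ker_isotropy])
  have "norm (?K x) = norm (ker c)" for x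
  proof -
    obtain g where g: "g \<in> SU3" "x = cp2_act g base_point" by (rule cp2_obtain)
    thus ?thesis by (simp add: kernel_at_ker op.norm)
  qed
  hence int: "integrable M ?K" by (intro integrable[OF cont, of "norm (ker c)"]) simp
  define B where "B = (\<integral>x. ?K x \<partial>M)"
  have T: "(\<integral>x. T (?K x) \<partial>M) = T B" if "bounded_linear T" for T :: "complex^'d^'d \<Rightarrow> 'b::euclidean_space"
    unfolding B_def by (rule integral_bounded_linear[OF that int])
  have inv: "act g B = B" if g: "g \<in> SU3" for g
  proof -
    have "bounded_linear (act g)"
      by (intro linear_conv_bounded_linear[THEN iffD1] linearI) (simp_all add: op.add op.scaleR g)
    from T[OF this] have "act g B = (\<integral>x. ?K (cp2_act g x) \<partial>M)"
      by (simp add: kernel_at_ker_act g)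
    also have "\<dots> = B" unfolding B_def by (rule integral_invariant[OF cont g])
    finally show ?thesis .
  qed
  obtain \<beta> where \<beta>: "B = \<beta> *\<^sub>C mat 1"
    using invariant_operator[OF inv] unfolding K0_0 by (metis scaleC_scaleR)
  have "trace (?K x) = 1" for x
  proof -
    obtain g where g: "g \<in> SU3" "x = cp2_act g base_point" by (rule cp2_obtain)
    thus ?thesis by (simp add: kernel_at_ker trace_act trace_ker[of c, OF c])
  qed
  hence "trace B = 1"
    using T[OF bounded_linear_trace_mult[of "mat 1"]] measure_UNIV by simp
  hence "\<beta> = 1 / of_real (irrep_dim P)"
    using dim_pos by (simp add: \<beta> trace_scaleC trace_one field_simps)
  thus ?thesis by (simp add: T[OF bounded_linear_trace_mult] \<beta> matrix_scaleC_right trace_scaleC)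
qed

lemma symbol_correspondenceI:
  assumes M: "invariant_probability M" and c0: "c 0 = 1" and c: "\<And>n. n \<in> {1..p} \<Longrightarrow> c n \<noteq> 0"
    and W: "\<And>A x. W A x = trace (A ** kernel_at \<rho> (ker c) x)"
  shows "symbol_correspondence \<rho> P M W"
  unfolding symbol_correspondence_def
proof (intro conjI allI ballI)
  have cn: "c n \<noteq> 0" if "n \<le> p" for n using c0 c[of n] that by (cases "n = 0") auto
  fix A :: "complex^'d^'d"
  from kernel_smooth[OF ker_isotropy bounded_linear_trace_mult] show "cp2_smooth (W A)" by (simp add: W[abs_def])
  show "W (A + B) x = W A x + W B x" for B x by (simp add: W matrix_mult_add_left trace_add)
  show "W (a *\<^sub>C A) x = a * W A x" for a x by (simp add: W matrix_scaleC_left trace_scaleC)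
  show "inj W"
  proof (rule injI)
    fix A B assume "W A = W B"
    hence "cinner (act g (ker c)) A = cinner (act g (ker c)) B" if "g \<in> SU3" for g
      using trace_kernel_at[OF that] W by metis
    hence "A - B = 0" by (intro kernel_injective[OF cn]) (simp_all add: cinner_diff_right)
    thus "A = B" by simp
  qed
  show "W (act g A) x = W A (cp2_act (matrix_inv g) x)" if g: "g \<in> SU3" for g x
    using trace_operator_action[OF rep SU3_dagger[OF g], of A "kernel_at \<rho> (ker c) x"]
    by (simp add: W SU3_matrix_inv[OF g] kernel_at_ker_act SU3_dagger g)
  show "W (dagger A) x = cnj (W A x)" for x
  proof -
    have "cnj (W A x) = trace (dagger (A ** kernel_at \<rho> (ker c) x))" by (simp only: W trace_dagger)
    also have "\<dots> = trace (kernel_at \<rho> (ker c) x ** dagger A)"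
      by (simp add: dagger_mult kernel_at_self_adjoint)
    finally show ?thesis using trace_mul_sym W by metis
  qed
  show "(\<integral>x. W A x \<partial>M) = trace A / of_real (irrep_dim P)"
    using kernel_integral[of M c A, OF M c0] by (simp add: W)
qed

lemma trace_form_eqI:
  fixes X Y :: "complex^'d^'d"
  assumes "\<And>A :: complex^'d^'d. trace (A ** X) = trace (A ** Y)" shows "X = Y"
proof -
  have "cinner (X - Y) (X - Y) = trace (dagger (X - Y) ** X) - trace (dagger (X - Y) ** Y)"
    by (simp add: cinner_matrix bounded_bilinear.diff_right[OF bounded_bilinear_matrix_mult] trace_sub)
  thus ?thesis using assms by (simp add: cinner_eq_zero_iff)
qed

lemma linear_functional_trace:
  fixes \<phi> :: "complex^'d^'d \<Rightarrow> complex"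
  assumes add: "\<And>A B. \<phi> (A + B) = \<phi> A + \<phi> B" and scale: "\<And>a A. \<phi> (a *\<^sub>C A) = a * \<phi> A"
  obtains K where "\<And>A. \<phi> A = trace (A ** K)"
proof
  define U :: "'d \<Rightarrow> 'd \<Rightarrow> complex^'d^'d" where "U i j = (\<chi> a b. if a = i \<and> b = j then 1 else 0)" for i j
  fix A :: "complex^'d^'d"
  have z: "\<phi> 0 = 0" using scale[of 0 0] by simp
  have s: "\<phi> (\<Sum>i\<in>I. f i) = (\<Sum>i\<in>I. \<phi> (f i))" for I :: "'d set" and f
    by (induction I rule: infinite_finite_induct) (simp_all add: z add)
  have "A = (\<Sum>i\<in>UNIV. \<Sum>j\<in>UNIV. (A $ i $ j) *\<^sub>C U i j)"
  proof -
    have "(\<Sum>i\<in>UNIV. \<Sum>j\<in>UNIV. (A $ i $ j) *\<^sub>C U i j) $ a $ b = A $ a $ b" for a b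
    proof -
      have "(\<Sum>j\<in>UNIV. (A $ i $ j) * (if a = i \<and> b = j then 1 else 0)) = (if i = a then A $ a $ b else 0)" for i
      proof -
        have "(\<Sum>j\<in>UNIV. (A $ i $ j) * (if a = i \<and> b = j then 1 else 0))
            = (\<Sum>j\<in>UNIV. if j = b then (if i = a then A $ a $ b else 0) else 0)"
          by (intro sum.cong) auto
        thus ?thesis by simp
      qed
      thus ?thesis by (simp add: U_def)
    qed
    thus ?thesis by (simp add: vec_eq_iff)
  qed
  hence "\<phi> A = \<phi> (\<Sum>i\<in>UNIV. \<Sum>j\<in>UNIV. (A $ i $ j) *\<^sub>C U i j)" by simp
  thus "\<phi> A = trace (A ** (\<chi> j i. \<phi> (U i j)))"
    by (simp add: s scale trace_def matrix_matrix_mult_def)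
qed

lemma symbol_correspondenceD:
  assumes M: "invariant_probability M" and W: "symbol_correspondence \<rho> P M W"
  shows "\<exists>c. c 0 = 1 \<and> (\<forall>n\<in>{1..p}. c n \<noteq> 0) \<and>
    (\<forall>A x. W A x = trace (A ** kernel_at \<rho> (ker c) x))"
proof -
  interpret invariant_measure M by standard (rule M)
  note Wd = W[unfolded symbol_correspondence_def]
  obtain K where K: "\<And>A. W A base_point = trace (A ** K)"
    using linear_functional_trace[of "\<lambda>A. W A base_point"] Wd by auto
  have Wg: "W A (cp2_act g base_point) = trace (A ** act g K)" if g: "g \<in> SU3" for A g
  proof -
    have "W (act (dagger g) A) base_point = W A (cp2_act (matrix_inv (dagger g)) base_point)"
      using Wd SU3_dagger[OF g] by blast
    thus ?thesis
      by (simp add: SU3_matrix_inv SU3_dagger g K trace_operator_action[OF rep g])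
  qed
  \<comment> \<open>Elements of the isotropy group do not move the base point, and the functionals A
    -> tr(A X) separate operators.\<close>
  have fixd: "act h K = K" if h: "h \<in> isotropy" for h
  proof (rule trace_form_eqI)
    fix A :: "complex^'d^'d"
    have S: "h \<in> SU3" using h by (simp add: isotropy_def)
    have "cp2_act (mat 1) base_point = cp2_act h base_point"
      using cp2_act_base_eq_iff[OF SU3_one S] h by simp
    hence "W A (cp2_act h base_point) = W A (cp2_act (mat 1) base_point)" by simp
    thus "trace (A ** act h K) = trace (A ** K)"
      by (simp add: Wg S SU3_one op.one)
  qed
  have K_adj: "dagger K = K"
  proof (rule trace_form_eqI)
    fix A :: "complex^'d^'d"
    have "W (dagger A) base_point = cnj (W A base_point)" using Wd by blast
    hence "trace (dagger A ** K) = trace (dagger (A ** K))" by (simp add: K trace_dagger)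
    hence "trace (dagger (dagger A ** K)) = trace (A ** K)" by (simp add: trace_dagger)
    thus "trace (A ** dagger K) = trace (A ** K)" using trace_mul_sym[of "dagger K" A] by (simp add: dagger_mult)
  qed
  define \<kappa> where "\<kappa> n = cinner (K0 n) K" for n
  have K_sum: "K = (\<Sum>n\<le>p. \<kappa> n *\<^sub>C K0 n)"
    unfolding \<kappa>_def by (rule isotropy_fixed_expand[OF fixd])
  have \<kappa>_real: "\<kappa> n = of_real (Re (\<kappa> n))" if n: "n \<le> p" for n
  proof -
    have "cnj (\<kappa> n) = cinner K (K0 n)" unfolding \<kappa>_def by (metis cinner_commute)
    also have "\<dots> = trace (K ** K0 n)" by (simp add: cinner_matrix K_adj)
    also have "\<dots> = \<kappa> n" by (simp add: trace_mul_sym[of K] \<kappa>_def cinner_matrix K0_self_adjoint n)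
    finally show ?thesis by (simp add: complex_eq_iff)
  qed
  \<comment> \<open>The coefficients of K in the orthonormal family \<open>K0\<close>, real by
    \<open>\<kappa>_real\<close>, divided by the normalization built into
    \<open>operator_kernel\<close>.\<close>
  define c where "c n = Re (\<kappa> n) / sqrt ((real n + 1) ^ 3 / irrep_dim P)" for n
  have "ker_coeff c n = Re (\<kappa> n)" for n
    using dim_pos by (simp add: ker_coeff_def c_def)
  hence ker_K: "ker c = K"
    unfolding ker_eq by (subst K_sum, intro sum.cong) (simp_all flip: \<kappa>_real)
  have c0: "c 0 = 1"
  proof -
    \<comment> \<open>The symbol of the identity is constant, so the integral condition at the
      identity forces trace K = 1, which fixes the coefficient of \<open>K0 0\<close>.\<close>
    have "W (mat 1) x = trace K" for x
    proof -
      obtain g where g: "g \<in> SU3" "x = cp2_act g base_point" by (rule cp2_obtain)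
      thus ?thesis by (simp add: Wg trace_act)
    qed
    hence "(\<integral>x. W (mat 1) x \<partial>M) = trace K" using measure_UNIV by simp
    moreover have "(\<integral>x. W (mat 1) x \<partial>M) = trace (mat 1 :: complex^'d^'d) / of_real (irrep_dim P)"
      using Wd by blast
    ultimately have "trace K = 1" using dim_pos by (simp add: trace_one)
    moreover have "\<kappa> 0 = of_real (1 / sqrt (irrep_dim P)) * trace K"
      unfolding \<kappa>_def K0_0 cinner_scaleR_left by (simp add: cinner_matrix)
    ultimately have "Re (\<kappa> 0) = 1 / sqrt (irrep_dim P)" by simp
    thus ?thesis using dim_pos by (simp add: c_def real_sqrt_divide)
  qed
  have WK: "W A x = trace (A ** kernel_at \<rho> (ker c) x)" for A x
  proof -
    obtain g where g: "g \<in> SU3" "x = cp2_act g base_point" by (rule cp2_obtain)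
    show ?thesis using kernel_at_ker[OF g(1), of c] by (simp add: Wg g ker_K)
  qed
  have "c n \<noteq> 0" if n: "n \<in> {1..p}" for n
  proof
    assume "c n = 0"
    hence 0: "ker_coeff c n = 0" by (simp add: ker_coeff_def)
    \<comment> \<open>Without its n-th term the kernel is orthogonal to \<open>H n\<close> along the
      whole orbit, so the nonzero operator \<open>K0 n\<close> would have zero symbol.\<close>
    have "W (K0 n) x = W 0 x" for x
    proof -
      obtain g where g: "g \<in> SU3" "x = cp2_act g base_point" by (rule cp2_obtain)
      have "cinner (act g (ker c)) (K0 n) = 0"
        unfolding ker_eq using n by (subst cinner_act_combination[OF _ g(1) K0_mem]) (simp_all add: 0)
      thus ?thesis using trace_kernel_at[OF g(1), of _ c] by (simp only: WK g(2) cinner_zero_right)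
    qed
    hence "W (K0 n) = W 0" by auto
    hence "K0 n = 0" using Wd by (auto dest: injD)
    thus False using K0_orthonormal[of n n] n by simp
  qed
  thus ?thesis using c0 WK by blast
qed

lemma ker_identity:
  assumes "c 0 = 1"
  shows "ker c = (1 / irrep_dim P) *\<^sub>R mat 1
    + (\<Sum>n=1..p. (c n * sqrt ((real n + 1) ^ 3 / irrep_dim P)) *\<^sub>R E n (zero_weight n) 0)"
proof -
  have "ker c = (c 0 * sqrt ((real 0 + 1) ^ 3 / irrep_dim P)) *\<^sub>R K0 0
      + (\<Sum>n=1..p. (c n * sqrt ((real n + 1) ^ 3 / irrep_dim P)) *\<^sub>R E n (zero_weight n) 0)"
    unfolding operator_kernel_def size K0_def by (subst sum.atLeast_Suc_atMost) simp_all
  also have "(c 0 * sqrt ((real 0 + 1) ^ 3 / irrep_dim P)) *\<^sub>R K0 0 = (1 / irrep_dim P) *\<^sub>R mat 1"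
    using assms dim_pos by (simp add: K0_0 real_sqrt_divide)
  finally show ?thesis .
qed

text \<open>Pairing with the n-th component leaves a Wigner function of \<open>H n\<close>, which
  \<open>gt_matrix_elements\<close> identifies with that of the arbitrary realization \<sigma>. The
  factor sqrt(dim) cancels the one in the kernel.\<close>

lemma symbol_of_basis:
  fixes \<sigma> :: "complex^3^3 \<Rightarrow> 'v \<Rightarrow> 'v::complex_euclidean"
  assumes n: "n \<le> p" and l: "(\<nu>, J) \<in> gt_labels (n, n)" and cn: "c n \<noteq> 0"
    and \<sigma>: "irrep \<sigma> V (n, n)" and f: "gt_basis \<sigma> V (n, n) f"
  shows "trace ((sqrt (irrep_dim P) *\<^sub>R E n \<nu> J) ** kernel_at \<rho> (ker c) x)
    = of_real (c n) * harmonic \<sigma> f n \<nu> J x"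
proof -
  have gt: "gt \<sigma> V n n f"
    using \<sigma> f by unfold_locales (simp_all add: irrep_def)
  define w where "w g = of_real ((real n + 1) powr (3 / 2)) * cnj (wigner \<sigma> f \<nu> J (zero_weight n) 0 g)" for g
  have mem: "E n \<nu> J \<in> H n" by (rule gt.e_mem[OF H_gt[OF n] l])
  have main: "trace ((sqrt (irrep_dim P) *\<^sub>R E n \<nu> J) ** kernel_at \<rho> (ker c) (cp2_act g base_point))
      = of_real (c n) * w g" if g: "g \<in> SU3" for g
  proof -
    have "cinner (act g (ker c)) (E n \<nu> J) = of_real (ker_coeff c n) * cinner (act g (K0 n)) (E n \<nu> J)"
      unfolding ker_eq by (subst cinner_act_combination[OF n g mem]) simp
    also have "cinner (act g (K0 n)) (E n \<nu> J) = cnj (cinner (E n \<nu> J) (act g (E n (zero_weight n) 0)))"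
      unfolding K0_def by (rule cinner_commute)
    also have "cinner (E n \<nu> J) (act g (E n (zero_weight n) 0)) = wigner \<sigma> f \<nu> J (zero_weight n) 0 g"
      unfolding wigner_def by (rule gt_matrix_elements[OF H_gt[OF n] gt g l zero_label])
    finally have 1: "cinner (act g (ker c)) (sqrt (irrep_dim P) *\<^sub>R E n \<nu> J)
        = of_real (sqrt (irrep_dim P) * ker_coeff c n) * cnj (wigner \<sigma> f \<nu> J (zero_weight n) 0 g)"
      by (simp add: cinner_scaleR_right)
    have 2: "sqrt (irrep_dim P) * ker_coeff c n = c n * (real n + 1) powr (3 / 2)"
    proof -
      have "(real n + 1) powr (3 / 2) = sqrt ((real n + 1) ^ 3)"
      proof -
        have "sqrt ((real n + 1) ^ 3) = ((real n + 1) powr real 3) powr (1 / 2)"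
          by (subst powr_realpow) (simp_all add: powr_half_sqrt)
        also have "\<dots> = (real n + 1) powr (real 3 * (1 / 2))" by (rule powr_powr)
        finally show ?thesis by simp
      qed
      thus ?thesis using dim_pos by (simp add: ker_coeff_def real_sqrt_divide)
    qed
    show ?thesis unfolding trace_kernel_at[OF g] 1 2 w_def by simp
  qed
  \<comment> \<open>The descent condition is not checked in \<sigma>: the trace in
    \<open>main\<close> depends on the point g x_0 only, and dividing by the nonzero c n passes this
    on to w.\<close>
  have "w (g ** h) = w g" if g: "g \<in> SU3" and h: "h \<in> isotropy" for g h
  proof -
    have S: "h \<in> SU3" using h by (simp add: isotropy_def)
    have "dagger g ** (g ** h) \<in> isotropy" using h by (simp add: matrix_mul_assoc SU3_inverse[OF g])
    hence "cp2_act g base_point = cp2_act (g ** h) base_point"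
      using cp2_act_base_eq_iff[OF g SU3_mult[OF g S]] by simp
    hence "of_real (c n) * w (g ** h) = of_real (c n) * w g"
      using main[OF SU3_mult[OF g S]] main[OF g] by simp
    thus ?thesis using cn by simp
  qed
  hence "harmonic \<sigma> f n \<nu> J (cp2_act g base_point) = w g" if "g \<in> SU3" for g
    unfolding harmonic_def w_def[symmetric] using that by (intro descend_eq) auto
  moreover obtain g where "g \<in> SU3" "x = cp2_act g base_point" by (rule cp2_obtain)
  ultimately show ?thesis using main by simp
qed

end

theorem theorem4p8:
  fixes p :: nat and P :: "nat \<times> nat"
    and \<rho> :: "complex^3^3 \<Rightarrow> complex^'d^'d"
    and e :: "weight \<Rightarrow> real \<Rightarrow> complex^'d"
    and E :: "nat \<Rightarrow> weight \<Rightarrow> real \<Rightarrow> complex^'d^'d"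
    and M :: "cp2 measure"
    and W :: "complex^'d^'d \<Rightarrow> cp2 \<Rightarrow> complex"
  assumes "p \<ge> 1" and "P = (p, 0) \<or> P = (0, p)"
    and "irrep (vector_action \<rho>) UNIV P"
    and "gt_basis (vector_action \<rho>) UNIV P e"
    and "coupled_basis \<rho> P e E"
    and "invariant_probability M"
  shows "(symbol_correspondence \<rho> P M W \<longleftrightarrow>
            (\<exists>c. c 0 = 1 \<and> (\<forall>n\<in>{1..p}. c n \<noteq> 0) \<and>
                 (\<forall>A x. W A x = trace (A ** kernel_at \<rho> (operator_kernel P E c) x))))
    \<and> (\<forall>c. c 0 = 1 \<and> (\<forall>n\<in>{1..p}. c n \<noteq> 0) \<longrightarrow>
          operator_kernel P E c = (1 / irrep_dim P) *\<^sub>R mat 1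
            + (\<Sum>n=1..p. (c n * sqrt ((real n + 1) ^ 3 / irrep_dim P)) *\<^sub>R E n (zero_weight n) 0))
    \<and> (\<forall>c. c 0 = 1 \<and> (\<forall>n\<in>{1..p}. c n \<noteq> 0) \<and>
             (\<forall>A x. W A x = trace (A ** kernel_at \<rho> (operator_kernel P E c) x)) \<longrightarrow>
          (\<forall>n\<le>p. \<forall>(\<nu>, J)\<in>gt_labels (n, n).
             \<forall>(\<sigma> :: complex^3^3 \<Rightarrow> 'v \<Rightarrow> 'v::complex_euclidean) V f.
               irrep \<sigma> V (n, n) \<and> gt_basis \<sigma> V (n, n) f \<longrightarrow>
               (\<forall>x. W (sqrt (irrep_dim P) *\<^sub>R E n \<nu> J) x = of_real (c n) * harmonic \<sigma> f n \<nu> J x)))"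
proof -
  interpret coupled p P \<rho> e E by standard (use assms in auto)
  have 1: "symbol_correspondence \<rho> P M W \<longleftrightarrow>
      (\<exists>c. c 0 = 1 \<and> (\<forall>n\<in>{1..p}. c n \<noteq> 0) \<and> (\<forall>A x. W A x = trace (A ** kernel_at \<rho> (ker c) x)))"
    using symbol_correspondenceD[OF assms(6)] symbol_correspondenceI[OF assms(6)] by blast
  have 2: "W (sqrt (irrep_dim P) *\<^sub>R E n \<nu> J) x = of_real (c n) * harmonic \<sigma> f n \<nu> J x"
    if "c 0 = 1" "\<forall>n\<in>{1..p}. c n \<noteq> 0" "\<forall>A x. W A x = trace (A ** kernel_at \<rho> (ker c) x)"
      "n \<le> p" "(\<nu>, J) \<in> gt_labels (n, n)" "irrep \<sigma> V (n, n)" "gt_basis \<sigma> V (n, n) f"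
    for c n \<nu> J x f V and \<sigma> :: "complex^3^3 \<Rightarrow> 'v \<Rightarrow> 'v"
  proof -
    have "c n \<noteq> 0" using that by (cases "n = 0") auto
    thus ?thesis using symbol_of_basis that by metis
  qed
  show ?thesis
    using 1 ker_identity 2 by (intro conjI allI impI ballI) auto
qed

end
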